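(* Let $\lambda_P$ be any partition having at least one block of size $2$ and let $\lambda_S$ be a non-empty partition whose blocks have size at least $4$. Then the lower central series of $\mathbf{wB}(\lambda_P,\varnothing,\lambda_S)$ stops at $\Gamma_3$. Moreover, $\mathcal{L}_2(\mathbf{wB}(\lambda_P,\varnothing,\lambda_S))$ has a $(\mathbb{Z}/2)$-basis consisting of the brackets $[t_i,x_{ij}]$, for $i\in I_P$ with $n_i=2$ and $j\in I_S$, and all the other brackets of two of the generators $s_i$, $t_i$, $r_i$, $x_{ij}$ of $\mathbf{wB}(\lambda_P,\varnothing,\lambda_S)^{\mathrm{ab}}$ are trivial in the Lie ring $\mathcal{L}(\mathbf{wB}(\lambda_P,\varnothing,\lambda_S))$.
   Context: For a group $G$, $\Gamma_1(G) = G$ and $\Gamma_{i}(G) = [G, \Gamma_{i-1}(G)]$ for $i \geq 2$. The lower central series of $G$ stops at $\Gamma_k$ if $k$ is the smallest integer $i\geq 1$ with $\Gamma_i(G) = \Gamma_{i+1}(G)$. $\mathcal{L}(G)=\bigoplus_{i\geq 1}\mathcal{L}_i(G)$, with $\mathcal{L}_i(G)=\Gamma_i(G)/\Gamma_{i+1}(G)$, is the graded Lie ring whose bracket is induced by commutators in $G$; $\mathcal{L}_1(G)=G^{\mathrm{ab}}$. Let $\lambda_P$ and $\lambda_S$ be partitions (tuples of positive integers) of $n_P$ and $n_S$, let $n=n_P+n_S$, and let $\lambda=(n_1,\ldots,n_l)$ be the concatenation of $\lambda_P$ and $\lambda_S$; $I_P=\{1,\ldots,l_P\}$ and $I_S=\{l_P+1,\ldots,l\}$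 are the indices of the blocks coming from $\lambda_P$ (of length $l_P$) and $\lambda_S$. Let $\mathfrak{S}_\lambda=\mathfrak{S}_{n_1}\times\cdots\times\mathfrak{S}_{n_l}\subseteq\mathfrak{S}_n$ be the subgroup preserving the consecutive blocks of sizes $n_1,\ldots,n_l$. The group $\mathbf{wB}(\lambda_P,\varnothing,\lambda_S)$ is the fundamental group of the space of configurations, in the $3$-disc, of $n_P$ points and $n_S$ unoriented circles, all disjoint, the circles being unlinked and unknotted, where points (resp. circles) are ordered up to permutations in $\mathfrak{S}_{\lambda_P}$ (resp. $\mathfrak{S}_{\lambda_S}$). It identifies (via the Artin representation on the free group $\mathbf{F}_n=\langle x_1,\ldots,x_n\rangle$) with the subgroup of $\mathrm{Aut}(\mathbf{F}_n)$ of automorphisms of the form $x_i\mapsto w_i x_{\sigma(i)}^{\epsilon_i}w_i^{-1}$ with $\sigma\in\mathfrak{S}_\lambda$, $w_i\in\langle x_{n_P+1},\ldots,x_n\rangle$, $\epsilon_i\in\{\pm1\}$ and $\epsilon_i=1$ if $i\leq n_P$. Consider the automorphisms of $\mathbf{F}_n$ (unmentioned generators are fixed): $\tau_\alpha$ exchanges $x_\alpha$ and $x_{\alpha+1}$; $\sigma_\alpha: x_\alpha\mapsto x_\alpha x_{\alpha+1}x_\alpha^{-1},\ x_{\alpha+1}\mapsto x_\alpha$; $\rho_\alpha:x_\alpha\mapsto x_\alpha^{-1}$; $\chi_{\alpha\beta}:x_\alpha\mapsto x_\beta x_\alpha x_\beta^{-1}$. The generators of $\mathbf{wB}(\lambda_P,\varnothing,\lambda_S)^{\mathrm{ab}}$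 are: \begin{itemize} \item $s_i$, for $i\in I_S$ with $n_i\geq 2$: the common class of the $\sigma_\alpha$ with $\alpha,\alpha+1$ in the $i$-th block of $\lambda$; \item $t_i$, for $i\in\{1,\ldots,l\}$ with $n_i\geq 2$: the common class of the $\tau_\alpha$ with $\alpha,\alpha+1$ in the $i$-th block; \item $r_i$, for $i\in I_S$: the common class of the $\rho_\alpha$ with $\alpha$ in the $i$-th block; \item $x_{ij}$, for $j\in I_S$ and $i\in\{1,\ldots,l\}$ with $i\neq j$: the common class of the $\chi_{\alpha\beta}$ with $\alpha$ in the $i$-th block and $\beta$ in the $j$-th block. \end{itemize} "All the other brackets" means all brackets of two of these generators other than the $[t_i,x_{ij}]$ listed (and their opposites $[x_{ij},t_i]$). *)

theory Defs
  imports
    "HOL-Algebra.Bij"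
    "HOL-Algebra.Coset"
    "HOL-Algebra.Generated_Groups"
    "HOL-Algebra.Module"
    "HOL-Number_Theory.Residues"
    "HOL-Combinatorics.Permutations"
begin

section \<open>The lower central series and its graded Lie ring\<close>

definition commutator :: "('a, 'b) monoid_scheme \<Rightarrow> 'a \<Rightarrow> 'a \<Rightarrow> 'a" where
  "commutator G a b = a \<otimes>\<^bsub>G\<^esub> b \<otimes>\<^bsub>G\<^esub> inv\<^bsub>G\<^esub> a \<otimes>\<^bsub>G\<^esub> inv\<^bsub>G\<^esub> b"

definition commutator_subgroup :: "('a, 'b) monoid_scheme \<Rightarrow> 'a set \<Rightarrow> 'a set \<Rightarrow> 'a set" where
  "commutator_subgroup G H K = generate G {commutator G h k | h k. h \<in> H \<and> k \<in> K}"

text \<open>Indexing starts at 1; the value at 0 is junk.\<close>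

fun lower_central :: "('a, 'b) monoid_scheme \<Rightarrow> nat \<Rightarrow> 'a set" where
  "lower_central G 0 = carrier G"
| "lower_central G (Suc 0) = carrier G"
| "lower_central G (Suc (Suc i)) =
     commutator_subgroup G (carrier G) (lower_central G (Suc i))"

definition lcs_stops_at :: "('a, 'b) monoid_scheme \<Rightarrow> nat \<Rightarrow> bool" where
  "lcs_stops_at G k \<longleftrightarrow>
     1 \<le> k \<and> lower_central G k = lower_central G (k + 1) \<and>
     (\<forall>i. 1 \<le> i \<and> i < k \<longrightarrow> lower_central G i \<noteq> lower_central G (i + 1))"

text \<open>The graded Lie ring is given by its homogeneous components, which are written
  multiplicatively (as in \<^const>\<open>FactGroup\<close>), and by the brackets
  between them.\<close>

definition lie_component :: "('a, 'b) monoid_scheme \<Rightarrow> nat \<Rightarrow> 'a set monoid" where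
  "lie_component G i = (G\<lparr>carrier := lower_central G i\<rparr>) Mod (lower_central G (i + 1))"

text \<open>The bracket of degrees \<open>i\<close> and \<open>j\<close>: all the cosets in this union are equal, because the
  class of the commutator does not depend on the chosen representatives.\<close>

definition lie_bracket ::
    "('a, 'b) monoid_scheme \<Rightarrow> nat \<Rightarrow> nat \<Rightarrow> 'a set \<Rightarrow> 'a set \<Rightarrow> 'a set" where
  "lie_bracket G i j A B =
     (\<Union>a\<in>A. \<Union>b\<in>B. lower_central G (i + j + 1) #>\<^bsub>G\<^esub> commutator G a b)"

definition ab_class :: "('a, 'b) monoid_scheme \<Rightarrow> 'a \<Rightarrow> 'a set" where
  "ab_class G g = lower_central G 2 #>\<^bsub>G\<^esub> g"


section \<open>Bases of modules\<close>

text \<open>A multiplicatively written abelian group of exponent dividing \<open>m\<close> is a module over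
  \<open>\<int>/m\<close>. (The ring multiplication that the record type demands plays no role.)\<close>

definition zmod_module :: "('a, 'b) monoid_scheme \<Rightarrow> (int, 'a) module" where
  "zmod_module A =
     \<lparr>carrier = carrier A, monoid.mult = undefined, monoid.one = undefined,
      ring.zero = \<one>\<^bsub>A\<^esub>, ring.add = monoid.mult A, module.smult = (\<lambda>k v. v [^]\<^bsub>A\<^esub> k)\<rparr>"

definition finite_basis ::
    "('r, 'm) ring_scheme \<Rightarrow> ('r, 'v, 'n) module_scheme \<Rightarrow> ('i \<Rightarrow> 'v) \<Rightarrow> 'i set \<Rightarrow> bool" where
  "finite_basis R M b I \<longleftrightarrow>
     module R M \<and> finite I \<and> b \<in> I \<rightarrow> carrier M \<and>
     (\<forall>c \<in> I \<rightarrow> carrier R.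
        (\<Oplus>\<^bsub>M\<^esub>i\<in>I. c i \<odot>\<^bsub>M\<^esub> b i) = \<zero>\<^bsub>M\<^esub> \<longrightarrow> (\<forall>i\<in>I. c i = \<zero>\<^bsub>R\<^esub>)) \<and>
     (\<forall>v \<in> carrier M. \<exists>c \<in> I \<rightarrow> carrier R. v = (\<Oplus>\<^bsub>M\<^esub>i\<in>I. c i \<odot>\<^bsub>M\<^esub> b i))"


section \<open>Free groups, as groups of reduced words\<close>

text \<open>The letter \<open>(a, True)\<close> stands for the generator \<open>a\<close> and \<open>(a, False)\<close> for its inverse.\<close>

type_synonym 'a word = "('a \<times> bool) list"

fun red_cons :: "'a \<times> bool \<Rightarrow> 'a word \<Rightarrow> 'a word" where
  "red_cons x [] = [x]"
| "red_cons x (y # ys) = (if fst y = fst x \<and> snd y \<noteq> snd x then ys else x # y # ys)"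

definition reduce :: "'a word \<Rightarrow> 'a word" where
  "reduce w = foldr red_cons w []"

definition free_group :: "'a set \<Rightarrow> 'a word monoid" where
  "free_group A =
     \<lparr>carrier = {w. reduce w = w \<and> fst ` set w \<subseteq> A},
      monoid.mult = (\<lambda>u v. reduce (u @ v)), one = []\<rparr>"

definition free_gen :: "'a \<Rightarrow> 'a word" where
  "free_gen a = [(a, True)]"

text \<open>The endomorphism sending each generator \<open>a\<close> to \<open>f a\<close>. It is extensional, as the elements
  of \<^const>\<open>AutoGroup\<close> are.\<close>

definition free_endo :: "'a set \<Rightarrow> ('a \<Rightarrow> 'a word) \<Rightarrow> 'a word \<Rightarrow> 'a word" where
  "free_endo A f =
     (\<lambda>w \<in> carrier (free_group A).
        foldr (\<lambda>(a, e) u. (if e then f a else inv\<^bsub>free_group A\<^esub> f a) \<otimes>\<^bsub>free_group A\<^esub> u)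
          w \<one>\<^bsub>free_group A\<^esub>)"


section \<open>The groups \<open>wB(\<lambda>\<^sub>P, \<emptyset>, \<lambda>\<^sub>S)\<close>\<close>

text \<open>Strands and blocks are numbered from 0: the free group \<open>F\<^sub>n\<close> is generated by
  \<open>{..<n}\<close>, and the blocks of \<open>\<lambda> = \<lambda>\<^sub>P @ \<lambda>\<^sub>S\<close> coming from \<open>\<lambda>\<^sub>P\<close> are those of index
  less than \<open>length \<lambda>\<^sub>P\<close>.\<close>

definition block :: "nat list \<Rightarrow> nat \<Rightarrow> nat set" where
  "block lam k = {sum_list (take k lam) ..< sum_list (take (k + 1) lam)}"

definition young_subgroup :: "nat list \<Rightarrow> (nat \<Rightarrow> nat) set" where
  "young_subgroup lam =
     {\<sigma>. \<sigma> permutes {..<sum_list lam} \<and> (\<forall>k<length lam. \<sigma> ` block lam k = block lam k)}"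

abbreviation FG :: "nat \<Rightarrow> nat word monoid" where
  "FG n \<equiv> free_group {..<n}"

definition wB :: "nat list \<Rightarrow> nat list \<Rightarrow> (nat word \<Rightarrow> nat word) monoid" where
  "wB lamP lamS =
     (let nP = sum_list lamP; n = nP + sum_list lamS in
      AutoGroup (FG n)
        \<lparr>carrier := {\<phi> \<in> auto (FG n).
           \<exists>\<sigma> w. \<exists>\<epsilon> :: nat \<Rightarrow> int.
             \<sigma> \<in> young_subgroup (lamP @ lamS) \<and>
             (\<forall>i<n. w i \<in> generate (FG n) (free_gen ` {nP..<n}) \<and>
                    \<epsilon> i \<in> {1, -1} \<and> (i < nP \<longrightarrow> \<epsilon> i = 1) \<and>
                    \<phi> (free_gen i) =
                      w i \<otimes>\<^bsub>FG n\<^esub> (free_gen (\<sigma> i) [^]\<^bsub>FG n\<^esub> \<epsilon> i) \<otimes>\<^bsub>FG n\<^esub> inv\<^bsub>FG n\<^esub> (w i))}\<rparr>)"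

definition tau_aut :: "nat \<Rightarrow> nat \<Rightarrow> nat word \<Rightarrow> nat word" where
  "tau_aut n \<alpha> = free_endo {..<n} (free_gen(\<alpha> := free_gen (\<alpha> + 1), \<alpha> + 1 := free_gen \<alpha>))"

definition sigma_aut :: "nat \<Rightarrow> nat \<Rightarrow> nat word \<Rightarrow> nat word" where
  "sigma_aut n \<alpha> = free_endo {..<n}
     (free_gen(\<alpha> := free_gen \<alpha> \<otimes>\<^bsub>FG n\<^esub> free_gen (\<alpha> + 1) \<otimes>\<^bsub>FG n\<^esub> inv\<^bsub>FG n\<^esub> (free_gen \<alpha>),
               \<alpha> + 1 := free_gen \<alpha>))"

definition rho_aut :: "nat \<Rightarrow> nat \<Rightarrow> nat word \<Rightarrow> nat word" where
  "rho_aut n \<alpha> = free_endo {..<n} (free_gen(\<alpha> := inv\<^bsub>FG n\<^esub> (free_gen \<alpha>)))"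

definition chi_aut :: "nat \<Rightarrow> nat \<Rightarrow> nat \<Rightarrow> nat word \<Rightarrow> nat word" where
  "chi_aut n \<alpha> \<beta> = free_endo {..<n}
     (free_gen(\<alpha> := free_gen \<beta> \<otimes>\<^bsub>FG n\<^esub> free_gen \<alpha> \<otimes>\<^bsub>FG n\<^esub> inv\<^bsub>FG n\<^esub> (free_gen \<beta>)))"


section \<open>The generators of the abelianization\<close>

datatype ab_gen = Gen_s nat | Gen_t nat | Gen_r nat | Gen_x nat nat

definition P_blocks :: "nat list \<Rightarrow> nat list \<Rightarrow> nat set" where
  "P_blocks lamP lamS = {..<length lamP}"

definition S_blocks :: "nat list \<Rightarrow> nat list \<Rightarrow> nat set" where
  "S_blocks lamP lamS = {length lamP ..< length lamP + length lamS}"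

definition ab_gens :: "nat list \<Rightarrow> nat list \<Rightarrow> ab_gen set" where
  "ab_gens lamP lamS =
     (let lam = lamP @ lamS; IP = P_blocks lamP lamS; IS = S_blocks lamP lamS in
      {Gen_s i | i. i \<in> IS \<and> 2 \<le> lam ! i} \<union>
      {Gen_t i | i. i \<in> IP \<union> IS \<and> 2 \<le> lam ! i} \<union>
      {Gen_r i | i. i \<in> IS} \<union>
      {Gen_x i j | i j. i \<in> IP \<union> IS \<and> j \<in> IS \<and> i \<noteq> j})"

text \<open>The automorphisms whose common class is the given generator.\<close>

fun ab_gen_reps :: "nat list \<Rightarrow> nat list \<Rightarrow> ab_gen \<Rightarrow> (nat word \<Rightarrow> nat word) set" where
  "ab_gen_reps lamP lamS (Gen_s i) =
     {sigma_aut (sum_list (lamP @ lamS)) \<alpha> | \<alpha>.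
        \<alpha> \<in> block (lamP @ lamS) i \<and> \<alpha> + 1 \<in> block (lamP @ lamS) i}"
| "ab_gen_reps lamP lamS (Gen_t i) =
     {tau_aut (sum_list (lamP @ lamS)) \<alpha> | \<alpha>.
        \<alpha> \<in> block (lamP @ lamS) i \<and> \<alpha> + 1 \<in> block (lamP @ lamS) i}"
| "ab_gen_reps lamP lamS (Gen_r i) =
     {rho_aut (sum_list (lamP @ lamS)) \<alpha> | \<alpha>. \<alpha> \<in> block (lamP @ lamS) i}"
| "ab_gen_reps lamP lamS (Gen_x i j) =
     {chi_aut (sum_list (lamP @ lamS)) \<alpha> \<beta> | \<alpha> \<beta>.
        \<alpha> \<in> block (lamP @ lamS) i \<and> \<beta> \<in> block (lamP @ lamS) j}"

text \<open>\<^const>\<open>the_elem\<close> is only meaningful on singletons, i.e. if the class is indeed common.\<close>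

definition ab_gen_class :: "nat list \<Rightarrow> nat list \<Rightarrow> ab_gen \<Rightarrow> (nat word \<Rightarrow> nat word) set" where
  "ab_gen_class lamP lamS g =
     the_elem (ab_class (wB lamP lamS) ` ab_gen_reps lamP lamS g)"

definition gen_bracket ::
    "nat list \<Rightarrow> nat list \<Rightarrow> ab_gen \<Rightarrow> ab_gen \<Rightarrow> (nat word \<Rightarrow> nat word) set" where
  "gen_bracket lamP lamS g h =
     lie_bracket (wB lamP lamS) 1 1 (ab_gen_class lamP lamS g) (ab_gen_class lamP lamS h)"

definition basis_index :: "nat list \<Rightarrow> nat list \<Rightarrow> (nat \<times> nat) set" where
  "basis_index lamP lamS =
     {(i, j). i \<in> P_blocks lamP lamS \<and> (lamP @ lamS) ! i = 2 \<and> j \<in> S_blocks lamP lamS}"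

end

theory Submission
  imports Defs
begin

text \<open>For a normal subgroup \<open>N\<close>, the elements commuting with a given element modulo \<open>N\<close> form a
  subgroup. Hence commutation modulo \<open>\<Gamma>\<^sub>3\<close> or \<open>\<Gamma>\<^sub>4\<close> may be checked on generators, and modulo \<open>\<Gamma>\<^sub>3\<close>
  each generator may be replaced by another one of the same class in the abelianization. Nielsen
  reduction shows that the transpositions \<open>\<tau>\<close> inside blocks, the \<open>\<rho>\<close> and the \<open>\<chi>\<close> generate the group.
  Since the blocks of \<open>\<lambda>\<^sub>S\<close> have at least four elements, two generators have representatives with
  disjoint supports, or are related by the relation of McCool, except for \<open>t\<^sub>i\<close> and \<open>x\<^sub>i\<^sub>j\<close> when the
  block \<open>i\<close> has size 2. The commutators of these exceptional pairs are central modulo \<open>\<Gamma>\<^sub>4\<close>, for the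
  same reasons. They are independent modulo \<open>\<Gamma>\<^sub>3\<close> because the two strands of a block of size 2, together
  with the parities of their conjugating words in the letters of the block \<open>j\<close>, define a homomorphism
  to the dihedral group of order 8, which is nilpotent of class 2.\<close>

section \<open>Commutators and the lower central series\<close>

text \<open>The delicate step is the one from \<open>\<Gamma> 3\<close> to
  \<open>\<Gamma> 4\<close>. Representatives of one class in the abelianization differ by an element
  of \<open>\<Gamma> 2\<close>, which is harmless modulo \<open>\<Gamma> 3\<close> but not modulo
  \<open>\<Gamma> 4\<close>. There a replacement must be a congruence modulo
  \<open>\<Gamma> 3\<close>: either the quotient of the two elements is a commutator already shown
  to lie in \<open>\<Gamma> 3\<close>, or the elements are commutators themselves and only the class
  of an entry is preserved. The bound 4 allows the choice of a circle strand different from three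
  given strands. In a block {a, a'} of two points no strand is left beside a and a', hence the
  exceptional pairs. Their commutator is \<open>\<chi>_a'b \<chi>_ab^-1\<close>; the involution
  \<tau> inverts it, whence the exponent 2, and in the dihedral group it becomes the central
  element. Nielsen moves stay inside the group because conjugating words contain circle letters
  only: if a conjugating word runs through the image of x_i past its central letter, then x_i is a
  circle, so conjugation by x_i is allowed.\<close>

context group
begin

lemma cancel_simps:
  assumes "a \<in> carrier G" "b \<in> carrier G"
  shows "inv a \<otimes> (a \<otimes> b) = b" "a \<otimes> (inv a \<otimes> b) = b"
  using assms by (simp_all flip: m_assoc)

text \<open>Together with the default cancellation rules these bring a product of letters and
  inverses to freely reduced form, so that commutator identities valid in every group are proved by
  simplification.\<close>

lemmas group_word_simps = m_assoc inv_mult_group cancel_simps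

lemma commutator_closed [simp, intro]:
  "a \<in> carrier G \<Longrightarrow> b \<in> carrier G \<Longrightarrow> commutator G a b \<in> carrier G"
  by (simp add: commutator_def)

lemma commutator_hom:
  assumes "group H" "f \<in> hom G H" "a \<in> carrier G" "b \<in> carrier G"
  shows "f (commutator G a b) = commutator H (f a) (f b)"
proof -
  interpret group_hom G H f
    using assms is_group by (simp add: group_hom_def group_hom_axioms_def)
  show ?thesis
    using assms by (simp add: commutator_def)
qed

lemma inv_commutator:
  "a \<in> carrier G \<Longrightarrow> b \<in> carrier G \<Longrightarrow> inv (commutator G a b) = commutator G b a"
  by (simp add: commutator_def group_word_simps)

lemma commutator_eq_one_iff:
  assumes "a \<in> carrier G" "b \<in> carrier G"
  shows "commutator G a b = \<one> \<longleftrightarrow> a \<otimes> b = b \<otimes> a"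
proof
  assume "commutator G a b = \<one>"
  then have "commutator G a b \<otimes> (b \<otimes> a) = b \<otimes> a"
    using assms by simp
  then show "a \<otimes> b = b \<otimes> a"
    using assms by (simp add: commutator_def group_word_simps)
next
  assume "a \<otimes> b = b \<otimes> a"
  then show "commutator G a b = \<one>"
    using assms by (simp add: commutator_def) (simp add: group_word_simps)
qed

lemma conj_eq_commutator_mult:
  "p \<in> carrier G \<Longrightarrow> a \<in> carrier G \<Longrightarrow> p \<otimes> a \<otimes> inv p = commutator G p a \<otimes> a"
  by (simp add: commutator_def group_word_simps)

lemma normal_imp_commutator_mem:
  assumes "N \<lhd> G" "a \<in> carrier G" "b \<in> N"
  shows "commutator G a b \<in> N"
proof -
  interpret N: normal N G by fact
  show ?thesis
    using assms by (simp add: commutator_def N.inv_op_closed2)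
qed

end

section \<open>Centralisers modulo a normal subgroup\<close>

text \<open>For normal N this is the preimage in G of the centraliser of the class of b in G/N.
  Staying in G lets the same elements be compared modulo several terms of the series.\<close>

definition cent_mod :: "('a, 'b) monoid_scheme \<Rightarrow> 'a set \<Rightarrow> 'a \<Rightarrow> 'a set" where
  "cent_mod G N b = {a \<in> carrier G. commutator G a b \<in> N}"

context group
begin

lemma cent_mod_sym:
  assumes "subgroup N G" "b \<in> carrier G" "a \<in> cent_mod G N b"
  shows "b \<in> cent_mod G N a"
  using assms subgroup.m_inv_closed[OF assms(1), of "commutator G a b"]
  by (simp add: cent_mod_def inv_commutator)

lemma subgroup_cent_mod:
  assumes N: "N \<lhd> G" and b: "b \<in> carrier G"
  shows "subgroup (cent_mod G N b) G"
proof -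
  interpret N: normal N G by fact
  show ?thesis
  proof
    show "cent_mod G N b \<subseteq> carrier G" by (auto simp: cent_mod_def)
    have "commutator G \<one> b = \<one>"
      using b by (simp add: commutator_def)
    then show "\<one> \<in> cent_mod G N b"
      by (simp add: cent_mod_def)
  next
    fix x y assume xy: "x \<in> cent_mod G N b" "y \<in> cent_mod G N b"
    then have c: "x \<in> carrier G" "y \<in> carrier G" by (auto simp: cent_mod_def)
    have "commutator G (x \<otimes> y) b = (x \<otimes> commutator G y b \<otimes> inv x) \<otimes> commutator G x b"
      using b c by (simp add: commutator_def group_word_simps)
    then show "x \<otimes> y \<in> cent_mod G N b"
      using xy c by (simp add: cent_mod_def N.inv_op_closed2)
  next
    fix x assume x: "x \<in> cent_mod G N b"
    then have c: "x \<in> carrier G" by (auto simp: cent_mod_def)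
    have "commutator G (inv x) b = inv x \<otimes> commutator G b x \<otimes> x"
      using b c by (simp add: commutator_def group_word_simps)
    moreover have "commutator G b x \<in> N"
      using x b cent_mod_sym[OF N.is_subgroup b x] by (simp add: cent_mod_def)
    ultimately show "inv x \<in> cent_mod G N b"
      using c by (simp add: cent_mod_def N.inv_op_closed1)
  qed
qed

lemma commute_imp_cent_mod:
  assumes "subgroup N G" "a \<in> carrier G" "b \<in> carrier G" "a \<otimes> b = b \<otimes> a"
  shows "a \<in> cent_mod G N b"
  using assms commutator_eq_one_iff[of a b] by (simp add: cent_mod_def subgroup.one_closed)

text \<open>Two passes through \<open>cent_mod\<close>: for fixed y in Y the centraliser contains X
  and hence everything; for fixed a the centraliser therefore contains Y and hence all that Y
  generates. In the applications Y generates \<open>\<Gamma> 1\<close> or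
  \<open>\<Gamma> 2\<close>.\<close>

lemma commutator_mem_if_generators:
  assumes N: "N \<lhd> G" and X: "X \<subseteq> carrier G" "generate G X = carrier G"
    and Y: "Y \<subseteq> carrier G"
    and *: "\<And>x y. x \<in> X \<Longrightarrow> y \<in> Y \<Longrightarrow> commutator G x y \<in> N"
    and a: "a \<in> carrier G" and b: "b \<in> generate G Y"
  shows "commutator G a b \<in> N"
proof -
  note sN = normal_imp_subgroup[OF N]
  have a_y: "a \<in> cent_mod G N y" if "y \<in> Y" for y
  proof -
    have "X \<subseteq> cent_mod G N y"
      using * that X by (auto simp: cent_mod_def)
    then have "generate G X \<subseteq> cent_mod G N y"
      using that Y by (intro generate_subgroup_incl subgroup_cent_mod N) auto
    then show ?thesis using a X by auto
  qed
  have "Y \<subseteq> cent_mod G N a"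
    using a_y cent_mod_sym[OF sN] Y by blast
  then have "generate G Y \<subseteq> cent_mod G N a"
    by (intro generate_subgroup_incl subgroup_cent_mod N a)
  then have "a \<in> cent_mod G N b"
    using b cent_mod_sym[OF sN a] by blast
  then show ?thesis by (simp add: cent_mod_def)
qed

section \<open>Terms of the lower central series\<close>

text \<open>A conjugate of a commutator is the commutator of the conjugates, so for normal H the
  generating set itself is stable under conjugation.\<close>

lemma commutator_subgroup_normal:
  assumes H: "H \<lhd> G"
  shows "commutator_subgroup G (carrier G) H \<lhd> G"
  unfolding commutator_subgroup_def
proof (rule normal_generateI)
  interpret H: normal H G by fact
  show "{commutator G h k | h k. h \<in> carrier G \<and> k \<in> H} \<subseteq> carrier G"
    using H.subset by auto
  fix c g assume c: "c \<in> {commutator G h k | h k. h \<in> carrier G \<and> k \<in> H}" and g: "g \<in> carrier G"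
  then obtain h k where hk: "c = commutator G h k" "h \<in> carrier G" "k \<in> H" "k \<in> carrier G"
    using H.subset by auto
  have "g \<otimes> c \<otimes> inv g = commutator G (g \<otimes> h \<otimes> inv g) (g \<otimes> k \<otimes> inv g)"
    using hk g by (simp add: commutator_def group_word_simps)
  moreover have "g \<otimes> k \<otimes> inv g \<in> H"
    using hk g by (simp add: H.inv_op_closed2)
  ultimately show "g \<otimes> c \<otimes> inv g \<in> {commutator G h k | h k. h \<in> carrier G \<and> k \<in> H}"
    using hk g by blast
qed

lemma lower_central_normal: "lower_central G i \<lhd> G"
proof (induction i)
  case (Suc i)
  then show ?case
    by (cases i) (simp_all add: normal_self commutator_subgroup_normal)
qed (simp add: normal_self)

lemma lower_central_subgroup: "subgroup (lower_central G i) G"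
  by (simp add: lower_central_normal normal_imp_subgroup)

lemma lower_central_Suc:
  "0 < i \<Longrightarrow> lower_central G (Suc i) = commutator_subgroup G (carrier G) (lower_central G i)"
  by (cases i) auto

lemma commutator_mem_lower_central_Suc:
  "0 < i \<Longrightarrow> a \<in> carrier G \<Longrightarrow> b \<in> lower_central G i \<Longrightarrow> commutator G a b \<in> lower_central G (Suc i)"
  by (auto simp: lower_central_Suc commutator_subgroup_def intro: generate.incl)

lemma lower_central_Suc_least:
  assumes "0 < i" "subgroup N G" "\<And>a b. a \<in> carrier G \<Longrightarrow> b \<in> lower_central G i \<Longrightarrow> commutator G a b \<in> N"
  shows "lower_central G (Suc i) \<subseteq> N"
  using assms unfolding lower_central_Suc[OF assms(1)] commutator_subgroup_def
  by (intro generate_subgroup_incl) auto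

lemma lower_central_antimono: "lower_central G (Suc i) \<subseteq> lower_central G i"
proof (cases "i = 0")
  case False
  then show ?thesis
    by (intro lower_central_Suc_least lower_central_subgroup)
      (auto intro: normal_imp_commutator_mem lower_central_normal)
qed auto

text \<open>The preimage of a term of the series of H is a subgroup of G that contains the required
  commutators. With a target of class 2 this places the third term of G inside a kernel.\<close>

lemma lower_central_hom:
  assumes H: "group H" and f: "f \<in> hom G H" and x: "x \<in> lower_central G i"
  shows "f x \<in> lower_central H i"
  using x
proof (induction i arbitrary: x)
  case 0
  then show ?case using f by (auto simp: hom_def)
next
  case (Suc i)
  interpret H: group H by fact
  interpret f: group_hom G H f
    using H f is_group by (simp add: group_hom_def group_hom_axioms_def)
  show ?case
  \<comment> \<open>The indices 0 and 1 both give the whole group, so the commutator recursion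
    applies only from i = 1 on.\<close>
  proof (cases "i = 0")
    case True
    then show ?thesis using Suc.prems f by (auto simp: hom_def)
  next
    case False
    let ?N = "{y \<in> carrier G. f y \<in> lower_central H (Suc i)}"
    interpret L: subgroup "lower_central H (Suc i)" H
      by (rule H.lower_central_subgroup)
    have "subgroup ?N G"
      by unfold_locales auto
    moreover have "commutator G a b \<in> ?N" if "a \<in> carrier G" "b \<in> lower_central G i" for a b
    proof -
      have b: "b \<in> carrier G"
        using that subgroup.subset[OF lower_central_subgroup] by blast
      show ?thesis
        using that b False Suc.IH[OF that(2)] commutator_hom[OF H f] H.commutator_mem_lower_central_Suc
        by auto
    qed
    ultimately have "lower_central G (Suc i) \<subseteq> ?N"
      using False by (intro lower_central_Suc_least) auto
    then show ?thesis using Suc.prems by auto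
  qed
qed

section \<open>Cosets, classes in the abelianization and the bracket of two classes\<close>

lemma rcos_mult_left:
  assumes "subgroup N G" "n \<in> N" "a \<in> carrier G"
  shows "N #> (n \<otimes> a) = N #> a"
proof -
  interpret N: subgroup N G by fact
  show ?thesis
    using assms coset_mult_assoc[of N n a] coset_join2[of n N] N.subset by auto
qed

lemma ab_class_conj:
  assumes "p \<in> carrier G" "a \<in> carrier G"
  shows "ab_class G (p \<otimes> a \<otimes> inv p) = ab_class G a"
  unfolding ab_class_def conj_eq_commutator_mult[OF assms]
  using commutator_mem_lower_central_Suc[of 1 p a] assms
  by (intro rcos_mult_left lower_central_subgroup) (simp_all add: numeral_2_eq_2)

lemma ab_class_eq_imp:
  assumes "a \<in> carrier G" "b \<in> carrier G" "ab_class G a = ab_class G b"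
  obtains k where "k \<in> lower_central G 2" "a = k \<otimes> b"
proof -
  have "a \<in> lower_central G 2 #> b"
    using assms lower_central_subgroup rcos_self by (metis ab_class_def)
  then show thesis using that by (auto simp: r_coset_def)
qed

text \<open>Here a is k a' with k in the second term, and [b, k] lies in the third term, hence in N.
  For N the fourth term that inclusion is the very claim to be proved, so commutation modulo
  \<open>\<Gamma> 4\<close> needs finer replacements.\<close>

lemma cent_mod_ab_class_cong:
  assumes N: "N \<lhd> G" and a: "a \<in> carrier G" "a' \<in> carrier G" "ab_class G a = ab_class G a'"
    and N3: "lower_central G 3 \<subseteq> N"
    and b: "b \<in> carrier G" and *: "a' \<in> cent_mod G N b"
  shows "a \<in> cent_mod G N b"
proof -
  obtain k where k: "k \<in> lower_central G 2" "a = k \<otimes> a'"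
    using ab_class_eq_imp[OF a] .
  have "commutator G b k \<in> N"
    using commutator_mem_lower_central_Suc[of 2 b k] b k N3 by (auto simp: numeral_3_eq_3 numeral_2_eq_2)
  moreover have "k \<in> carrier G"
    using k(1) lower_central_subgroup subgroup.subset by blast
  ultimately have "k \<in> cent_mod G N b"
    using b cent_mod_sym[OF normal_imp_subgroup[OF N], of k b] by (simp add: cent_mod_def)
  then show ?thesis
    using * k subgroup.m_closed[OF subgroup_cent_mod[OF N b]] by simp
qed

lemma commutator_rcos_cong:
  assumes N: "N \<lhd> G" and a: "a \<in> carrier G" and b: "b \<in> carrier G" and k: "k \<in> carrier G"
    and *: "commutator G k b \<in> N"
  shows "N #> commutator G (a \<otimes> k) b = N #> commutator G a b"
    and "N #> commutator G b (a \<otimes> k) = N #> commutator G b a"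
proof -
  interpret N: normal N G by fact
  have "commutator G (a \<otimes> k) b = (a \<otimes> commutator G k b \<otimes> inv a) \<otimes> commutator G a b"
    using a b k by (simp add: commutator_def group_word_simps)
  moreover have "a \<otimes> commutator G k b \<otimes> inv a \<in> N"
    using * a by (simp add: N.inv_op_closed2)
  ultimately show "N #> commutator G (a \<otimes> k) b = N #> commutator G a b"
    using rcos_mult_left[OF N.is_subgroup _ commutator_closed[OF a b]] by simp
  let ?n = "commutator G b a \<otimes> (a \<otimes> commutator G b k \<otimes> inv a) \<otimes> inv (commutator G b a)"
  have "commutator G b (a \<otimes> k) = ?n \<otimes> commutator G b a"
    using a b k by (simp add: commutator_def group_word_simps)
  moreover have "commutator G b k \<in> N"
    using N.m_inv_closed[OF *] b k by (simp add: inv_commutator)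
  then have "?n \<in> N"
    using a b by (intro N.inv_op_closed2) auto
  ultimately show "N #> commutator G b (a \<otimes> k) = N #> commutator G b a"
    using rcos_mult_left[OF N.is_subgroup _ commutator_closed[OF b a]] by simp
qed

lemma lie_bracket_ab_class:
  assumes a: "a \<in> carrier G" and b: "b \<in> carrier G"
  shows "lie_bracket G 1 1 (ab_class G a) (ab_class G b) = lower_central G 3 #> commutator G a b"
proof -
  have cong: "lower_central G 3 #> commutator G a' b' = lower_central G 3 #> commutator G a b"
    if ab: "a' \<in> ab_class G a" "b' \<in> ab_class G b" for a' b'
  proof -
    interpret L: subgroup "lower_central G 2" G by (rule lower_central_subgroup)
    \<comment> \<open>In the coset of x the factor from the second term stands on the left;
      normality moves it to the right, where \<open>commutator_rcos_cong\<close> expects it.\<close>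
    have in_coset: "\<exists>k \<in> lower_central G 2. x' = x \<otimes> k" if x: "x \<in> carrier G" "x' \<in> ab_class G x" for x x'
    proof -
      obtain k where k: "k \<in> lower_central G 2" "x' = k \<otimes> x"
        using x by (auto simp: ab_class_def r_coset_def)
      then have "x' = x \<otimes> (inv x \<otimes> k \<otimes> x)"
        using x by (simp add: group_word_simps)
      moreover have "inv x \<otimes> k \<otimes> x \<in> lower_central G 2"
        using k x lower_central_normal normal.inv_op_closed1 by metis
      ultimately show ?thesis by blast
    qed
    from in_coset[OF a ab(1)] obtain k where k: "k \<in> lower_central G 2" "a' = a \<otimes> k" by auto
    from in_coset[OF b ab(2)] obtain l where l: "l \<in> lower_central G 2" "b' = b \<otimes> l" by auto
    have 3: "commutator G g x \<in> lower_central G 3" "commutator G x g \<in> lower_central G 3"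
      if "g \<in> carrier G" "x \<in> lower_central G 2" for g x
    proof -
      show *: "commutator G g x \<in> lower_central G 3"
        using commutator_mem_lower_central_Suc[of 2 g x] that by (simp add: numeral_3_eq_3 numeral_2_eq_2)
      show "commutator G x g \<in> lower_central G 3"
        using subgroup.m_inv_closed[OF lower_central_subgroup *] that by (simp add: inv_commutator)
    qed
    have b': "b' \<in> carrier G" using b l by auto
    have "lower_central G 3 #> commutator G a' b' = lower_central G 3 #> commutator G a b'"
      unfolding k(2) by (rule commutator_rcos_cong(1)) (use a b' k 3 lower_central_normal in auto)
    also have "\<dots> = lower_central G 3 #> commutator G a b"
      unfolding l(2) by (rule commutator_rcos_cong(2)) (use a b l 3 lower_central_normal in auto)
    finally show ?thesis .
  qed
  \<comment> \<open>The bracket is a union of equal cosets; these memberships show that the union is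
    not empty.\<close>
  have "a \<in> ab_class G a" "b \<in> ab_class G b"
    using a b rcos_self lower_central_subgroup by (auto simp: ab_class_def)
  moreover have "(1::nat) + 1 + 1 = 3" by simp
  ultimately show ?thesis
    unfolding lie_bracket_def using cong by (metis (no_types, lifting) SUP_eq_const empty_iff)
qed

end

section \<open>Free groups\<close>

definition inv_word :: "'a word \<Rightarrow> 'a word" where
  "inv_word w = rev (map (\<lambda>(a, e). (a, \<not> e)) w)"

lemma inv_word_simps [simp]:
  "inv_word [] = []"
  "inv_word (x # w) = inv_word w @ [(fst x, \<not> snd x)]"
  "inv_word (u @ v) = inv_word v @ inv_word u"
  "length (inv_word w) = length w"
  "inv_word (inv_word w) = w"
  "fst ` set (inv_word w) = fst ` set w"
  by (auto simp: inv_word_def rev_map case_prod_unfold image_image comp_def)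

abbreviation cancels :: "'a \<times> bool \<Rightarrow> 'a \<times> bool \<Rightarrow> bool" where
  "cancels x y \<equiv> fst y = fst x \<and> snd y \<noteq> snd x"

text \<open>A local form of the condition \<open>reduce w = w\<close> that defines the carrier. It
  compares adjacent letters only and so splits over \<open>@\<close>, which the inductions on words
  require; \<open>reduce_eq_iff\<close> relates the two.\<close>

fun reduced :: "'a word \<Rightarrow> bool" where
  "reduced [] = True"
| "reduced [x] = True"
| "reduced (x # y # w) = (\<not> cancels x y \<and> reduced (y # w))"

lemma reduced_Cons: "reduced (x # w) \<longleftrightarrow> reduced w \<and> (w \<noteq> [] \<longrightarrow> \<not> cancels x (hd w))"
  by (cases w) auto

lemma reduced_append:
  "reduced (u @ v) \<longleftrightarrow>
     reduced u \<and> reduced v \<and> (u \<noteq> [] \<longrightarrow> v \<noteq> [] \<longrightarrow> \<not> cancels (last u) (hd v))"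
  by (induction u) (auto simp: reduced_Cons)

lemma reduced_inv_word [simp]: "reduced (inv_word w) \<longleftrightarrow> reduced w"
proof -
  have "reduced w \<Longrightarrow> reduced (inv_word w)" for w :: "'a word"
    by (induction w) (auto simp: reduced_append reduced_Cons inv_word_def last_rev hd_map case_prod_unfold)
  from this[of w] this[of "inv_word w"] show ?thesis by auto
qed

lemma red_cons_reduced: "reduced (x # w) \<Longrightarrow> red_cons x w = x # w"
  by (cases w) auto

lemma reduced_red_cons: "reduced w \<Longrightarrow> reduced (red_cons x w)"
  by (cases w) (auto simp: reduced_Cons)

text \<open>The argument of van der Waerden: letters act on reduced words through
  \<open>red_cons\<close>, and opposite letters act by inverse maps. If the inner step deletes a
  letter, reducedness of w prevents the outer step from deleting the next one.\<close>

lemma red_cons_cancel: "reduced w \<Longrightarrow> cancels x y \<Longrightarrow> red_cons x (red_cons y w) = w"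
  by (cases w; cases "tl w") (auto simp: prod_eq_iff)

lemma reduced_foldr: "reduced v \<Longrightarrow> reduced (foldr red_cons u v)"
  by (induction u) (auto simp: reduced_red_cons)

lemma reduced_reduce [simp]: "reduced (reduce w)"
  by (simp add: reduce_def reduced_foldr)

lemma reduce_reduced: "reduced w \<Longrightarrow> reduce w = w"
  unfolding reduce_def by (induction w) (auto simp: reduced_Cons red_cons_reduced)

lemma reduce_eq_iff: "reduce w = w \<longleftrightarrow> reduced w"
  by (metis reduced_reduce reduce_reduced)

lemma foldr_red_cons_red_cons:
  "reduced v \<Longrightarrow> foldr red_cons (red_cons x u) v = red_cons x (foldr red_cons u v)"
  by (cases u) (auto simp: red_cons_cancel reduced_foldr)

text \<open>With \<open>foldr red_cons u\<close> read as the action of u on reduced words, a word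
  and its reduction act alike. Associativity of the multiplication comes from this.\<close>

lemma foldr_red_cons_reduce:
  "reduced v \<Longrightarrow> foldr red_cons (reduce u) v = foldr red_cons u v"
  unfolding reduce_def by (induction u) (auto simp: foldr_red_cons_red_cons)

lemma reduce_append: "reduce (u @ v) = foldr red_cons u (reduce v)"
  by (simp add: reduce_def)

lemma reduce_reduce_append [simp]:
  "reduce (reduce u @ v) = reduce (u @ v)" "reduce (u @ reduce v) = reduce (u @ v)"
  "reduce (reduce u) = reduce u"
  by (simp_all add: reduce_append foldr_red_cons_reduce reduce_reduced)

lemma set_red_cons: "set (red_cons x w) \<subseteq> insert x (set w)"
  by (cases w) auto

lemma set_reduce: "set (reduce w) \<subseteq> set w"
  unfolding reduce_def
proof (induction w)
  case (Cons x w)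
  then show ?case using set_red_cons[of x "foldr red_cons w []"] by auto
qed auto

lemma fst_set_reduce: "fst ` set w \<subseteq> A \<Longrightarrow> fst ` set (reduce w) \<subseteq> A"
  using set_reduce[of w] by blast

lemma length_red_cons: "length (red_cons x w) \<le> Suc (length w)"
  by (cases w) auto

lemma length_reduce: "length (reduce w) \<le> length w"
  unfolding reduce_def
proof (induction w)
  case (Cons x w)
  then show ?case using length_red_cons[of x "foldr red_cons w []"] by auto
qed auto

lemma reduce_inv_word_append: "reduce (inv_word u @ u @ v) = reduce v"
proof (induction u arbitrary: v)
  case (Cons x u)
  have "reduce (inv_word (x # u) @ (x # u) @ v)
      = foldr red_cons (inv_word u) (red_cons (fst x, \<not> snd x) (red_cons x (reduce (u @ v))))"
    by (simp add: reduce_def)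
  also have "\<dots> = reduce (inv_word u @ u @ v)"
    by (subst red_cons_cancel) (auto simp: reduce_append reduced_foldr)
  finally show ?case using Cons by simp
qed auto

lemma carrier_free_group: "carrier (free_group A) = {w. reduced w \<and> fst ` set w \<subseteq> A}"
  by (simp add: free_group_def reduce_eq_iff)

lemma mult_free_group: "u \<otimes>\<^bsub>free_group A\<^esub> v = reduce (u @ v)"
  by (simp add: free_group_def)

lemma one_free_group: "\<one>\<^bsub>free_group A\<^esub> = []"
  by (simp add: free_group_def)

lemma group_free_group: "group (free_group A)"
proof (rule groupI)
  fix u assume u: "u \<in> carrier (free_group A)"
  show "\<exists>v\<in>carrier (free_group A). v \<otimes>\<^bsub>free_group A\<^esub> u = \<one>\<^bsub>free_group A\<^esub>"
  proof (rule bexI[of _ "inv_word u"])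
    show "inv_word u \<otimes>\<^bsub>free_group A\<^esub> u = \<one>\<^bsub>free_group A\<^esub>"
      using reduce_inv_word_append[of u "[]"]
      by (simp add: mult_free_group one_free_group reduce_def)
  qed (use u in \<open>auto simp: carrier_free_group\<close>)
qed (simp_all add: mult_free_group one_free_group carrier_free_group reduce_reduced fst_set_reduce image_Un)

lemma inv_free_group:
  assumes "u \<in> carrier (free_group A)"
  shows "inv\<^bsub>free_group A\<^esub> u = inv_word u"
proof (rule group.inv_equality[OF group_free_group])
  show "inv_word u \<otimes>\<^bsub>free_group A\<^esub> u = \<one>\<^bsub>free_group A\<^esub>"
    using reduce_inv_word_append[of u "[]"]
    by (simp add: mult_free_group one_free_group reduce_def)
qed (use assms in \<open>auto simp: carrier_free_group\<close>)

lemma free_gen_closed: "a \<in> A \<Longrightarrow> free_gen a \<in> carrier (free_group A)"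
  by (simp add: free_gen_def carrier_free_group)

lemma letter_eq:
  "a \<in> A \<Longrightarrow> [(a, e)] = (if e then free_gen a else inv\<^bsub>free_group A\<^esub> (free_gen a))"
  by (simp add: inv_free_group free_gen_closed) (simp add: free_gen_def)

section \<open>Evaluation in a group and the universal property\<close>

text \<open>The fold inside \<open>free_endo\<close>, with an arbitrary target and defined on
  unreduced words as well. There it turns \<open>@\<close> into products directly, and invariance
  under \<open>reduce\<close> is a separate lemma.\<close>

definition free_eval :: "('b, 'c) monoid_scheme \<Rightarrow> ('a \<Rightarrow> 'b) \<Rightarrow> 'a word \<Rightarrow> 'b" where
  "free_eval H f w = foldr (\<lambda>(a, e) u. (if e then f a else inv\<^bsub>H\<^esub> f a) \<otimes>\<^bsub>H\<^esub> u) w \<one>\<^bsub>H\<^esub>"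

lemma free_eval_Nil [simp]: "free_eval H f [] = \<one>\<^bsub>H\<^esub>"
  by (simp add: free_eval_def)

lemma free_eval_Cons:
  "free_eval H f ((a, e) # w) = (if e then f a else inv\<^bsub>H\<^esub> f a) \<otimes>\<^bsub>H\<^esub> free_eval H f w"
  by (simp add: free_eval_def)

context group
begin

lemma free_eval_closed:
  "f ` A \<subseteq> carrier G \<Longrightarrow> fst ` set w \<subseteq> A \<Longrightarrow> free_eval G f w \<in> carrier G"
  by (induction w) (auto simp: free_eval_Cons)

lemma free_eval_append:
  assumes "f ` A \<subseteq> carrier G" "fst ` set u \<subseteq> A" "fst ` set v \<subseteq> A"
  shows "free_eval G f (u @ v) = free_eval G f u \<otimes> free_eval G f v"
  using assms(2)
proof (induction u)
  case Nil
  then show ?case using assms free_eval_closed[of f A v] by simp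
next
  case (Cons x u)
  obtain a e where x: "x = (a, e)" by force
  show ?case
    using Cons assms free_eval_closed[of f A v] free_eval_closed[of f A u]
    by (auto simp: x free_eval_Cons m_assoc)
qed

lemma free_eval_red_cons:
  assumes "f ` A \<subseteq> carrier G" "a \<in> A" "fst ` set w \<subseteq> A"
  shows "free_eval G f (red_cons (a, e) w) = free_eval G f ((a, e) # w)"
proof (cases w)
  case (Cons y v)
  then show ?thesis
    using assms free_eval_closed[of f A v] by (cases y) (auto simp: free_eval_Cons cancel_simps)
qed auto

lemma free_eval_reduce:
  assumes "f ` A \<subseteq> carrier G" "fst ` set w \<subseteq> A"
  shows "free_eval G f (reduce w) = free_eval G f w"
  using assms(2)
proof (induction w)
  case (Cons x w)
  obtain a e where x: "x = (a, e)" by force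
  have "reduce (x # w) = red_cons x (reduce w)" by (simp add: reduce_def)
  then show ?case
    using Cons free_eval_red_cons[OF assms(1), of a "reduce w" e] fst_set_reduce[of w A]
    by (simp add: x free_eval_Cons)
qed (simp add: reduce_def)

lemma free_eval_hom:
  assumes "f ` A \<subseteq> carrier G"
  shows "free_eval G f \<in> hom (free_group A) G"
proof (rule homI)
  fix u v assume uv: "u \<in> carrier (free_group A)" "v \<in> carrier (free_group A)"
  then show "free_eval G f u \<in> carrier G"
    using free_eval_closed[OF assms] by (simp add: carrier_free_group)
  have "fst ` set (u @ v) \<subseteq> A"
    using uv by (simp add: carrier_free_group image_Un)
  then show "free_eval G f (u \<otimes>\<^bsub>free_group A\<^esub> v) = free_eval G f u \<otimes> free_eval G f v"
    using uv free_eval_reduce[OF assms, of "u @ v"] free_eval_append[OF assms, of u v]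
    by (simp add: mult_free_group carrier_free_group)
qed

lemma free_eval_gen: "a \<in> A \<Longrightarrow> f ` A \<subseteq> carrier G \<Longrightarrow> free_eval G f (free_gen a) = f a"
  by (auto simp: free_gen_def free_eval_Cons)

lemma hom_free_group_eqI:
  assumes "\<phi> \<in> hom (free_group A) G" "\<psi> \<in> hom (free_group A) G"
    and eq: "\<And>a. a \<in> A \<Longrightarrow> \<phi> (free_gen a) = \<psi> (free_gen a)"
    and "w \<in> carrier (free_group A)"
  shows "\<phi> w = \<psi> w"
proof -
  interpret F: group "free_group A" by (rule group_free_group)
  interpret phi: group_hom "free_group A" G \<phi>
    using assms by (simp add: group_hom_def group_hom_axioms_def is_group group_free_group)
  interpret psi: group_hom "free_group A" G \<psi>
    using assms by (simp add: group_hom_def group_hom_axioms_def is_group group_free_group)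
  show ?thesis
    using assms(4)
  proof (induction w)
    case Nil
    show ?case using phi.hom_one psi.hom_one by (simp add: one_free_group)
  next
    case (Cons x w)
    obtain a e where x: "x = (a, e)" by force
    have a: "a \<in> A" and w: "w \<in> carrier (free_group A)"
      using Cons.prems by (auto simp: x carrier_free_group reduced_Cons)
    have l: "[x] \<in> carrier (free_group A)" using a by (simp add: x carrier_free_group)
    have "x # w = [x] \<otimes>\<^bsub>free_group A\<^esub> w"
      using Cons.prems by (simp add: mult_free_group carrier_free_group reduce_reduced)
    moreover have "\<phi> [x] = \<psi> [x]"
      using eq[OF a] free_gen_closed[OF a] by (auto simp: x letter_eq[OF a])
    ultimately show ?case
      using Cons.IH[OF w] phi.hom_mult[OF l w] psi.hom_mult[OF l w] by metis
  qed
qed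

end

lemma free_endo_eq: "free_endo A f = restrict (free_eval (free_group A) f) (carrier (free_group A))"
  unfolding free_endo_def free_eval_def[abs_def] by (rule refl)

lemma free_endo_hom:
  "f ` A \<subseteq> carrier (free_group A) \<Longrightarrow> free_endo A f \<in> hom (free_group A) (free_group A)"
  unfolding free_endo_eq
  using group.free_eval_hom[OF group_free_group, of f A A]
  by (rule group.hom_restrict[OF group_free_group]) auto

lemma free_endo_gen:
  "f ` A \<subseteq> carrier (free_group A) \<Longrightarrow> a \<in> A \<Longrightarrow> free_endo A f (free_gen a) = f a"
  by (simp add: free_endo_eq free_gen_closed group.free_eval_gen group_free_group)

lemma free_endo_extensional: "free_endo A f \<in> extensional (carrier (free_group A))"
  by (simp add: free_endo_eq)

lemma auto_free_group_eqI:
  assumes "\<phi> \<in> auto (free_group A)" "\<psi> \<in> auto (free_group A)"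
    and "\<And>a. a \<in> A \<Longrightarrow> \<phi> (free_gen a) = \<psi> (free_gen a)"
  shows "\<phi> = \<psi>"
proof (rule extensionalityI[of _ "carrier (free_group A)"])
  fix w assume w: "w \<in> carrier (free_group A)"
  have "\<phi> \<in> hom (free_group A) (free_group A)" "\<psi> \<in> hom (free_group A) (free_group A)"
    using assms(1,2) by (auto simp: auto_def)
  then show "\<phi> w = \<psi> w"
    by (rule group.hom_free_group_eqI[where \<phi> = \<phi> and \<psi> = \<psi>, OF group_free_group _ _ assms(3) w])
qed (use assms(1,2) in \<open>auto simp: auto_def Bij_def\<close>)

text \<open>By uniqueness of homomorphisms, two endomorphisms that are inverse to each other on
  generators are inverse everywhere, so each automorphism below only needs an explicit candidate for
  its inverse.\<close>

lemma free_endo_auto: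
  assumes f: "f ` A \<subseteq> carrier (free_group A)" and g: "g ` A \<subseteq> carrier (free_group A)"
    and fg: "\<And>a. a \<in> A \<Longrightarrow> free_endo A f (g a) = free_gen a"
    and gf: "\<And>a. a \<in> A \<Longrightarrow> free_endo A g (f a) = free_gen a"
  shows "free_endo A f \<in> auto (free_group A)"
proof -
  let ?F = "free_group A" and ?f = "free_endo A f" and ?g = "free_endo A g"
  interpret F: group ?F by (rule group_free_group)
  note hf = free_endo_hom[OF f] and hg = free_endo_hom[OF g]
  have id: "(\<lambda>w. w) \<in> hom ?F ?F" by (simp add: hom_def)
  have c: "?f w \<in> carrier ?F" "?g w \<in> carrier ?F" if "w \<in> carrier ?F" for w
    using hf hg that by (auto simp: hom_def)
  have *: "?f (?g w) = w" if "w \<in> carrier ?F" for w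
    using F.hom_free_group_eqI[OF hom_compose[OF hg hf] id, of w] that fg
    by (simp add: free_endo_gen g)
  have **: "?g (?f w) = w" if "w \<in> carrier ?F" for w
    using F.hom_free_group_eqI[OF hom_compose[OF hf hg] id, of w] that gf
    by (simp add: free_endo_gen f)
  have "bij_betw ?f (carrier ?F) (carrier ?F)"
    by (rule bij_betw_byWitness[where f' = ?g]) (use * ** c in auto)
  then show ?thesis
    using hf free_endo_extensional by (auto simp: auto_def Bij_def)
qed

text \<open>Turns the condition on conjugating words in the definition of \<open>wB\<close> into a
  condition on letters of reduced words, which can be inspected.\<close>

lemma generate_free_gens:
  assumes "B \<subseteq> A"
  shows "generate (free_group A) (free_gen ` B) = carrier (free_group B)"
proof
  interpret F: group "free_group A" by (rule group_free_group)
  have "subgroup (carrier (free_group B)) (free_group A)"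
  proof
    show "carrier (free_group B) \<subseteq> carrier (free_group A)"
      using assms by (auto simp: carrier_free_group)
    fix u assume u: "u \<in> carrier (free_group B)"
    then show "inv\<^bsub>free_group A\<^esub> u \<in> carrier (free_group B)"
      using \<open>carrier (free_group B) \<subseteq> carrier (free_group A)\<close>
      by (subst inv_free_group) (auto simp: carrier_free_group)
    fix v assume "v \<in> carrier (free_group B)"
    then show "u \<otimes>\<^bsub>free_group A\<^esub> v \<in> carrier (free_group B)"
      using u by (simp add: mult_free_group carrier_free_group fst_set_reduce image_Un)
  qed (simp add: one_free_group carrier_free_group)
  then show "generate (free_group A) (free_gen ` B) \<subseteq> carrier (free_group B)"
    by (rule F.generate_subgroup_incl[rotated]) (auto intro: free_gen_closed)
  have sub: "subgroup (generate (free_group A) (free_gen ` B)) (free_group A)"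
    using assms by (intro F.generate_is_subgroup) (auto intro: free_gen_closed)
  show "carrier (free_group B) \<subseteq> generate (free_group A) (free_gen ` B)"
  proof
    fix w assume "w \<in> carrier (free_group B)"
    then show "w \<in> generate (free_group A) (free_gen ` B)"
    proof (induction w)
      case Nil
      then show ?case using generate.one[of "free_group A"] by (simp add: one_free_group)
    next
      case (Cons x w)
      obtain a e where x: "x = (a, e)" by force
      have a: "a \<in> B" and w: "w \<in> carrier (free_group B)"
        using Cons.prems by (auto simp: x carrier_free_group reduced_Cons)
      have g: "free_gen a \<in> generate (free_group A) (free_gen ` B)"
        using a by (auto intro: generate.incl)
      then have "[x] \<in> generate (free_group A) (free_gen ` B)"
        using a assms subgroup.m_inv_closed[OF sub g] by (auto simp: x letter_eq[of a A])
      moreover have "x # w = [x] \<otimes>\<^bsub>free_group A\<^esub> w"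
        using Cons.prems by (simp add: mult_free_group carrier_free_group reduce_reduced)
      ultimately show ?case
        using Cons.IH[OF w] subgroup.m_closed[OF sub] by metis
    qed
  qed
qed

section \<open>Blocks\<close>

lemma sum_list_take_mono: "k \<le> k' \<Longrightarrow> sum_list (take k lam) \<le> sum_list (take k' (lam :: nat list))"
  by (metis le_add1 min.absorb1 sum_list_append take_add take_take le_add_diff_inverse)

lemma block_inj:
  assumes "i \<in> block lam k" "i \<in> block lam k'"
  shows "k = k'"
proof (rule ccontr)
  assume "k \<noteq> k'"
  then have "k + 1 \<le> k' \<or> k' + 1 \<le> k" by auto
  then show False
    using assms sum_list_take_mono[of "k + 1" k' lam] sum_list_take_mono[of "k' + 1" k lam]
    by (auto simp: block_def)
qed

lemma block_subset: "block lam k \<subseteq> {..<sum_list lam}"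
  using sum_list_take_mono[of "k + 1" "max (k + 1) (length lam)" lam] by (auto simp: block_def)

lemma card_block: "k < length lam \<Longrightarrow> card (block lam k) = lam ! k"
  by (simp add: block_def take_Suc_conv_app_nth)

lemma ex_block: "i < sum_list lam \<Longrightarrow> \<exists>k<length lam. i \<in> block lam k"
proof (induction lam rule: rev_induct)
  case (snoc a lam)
  show ?case
  proof (cases "i < sum_list lam")
    case True
    then obtain k where "k < length lam" "i \<in> block lam k" using snoc.IH by blast
    then have "k < length (lam @ [a])" "i \<in> block (lam @ [a]) k" by (auto simp: block_def)
    then show ?thesis by blast
  next
    case False
    then have "i \<in> block (lam @ [a]) (length lam)" using snoc.prems by (auto simp: block_def)
    then show ?thesis by auto
  qed
qed auto

text \<open>A permutation is injective and blocks are finite, so mapping a block into itself already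
  means mapping it onto itself.\<close>

lemma young_subgroup_iff:
  "\<sigma> \<in> young_subgroup lam \<longleftrightarrow>
     \<sigma> permutes {..<sum_list lam} \<and> (\<forall>k<length lam. \<forall>i\<in>block lam k. \<sigma> i \<in> block lam k)"
proof -
  have "\<sigma> ` block lam k = block lam k"
    if "\<sigma> permutes {..<sum_list lam}" "\<forall>i\<in>block lam k. \<sigma> i \<in> block lam k" for k
  proof (rule endo_inj_surj)
    show "finite (block lam k)" by (simp add: block_def)
    show "inj_on \<sigma> (block lam k)" using permutes_inj[OF that(1)] by (auto simp: inj_def inj_on_def)
  qed (use that in auto)
  then show ?thesis by (auto simp: young_subgroup_def)
qed

lemma young_subgroup_comp:
  "\<sigma> \<in> young_subgroup lam \<Longrightarrow> \<tau> \<in> young_subgroup lam \<Longrightarrow> \<sigma> \<circ> \<tau> \<in> young_subgroup lam"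
  by (auto simp: young_subgroup_iff permutes_compose)

lemma young_subgroup_inv:
  assumes "\<sigma> \<in> young_subgroup lam"
  shows "Hilbert_Choice.inv \<sigma> \<in> young_subgroup lam"
proof -
  have p: "\<sigma> permutes {..<sum_list lam}" and im: "\<And>k. k < length lam \<Longrightarrow> \<sigma> ` block lam k = block lam k"
    using assms by (auto simp: young_subgroup_def)
  have "Hilbert_Choice.inv \<sigma> i \<in> block lam k" if k: "k < length lam" "i \<in> block lam k" for k i
  proof -
    obtain j where "j \<in> block lam k" "\<sigma> j = i" using im[OF k(1)] k(2) by (metis imageE)
    then show ?thesis using permutes_inverses(2)[OF p, of j] by simp
  qed
  then show ?thesis using permutes_inv[OF p] by (simp add: young_subgroup_iff)
qed

lemma young_subgroup_transpose:
  assumes "i \<in> block lam k" "j \<in> block lam k"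
  shows "transpose i j \<in> young_subgroup lam"
proof -
  have "transpose i j permutes {..<sum_list lam}"
    using assms block_subset by (intro permutes_swap_id) auto
  moreover have "transpose i j m \<in> block lam k'" if "m \<in> block lam k'" for m k'
    using assms that block_inj[of m lam k k'] by (auto simp: transpose_def)
  ultimately show ?thesis by (simp add: young_subgroup_iff)
qed

lemma id_young_subgroup: "id \<in> young_subgroup lam"
  by (auto simp: young_subgroup_iff permutes_id)

lemma young_subgroup_block:
  assumes "\<sigma> \<in> young_subgroup lam"
  shows "\<sigma> i \<in> block lam k \<longleftrightarrow> i \<in> block lam k"
proof -
  have *: "\<sigma> j \<in> block lam k" if "\<sigma> \<in> young_subgroup lam" "j \<in> block lam k" for \<sigma> j
  proof (cases "k < length lam")
    case False
    then have "block lam k = {}" by (simp add: block_def)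
    then show ?thesis using that by simp
  qed (use that in \<open>auto simp: young_subgroup_iff\<close>)
  have "\<sigma> permutes {..<sum_list lam}" using assms by (simp add: young_subgroup_iff)
  then have "Hilbert_Choice.inv \<sigma> (\<sigma> i) = i" by (rule permutes_inverses(2))
  then show ?thesis
    using *[OF assms, of i] *[OF young_subgroup_inv[OF assms], of "\<sigma> i"] by auto
qed

lemma block_append1: "k < length lamP \<Longrightarrow> block (lamP @ lamS) k \<subseteq> {..<sum_list lamP}"
  using block_subset[of lamP k] by (simp add: block_def)

lemma block_append2: "length lamP \<le> k \<Longrightarrow> block (lamP @ lamS) k \<subseteq> {sum_list lamP..}"
  by (auto simp: block_def)

section \<open>The group of automorphisms and its generators\<close>

definition perm_aut :: "nat \<Rightarrow> (nat \<Rightarrow> nat) \<Rightarrow> nat word \<Rightarrow> nat word" where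
  "perm_aut n \<pi> = free_endo {..<n} (\<lambda>i. free_gen (\<pi> i))"

text \<open>For \<open>e = False\<close> this is the inverse of \<open>chi_aut n a b\<close>.
  Nielsen moves need both exponents, and a letter with a boolean sign treats them together.\<close>

definition chi_sgn :: "nat \<Rightarrow> nat \<Rightarrow> nat \<Rightarrow> bool \<Rightarrow> nat word \<Rightarrow> nat word" where
  "chi_sgn n a b e = free_endo {..<n}
     (free_gen(a := [(b, e)] \<otimes>\<^bsub>FG n\<^esub> free_gen a \<otimes>\<^bsub>FG n\<^esub> [(b, \<not> e)]))"

lemma letter_closed: "j < n \<Longrightarrow> [(j, e)] \<in> carrier (FG n)"
  by (simp add: carrier_free_group)

lemma inv_letter: "j < n \<Longrightarrow> inv\<^bsub>FG n\<^esub> [(j, e)] = [(j, \<not> e)]"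
  by (simp add: inv_free_group letter_closed)

lemma free_gen_letter: "free_gen j = [(j, True)]"
  by (simp add: free_gen_def)

lemma letter_int_pow:
  assumes "j < n"
  shows "free_gen j [^]\<^bsub>FG n\<^esub> (1::int) = [(j, True)]" "free_gen j [^]\<^bsub>FG n\<^esub> (-1::int) = [(j, False)]"
proof -
  interpret F: group "FG n" by (rule group_free_group)
  have c: "free_gen j \<in> carrier (FG n)" using assms by (simp add: free_gen_closed)
  show "free_gen j [^]\<^bsub>FG n\<^esub> (1::int) = [(j, True)]"
    using F.int_pow_1[OF c] by (simp add: free_gen_letter)
  show "free_gen j [^]\<^bsub>FG n\<^esub> (-1::int) = [(j, False)]"
    using F.int_pow_neg[OF c, of 1] F.int_pow_1[OF c] inv_letter[OF assms] by (simp add: free_gen_letter)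
qed

locale wB_group =
  fixes lamP lamS :: "nat list"
begin

abbreviation lam where "lam \<equiv> lamP @ lamS"
abbreviation nP where "nP \<equiv> sum_list lamP"
definition n where "n = sum_list lam"
abbreviation F where "F \<equiv> FG n"
abbreviation FS where "FS \<equiv> free_group {nP..<n}"
abbreviation G where "G \<equiv> wB lamP lamS"

abbreviation mult_F (infixl \<open>\<cdot>\<close> 70) where "u \<cdot> v \<equiv> u \<otimes>\<^bsub>FG n\<^esub> v"
abbreviation mult_G (infixl \<open>\<bullet>\<close> 70) where "\<phi> \<bullet> \<psi> \<equiv> \<phi> \<otimes>\<^bsub>wB lamP lamS\<^esub> \<psi>"

sublocale F: group F by (rule group_free_group)

lemma young_less: "\<sigma> \<in> young_subgroup lam \<Longrightarrow> i < n \<Longrightarrow> \<sigma> i < n"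
  using permutes_in_image[of \<sigma> "{..<n}" i] by (simp add: young_subgroup_iff n_def)

lemma young_less_nP:
  assumes "\<sigma> \<in> young_subgroup lam" "i < n"
  shows "\<sigma> i < nP \<longleftrightarrow> i < nP"
proof -
  obtain k where k: "k < length lam" "i \<in> block lam k" using ex_block assms unfolding n_def by blast
  then have "\<sigma> i \<in> block lam k" using assms young_subgroup_block by blast
  then show ?thesis
    using k block_append1[of k lamP lamS] block_append2[of lamP k lamS] by (cases "k < length lamP") fastforce+
qed

lemma subgroup_FS: "subgroup (carrier FS) F"
  by (subst generate_free_gens[of _ "{..<n}", symmetric])
    (auto intro!: F.generate_is_subgroup free_gen_closed)

lemma FS_subset: "w \<in> carrier FS \<Longrightarrow> w \<in> carrier F"
  using subgroup.subset[OF subgroup_FS] by blast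

text \<open>The clause on generators in the definition of \<open>wB\<close>, with the exponent
  encoded as the sign of a letter. The index i enters only through the requirement that points are
  not inverted.\<close>

definition conj_letter :: "nat \<Rightarrow> nat \<Rightarrow> nat word \<Rightarrow> bool" where
  "conj_letter i j u \<longleftrightarrow> (\<exists>w\<in>carrier FS. \<exists>e. (i < nP \<longrightarrow> e) \<and> u = w \<cdot> [(j, e)] \<cdot> inv\<^bsub>F\<^esub> w)"

lemma conj_letterI:
  "w \<in> carrier FS \<Longrightarrow> (i < nP \<Longrightarrow> e) \<Longrightarrow> u = w \<cdot> [(j, e)] \<cdot> inv\<^bsub>F\<^esub> w \<Longrightarrow> conj_letter i j u"
  unfolding conj_letter_def by blast

lemma conj_letterE:
  assumes "conj_letter i j u"
  obtains w e where "w \<in> carrier FS" "i < nP \<Longrightarrow> e" "u = w \<cdot> [(j, e)] \<cdot> inv\<^bsub>F\<^esub> w"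
  using assms unfolding conj_letter_def by blast

lemma mem_wB_iff:
  "\<phi> \<in> carrier G \<longleftrightarrow>
     \<phi> \<in> auto F \<and> (\<exists>\<sigma>\<in>young_subgroup lam. \<forall>i<n. conj_letter i (\<sigma> i) (\<phi> (free_gen i)))"
proof -
  have FS: "generate F (free_gen ` {nP..<n}) = carrier FS"
    by (rule generate_free_gens) auto
  have n: "nP + sum_list lamS = n" by (simp add: n_def)
  have *: "(\<exists>w. \<exists>\<epsilon> :: nat \<Rightarrow> int. \<forall>i<n. w i \<in> carrier FS \<and> \<epsilon> i \<in> {1, -1} \<and> (i < nP \<longrightarrow> \<epsilon> i = 1) \<and>
              \<phi> (free_gen i) = w i \<cdot> (free_gen (\<sigma> i) [^]\<^bsub>F\<^esub> \<epsilon> i) \<cdot> inv\<^bsub>F\<^esub> (w i)) \<longleftrightarrow>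
      (\<forall>i<n. conj_letter i (\<sigma> i) (\<phi> (free_gen i)))" (is "?L \<longleftrightarrow> ?R")
    if \<sigma>: "\<sigma> \<in> young_subgroup lam" for \<sigma>
  proof
    assume ?L
    then obtain w and \<epsilon> :: "nat \<Rightarrow> int"
      where *: "\<And>i. i < n \<Longrightarrow> w i \<in> carrier FS \<and> \<epsilon> i \<in> {1, -1} \<and> (i < nP \<longrightarrow> \<epsilon> i = 1) \<and>
              \<phi> (free_gen i) = w i \<cdot> (free_gen (\<sigma> i) [^]\<^bsub>F\<^esub> \<epsilon> i) \<cdot> inv\<^bsub>F\<^esub> (w i)"
      by blast
    show ?R
    proof (intro allI impI)
      fix i assume i: "i < n"
      show "conj_letter i (\<sigma> i) (\<phi> (free_gen i))"
        using *[OF i] letter_int_pow[OF young_less[OF \<sigma> i]]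
        by (intro conj_letterI[of "w i" i "\<epsilon> i = 1"]) auto
    qed
  next
    assume ?R
    then have "\<forall>i. \<exists>w e. i < n \<longrightarrow> w \<in> carrier FS \<and> (i < nP \<longrightarrow> e) \<and>
        \<phi> (free_gen i) = w \<cdot> [(\<sigma> i, e)] \<cdot> inv\<^bsub>F\<^esub> w"
      unfolding conj_letter_def by blast
    then obtain w e where *: "\<And>i. i < n \<Longrightarrow> w i \<in> carrier FS \<and> (i < nP \<longrightarrow> e i) \<and>
        \<phi> (free_gen i) = w i \<cdot> [(\<sigma> i, e i)] \<cdot> inv\<^bsub>F\<^esub> (w i)"
      by metis
    show ?L
    proof (intro exI allI impI)
      fix i assume i: "i < n"
      let ?e = "\<lambda>i. if e i then 1 else -1 :: int"
      show "w i \<in> carrier FS \<and> ?e i \<in> {1, -1} \<and> (i < nP \<longrightarrow> ?e i = 1) \<and>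
              \<phi> (free_gen i) = w i \<cdot> (free_gen (\<sigma> i) [^]\<^bsub>F\<^esub> ?e i) \<cdot> inv\<^bsub>F\<^esub> (w i)"
        using *[OF i] letter_int_pow[OF young_less[OF \<sigma> i]] by auto
    qed
  qed
  have "\<phi> \<in> carrier G \<longleftrightarrow> \<phi> \<in> auto F \<and> (\<exists>\<sigma>\<in>young_subgroup lam.
      \<exists>w. \<exists>\<epsilon> :: nat \<Rightarrow> int. \<forall>i<n. w i \<in> carrier FS \<and> \<epsilon> i \<in> {1, -1} \<and> (i < nP \<longrightarrow> \<epsilon> i = 1) \<and>
              \<phi> (free_gen i) = w i \<cdot> (free_gen (\<sigma> i) [^]\<^bsub>F\<^esub> \<epsilon> i) \<cdot> inv\<^bsub>F\<^esub> (w i))"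
    unfolding wB_def Let_def n FS by (simp, blast)
  then show ?thesis using * by blast
qed

lemma mem_wBI:
  "\<phi> \<in> auto F \<Longrightarrow> \<sigma> \<in> young_subgroup lam \<Longrightarrow> (\<And>i. i < n \<Longrightarrow> conj_letter i (\<sigma> i) (\<phi> (free_gen i))) \<Longrightarrow>
    \<phi> \<in> carrier G"
  unfolding mem_wB_iff by blast

lemma wB_auto: "\<phi> \<in> carrier G \<Longrightarrow> \<phi> \<in> auto F"
  by (simp add: mem_wB_iff)

lemma auto_hom: "\<phi> \<in> auto F \<Longrightarrow> \<phi> \<in> hom F F"
  by (simp add: auto_def)

lemma hom_simps:
  assumes "\<phi> \<in> hom F F"
  shows "\<And>u. u \<in> carrier F \<Longrightarrow> \<phi> u \<in> carrier F"
    and "\<And>u v. u \<in> carrier F \<Longrightarrow> v \<in> carrier F \<Longrightarrow> \<phi> (u \<cdot> v) = \<phi> u \<cdot> \<phi> v"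
    and "\<And>u. u \<in> carrier F \<Longrightarrow> \<phi> (inv\<^bsub>F\<^esub> u) = inv\<^bsub>F\<^esub> \<phi> u"
    and "\<phi> \<one>\<^bsub>F\<^esub> = \<one>\<^bsub>F\<^esub>"
    and "\<And>j e. j < n \<Longrightarrow> \<phi> [(j, e)] = (if e then \<phi> (free_gen j) else inv\<^bsub>F\<^esub> (\<phi> (free_gen j)))"
proof -
  interpret group_hom F F \<phi>
    using assms by unfold_locales
  show "\<And>u. u \<in> carrier F \<Longrightarrow> \<phi> u \<in> carrier F"
    "\<And>u v. u \<in> carrier F \<Longrightarrow> v \<in> carrier F \<Longrightarrow> \<phi> (u \<cdot> v) = \<phi> u \<cdot> \<phi> v"
    "\<And>u. u \<in> carrier F \<Longrightarrow> \<phi> (inv\<^bsub>F\<^esub> u) = inv\<^bsub>F\<^esub> \<phi> u"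
    "\<phi> \<one>\<^bsub>F\<^esub> = \<one>\<^bsub>F\<^esub>"
    by auto
  then show "\<phi> [(j, e)] = (if e then \<phi> (free_gen j) else inv\<^bsub>F\<^esub> (\<phi> (free_gen j)))" if "j < n" for j e
    using that letter_eq[of j "{..<n}" e] by (simp add: free_gen_closed)
qed

lemma hom_conj_letter:
  assumes \<phi>: "\<phi> \<in> hom F F" and j: "j < n" "k < n" and c: "conj_letter j k (\<phi> (free_gen j))"
  shows "\<exists>w\<in>carrier FS. \<exists>e'. (j < nP \<longrightarrow> e' = e) \<and> \<phi> [(j, e)] = w \<cdot> [(k, e')] \<cdot> inv\<^bsub>F\<^esub> w"
proof -
  obtain w e0 where w: "w \<in> carrier FS" "j < nP \<Longrightarrow> e0" "\<phi> (free_gen j) = w \<cdot> [(k, e0)] \<cdot> inv\<^bsub>F\<^esub> w"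
    using c by (elim conj_letterE) auto
  have wF: "w \<in> carrier F" using w FS_subset by blast
  \<comment> \<open>Exponents multiply; with \<open>True\<close> for +1 and \<open>False\<close> for
    -1, the product of two signs is their equality.\<close>
  have "\<phi> [(j, e)] = w \<cdot> [(k, e0 = e)] \<cdot> inv\<^bsub>F\<^esub> w"
  proof (cases e)
    case True
    then show ?thesis using w j hom_simps(5)[OF \<phi>, of j] by simp
  next
    case False
    have "inv\<^bsub>F\<^esub> (w \<cdot> [(k, e0)] \<cdot> inv\<^bsub>F\<^esub> w) = w \<cdot> [(k, \<not> e0)] \<cdot> inv\<^bsub>F\<^esub> w"
      using wF j by (simp add: F.inv_mult_group letter_closed inv_letter F.m_assoc)
    then show ?thesis using w j False hom_simps(5)[OF \<phi>, of j] by simp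
  qed
  moreover have "j < nP \<longrightarrow> (e0 = e) = e" using w(2) by simp
  ultimately show ?thesis using w(1) by (intro bexI[of _ w] exI[of _ "e0 = e"] conjI)
qed

lemma hom_FS_closed:
  assumes \<phi>: "\<phi> \<in> hom F F" and S: "\<And>j. nP \<le> j \<Longrightarrow> j < n \<Longrightarrow> \<phi> (free_gen j) \<in> carrier FS" and w: "w \<in> carrier FS"
  shows "\<phi> w \<in> carrier FS"
proof -
  interpret S: subgroup "carrier FS" F by (rule subgroup_FS)
  have "subgroup {w \<in> carrier F. \<phi> w \<in> carrier FS} F"
    by unfold_locales (auto simp: hom_simps[OF \<phi>])
  then have "generate F (free_gen ` {nP..<n}) \<subseteq> {w \<in> carrier F. \<phi> w \<in> carrier FS}"
    by (rule F.generate_subgroup_incl[rotated]) (auto intro: S free_gen_closed)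
  then show ?thesis using w by (subst (asm) generate_free_gens) auto
qed

lemma letter_FS: "nP \<le> j \<Longrightarrow> j < n \<Longrightarrow> [(j, e)] \<in> carrier FS"
  by (simp add: carrier_free_group)

lemma wB_FS_closed:
  assumes \<phi>: "\<phi> \<in> carrier G" and w: "w \<in> carrier FS"
  shows "\<phi> w \<in> carrier FS"
proof (rule hom_FS_closed[OF _ _ w])
  show h: "\<phi> \<in> hom F F" using \<phi> wB_auto auto_hom by blast
  interpret S: subgroup "carrier FS" F by (rule subgroup_FS)
  fix j assume j: "nP \<le> j" "j < n"
  obtain \<sigma> where \<sigma>: "\<sigma> \<in> young_subgroup lam" "conj_letter j (\<sigma> j) (\<phi> (free_gen j))"
    using \<phi> j by (auto simp: mem_wB_iff)
  then have "[(\<sigma> j, e)] \<in> carrier FS" for e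
    using j young_less young_less_nP by (intro letter_FS) (auto simp: not_less[symmetric])
  then show "\<phi> (free_gen j) \<in> carrier FS"
    using \<sigma>(2) by (auto simp: conj_letter_def)
qed

text \<open>The retraction onto \<open>FS\<close> killing the other generators commutes with \<open>\<phi>\<close>.\<close>

lemma wB_FS_reflect:
  assumes \<phi>: "\<phi> \<in> carrier G" and u: "u \<in> carrier F" and "\<phi> u \<in> carrier FS"
  shows "u \<in> carrier FS"
proof -
  let ?f = "\<lambda>i. if nP \<le> i then free_gen i else \<one>\<^bsub>F\<^esub>"
  let ?r = "free_eval F ?f"
  have f: "?f ` {..<n} \<subseteq> carrier F" by (auto simp: free_gen_closed)
  have r: "?r \<in> hom F F" by (rule F.free_eval_hom[OF f])
  have h: "\<phi> \<in> hom F F" using \<phi> wB_auto auto_hom by blast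
  interpret S: subgroup "carrier FS" F by (rule subgroup_FS)
  have r_gen: "?r (free_gen i) = ?f i" if "i < n" for i
    using F.free_eval_gen[OF _ f, of i] that by simp
  have id: "(\<lambda>w. w) \<in> hom F F" by (simp add: hom_def)
  have rS: "?r w = w" if "w \<in> carrier FS" for w
  proof -
    have "{w \<in> carrier F. ?r w = w} \<supseteq> generate F (free_gen ` {nP..<n})"
    proof (rule F.generate_subgroup_incl)
      show "subgroup {w \<in> carrier F. ?r w = w} F"
        by unfold_locales (auto simp: hom_simps[OF r])
    qed (auto simp: r_gen free_gen_closed)
    then show ?thesis using that by (subst (asm) generate_free_gens) auto
  qed
  have r_in: "?r w \<in> carrier FS" if "w \<in> carrier F" for w
  proof -
    have "subgroup {w \<in> carrier F. ?r w \<in> carrier FS} F"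
      by unfold_locales (auto simp: hom_simps[OF r])
    then have "generate F (free_gen ` {..<n}) \<subseteq> {w \<in> carrier F. ?r w \<in> carrier FS}"
      by (rule F.generate_subgroup_incl[rotated]) (auto simp: r_gen free_gen_closed)
    then show ?thesis using that by (subst (asm) generate_free_gens) auto
  qed
  \<comment> \<open>On a point generator both sides are trivial, because \<phi> sends it to a
    conjugate of a point. On a circle generator the retraction acts as the identity before and after
    \<phi>.\<close>
  have "?r (\<phi> u) = \<phi> (?r u)"
  proof (rule F.hom_free_group_eqI[where \<phi> = "?r \<circ> \<phi>" and \<psi> = "\<phi> \<circ> ?r", OF hom_compose[OF h r] hom_compose[OF r h] _ u,
        unfolded comp_def])
    fix i assume "i \<in> {..<n}"
    then have i: "i < n" by simp
    show "?r (\<phi> (free_gen i)) = \<phi> (?r (free_gen i))"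
    proof (cases "nP \<le> i")
      case True
      then have "\<phi> (free_gen i) \<in> carrier FS"
        using wB_FS_closed[OF \<phi>, of "free_gen i"] i by (simp add: free_gen_closed)
      then show ?thesis using True i by (simp add: rS r_gen)
    next
      case False
      obtain \<sigma> where \<sigma>: "\<sigma> \<in> young_subgroup lam" "conj_letter i (\<sigma> i) (\<phi> (free_gen i))"
        using \<phi> i by (auto simp: mem_wB_iff)
      then obtain w e where w: "w \<in> carrier FS" "\<phi> (free_gen i) = w \<cdot> [(\<sigma> i, e)] \<cdot> inv\<^bsub>F\<^esub> w"
        by (elim conj_letterE)
      have s: "\<sigma> i < n" "\<not> nP \<le> \<sigma> i"
        using False \<sigma> i young_less_nP[OF \<sigma>(1) i] young_less[OF \<sigma>(1) i] by auto
      have "?r [(\<sigma> i, e)] = \<one>\<^bsub>F\<^esub>"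
        using s hom_simps(5)[OF r s(1)] by (simp add: r_gen)
      then have "?r (\<phi> (free_gen i)) = \<one>\<^bsub>F\<^esub>"
        using w s by (simp add: hom_simps(1-4)[OF r] FS_subset letter_closed)
      then show ?thesis using False i by (simp add: r_gen hom_simps[OF h])
    qed
  qed
  then have "\<phi> (?r u) = \<phi> u" using rS assms(3) by simp
  moreover have "inj_on \<phi> (carrier F)"
    using \<phi> wB_auto by (auto simp: auto_def Bij_def bij_betw_def)
  ultimately have "?r u = u"
    using u r_in FS_subset by (meson inj_on_def)
  then show ?thesis using r_in[OF u] by simp
qed

lemma mult_AutoGroup:
  "\<phi> \<in> auto F \<Longrightarrow> \<psi> \<in> auto F \<Longrightarrow> \<phi> \<otimes>\<^bsub>AutoGroup F\<^esub> \<psi> = compose (carrier F) \<phi> \<psi>"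
  by (simp add: AutoGroup_def BijGroup_def auto_def)

text \<open>The delicate part is closure under inverses. If \<phi> sends x_i to a conjugate by w of
  a letter at j, then the inverse \<psi> sends that letter to the conjugate of x_i by the inverse of
  \<psi> w. That \<psi> w is again a word in the circle letters is what \<open>wB_FS_reflect\<close>
  provides.\<close>

lemma subgroup_wB: "subgroup (carrier G) (AutoGroup F)"
proof -
  interpret A: group "AutoGroup F" by (rule F.AutoGroup)
  interpret S: subgroup "carrier FS" F by (rule subgroup_FS)
  have carrier_A: "carrier (AutoGroup F) = auto F" by (simp add: AutoGroup_def)
  have one_A: "\<one>\<^bsub>AutoGroup F\<^esub> = (\<lambda>w\<in>carrier F. w)" by (simp add: AutoGroup_def BijGroup_def)
  show ?thesis
  proof
    show "carrier G \<subseteq> carrier (AutoGroup F)"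
      by (auto simp: carrier_A wB_auto)
  next
    fix \<phi> \<psi> assume \<phi>: "\<phi> \<in> carrier G" and \<psi>: "\<psi> \<in> carrier G"
    have h: "\<phi> \<in> hom F F" using \<phi> wB_auto auto_hom by blast
    from \<phi> obtain \<sigma> where \<sigma>: "\<sigma> \<in> young_subgroup lam" "\<And>i. i < n \<Longrightarrow> conj_letter i (\<sigma> i) (\<phi> (free_gen i))"
      by (auto simp: mem_wB_iff)
    from \<psi> obtain \<tau> where \<tau>: "\<tau> \<in> young_subgroup lam" "\<And>i. i < n \<Longrightarrow> conj_letter i (\<tau> i) (\<psi> (free_gen i))"
      by (auto simp: mem_wB_iff)
    have "conj_letter i ((\<sigma> \<circ> \<tau>) i) (compose (carrier F) \<phi> \<psi> (free_gen i))" if i: "i < n" for i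
    proof -
      have s: "\<tau> i < n" "\<sigma> (\<tau> i) < n" "i < nP \<longleftrightarrow> \<tau> i < nP"
        using \<sigma> \<tau> i young_less young_less_nP by auto
      obtain w e where w: "w \<in> carrier FS" "i < nP \<Longrightarrow> e" "\<psi> (free_gen i) = w \<cdot> [(\<tau> i, e)] \<cdot> inv\<^bsub>F\<^esub> w"
        using \<tau>(2)[OF i] by (elim conj_letterE) auto
      obtain v e' where v: "v \<in> carrier FS" "\<tau> i < nP \<Longrightarrow> e' = e" "\<phi> [(\<tau> i, e)] = v \<cdot> [(\<sigma> (\<tau> i), e')] \<cdot> inv\<^bsub>F\<^esub> v"
        using hom_conj_letter[OF h s(1,2) \<sigma>(2)[OF s(1)], of e] by blast
      have "compose (carrier F) \<phi> \<psi> (free_gen i) = \<phi> w \<cdot> v \<cdot> [(\<sigma> (\<tau> i), e')] \<cdot> inv\<^bsub>F\<^esub> (\<phi> w \<cdot> v)"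
        using w v s i FS_subset
        by (simp add: compose_def free_gen_closed hom_simps(1-4)[OF h] letter_closed F.inv_mult_group F.m_assoc)
      moreover have "\<phi> w \<cdot> v \<in> carrier FS"
        using wB_FS_closed[OF \<phi>] w v by auto
      ultimately show ?thesis
        using w v s by (intro conj_letterI[of "\<phi> w \<cdot> v" i e']) auto
    qed
    moreover have "\<phi> \<otimes>\<^bsub>AutoGroup F\<^esub> \<psi> = compose (carrier F) \<phi> \<psi>"
      using \<phi> \<psi> wB_auto by (simp add: mult_AutoGroup)
    moreover have "\<phi> \<otimes>\<^bsub>AutoGroup F\<^esub> \<psi> \<in> auto F"
      using A.m_closed[of \<phi> \<psi>] \<phi> \<psi> wB_auto by (simp add: carrier_A)
    ultimately show "\<phi> \<otimes>\<^bsub>AutoGroup F\<^esub> \<psi> \<in> carrier G"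
      using young_subgroup_comp[OF \<sigma>(1) \<tau>(1)] by (intro mem_wBI[where \<sigma> = "\<sigma> \<circ> \<tau>"]) simp_all
  next
    have "conj_letter i (id i) ((\<lambda>w\<in>carrier F. w) (free_gen i))" if "i < n" for i
    proof (rule conj_letterI[where e = True, OF S.one_closed])
      show "(\<lambda>w\<in>carrier F. w) (free_gen i) = \<one>\<^bsub>F\<^esub> \<cdot> [(id i, True)] \<cdot> inv\<^bsub>F\<^esub> \<one>\<^bsub>F\<^esub>"
        using that letter_closed[OF that, of True] by (simp add: free_gen_letter)
    qed simp
    then show "\<one>\<^bsub>AutoGroup F\<^esub> \<in> carrier G"
      unfolding one_A by (rule mem_wBI[OF F.id_in_auto id_young_subgroup])
  next
    fix \<phi> assume \<phi>: "\<phi> \<in> carrier G"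
    let ?\<psi> = "inv\<^bsub>AutoGroup F\<^esub> \<phi>"
    have h: "\<phi> \<in> hom F F" using \<phi> wB_auto auto_hom by blast
    have \<phi>A: "\<phi> \<in> carrier (AutoGroup F)" using \<phi> wB_auto by (simp add: carrier_A)
    have \<psi>A: "?\<psi> \<in> auto F" using A.inv_closed[OF \<phi>A] by (simp add: carrier_A)
    then have h': "?\<psi> \<in> hom F F" using auto_hom by blast
    have "compose (carrier F) ?\<psi> \<phi> = (\<lambda>w\<in>carrier F. w)" "compose (carrier F) \<phi> ?\<psi> = (\<lambda>w\<in>carrier F. w)"
      using A.l_inv[OF \<phi>A] A.r_inv[OF \<phi>A] \<phi> \<psi>A wB_auto by (auto simp: mult_AutoGroup one_A)
    then have inv: "?\<psi> (\<phi> w) = w" "\<phi> (?\<psi> w) = w" if "w \<in> carrier F" for w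
      using that by (auto simp: compose_def dest!: fun_cong[where x = w])
    from \<phi> obtain \<sigma> where \<sigma>: "\<sigma> \<in> young_subgroup lam" "\<And>i. i < n \<Longrightarrow> conj_letter i (\<sigma> i) (\<phi> (free_gen i))"
      by (auto simp: mem_wB_iff)
    let ?\<tau> = "Hilbert_Choice.inv \<sigma>"
    have \<tau>: "?\<tau> \<in> young_subgroup lam" using \<sigma>(1) by (rule young_subgroup_inv)
    have "conj_letter j (?\<tau> j) (?\<psi> (free_gen j))" if j: "j < n" for j
    proof -
      define i where "i = ?\<tau> j"
      have "\<sigma> permutes {..<n}" using \<sigma> by (simp add: young_subgroup_iff n_def)
      then have i: "i < n" "\<sigma> i = j" "i < nP \<longleftrightarrow> j < nP"
        using young_less[OF \<tau> j] young_less_nP[OF \<tau> j] permutes_inverses[of \<sigma> "{..<n}"] by (auto simp: i_def)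
      obtain w e where w: "w \<in> carrier FS" "i < nP \<Longrightarrow> e" "\<phi> (free_gen i) = w \<cdot> [(j, e)] \<cdot> inv\<^bsub>F\<^esub> w"
        using \<sigma>(2)[OF i(1)] i(2) by (elim conj_letterE) auto
      let ?v = "?\<psi> w"
      have wF: "w \<in> carrier F" using w FS_subset by blast
      have vF: "?v \<in> carrier F" using wF by (simp add: hom_simps(1)[OF h'])
      have v: "?v \<in> carrier FS"
        using wB_FS_reflect[OF \<phi> vF] inv wF w by simp
      have "free_gen i = ?\<psi> (\<phi> (free_gen i))" using inv i by (simp add: free_gen_closed)
      also have "\<dots> = ?v \<cdot> ?\<psi> [(j, e)] \<cdot> inv\<^bsub>F\<^esub> ?v"
        using w wF j by (simp add: hom_simps(1-4)[OF h'] letter_closed)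
      finally have "inv\<^bsub>F\<^esub> ?v \<cdot> free_gen i \<cdot> ?v = ?\<psi> [(j, e)]"
        using vF j by (simp add: hom_simps(1)[OF h'] letter_closed F.group_word_simps)
      then have *: "?\<psi> [(j, e)] = inv\<^bsub>F\<^esub> ?v \<cdot> [(i, True)] \<cdot> inv\<^bsub>F\<^esub> (inv\<^bsub>F\<^esub> ?v)"
        using vF by (simp add: free_gen_letter)
      have "?\<psi> (free_gen j) = inv\<^bsub>F\<^esub> ?v \<cdot> [(i, e)] \<cdot> inv\<^bsub>F\<^esub> (inv\<^bsub>F\<^esub> ?v)"
      proof (cases e)
        case True
        then show ?thesis using * by (simp add: free_gen_letter)
      next
        case False
        then have "?\<psi> (free_gen j) = inv\<^bsub>F\<^esub> (?\<psi> [(j, e)])"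
          using j hom_simps(5)[OF h' j] by (simp add: hom_simps(1)[OF h'] free_gen_closed)
        then show ?thesis
          using * False vF i by (simp add: F.inv_mult_group letter_closed inv_letter F.m_assoc)
      qed
      then show ?thesis
        using v w i by (intro conj_letterI[of "inv\<^bsub>F\<^esub> ?v" j e]) (auto simp: i_def)
    qed
    then show "?\<psi> \<in> carrier G"
      using \<tau> \<psi>A by (intro mem_wBI)
  qed
qed

lemma wB_eq: "G = AutoGroup F\<lparr>carrier := carrier G\<rparr>"
  by (simp add: wB_def Let_def n_def)

sublocale G: group G
proof -
  interpret A: group "AutoGroup F" by (rule F.AutoGroup)
  have "group (AutoGroup F\<lparr>carrier := carrier G\<rparr>)"
    by (rule subgroup.subgroup_is_group[OF subgroup_wB F.AutoGroup])
  then show "group G" by (simp only: wB_eq[symmetric])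
qed

lemma mult_wB: "\<phi> \<in> carrier G \<Longrightarrow> \<psi> \<in> carrier G \<Longrightarrow> \<phi> \<bullet> \<psi> = compose (carrier F) \<phi> \<psi>"
  by (subst wB_eq) (simp add: mult_AutoGroup wB_auto)

lemma mult_wB_apply:
  "\<phi> \<in> carrier G \<Longrightarrow> \<psi> \<in> carrier G \<Longrightarrow> u \<in> carrier F \<Longrightarrow> (\<phi> \<bullet> \<psi>) u = \<phi> (\<psi> u)"
  by (simp add: mult_wB compose_def)

lemma one_wB: "\<one>\<^bsub>G\<^esub> = (\<lambda>w\<in>carrier F. w)"
  by (subst wB_eq) (simp add: AutoGroup_def BijGroup_def)

lemma wB_eqI:
  assumes "\<phi> \<in> carrier G" "\<psi> \<in> carrier G" "\<And>i. i < n \<Longrightarrow> \<phi> (free_gen i) = \<psi> (free_gen i)"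
  shows "\<phi> = \<psi>"
  by (rule auto_free_group_eqI[OF wB_auto[OF assms(1)] wB_auto[OF assms(2)]], rule assms(3), simp)

lemmas wB_hom = hom_simps[OF auto_hom[OF wB_auto]]

end

section \<open>The generating automorphisms and the relations between them\<close>

context wB_group
begin

lemma gen_closed [simp]: "i < n \<Longrightarrow> free_gen i \<in> carrier F"
  by (simp add: free_gen_closed)

lemma one_wB_apply: "u \<in> carrier F \<Longrightarrow> \<one>\<^bsub>G\<^esub> u = u"
  by (simp add: one_wB)

lemma perm_aut_gen: "\<pi> \<in> young_subgroup lam \<Longrightarrow> i < n \<Longrightarrow> perm_aut n \<pi> (free_gen i) = free_gen (\<pi> i)"
  unfolding perm_aut_def by (subst free_endo_gen) (auto simp: young_less)

lemma chi_sgn_gen: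
  "a < n \<Longrightarrow> b < n \<Longrightarrow> i < n \<Longrightarrow> chi_sgn n a b e (free_gen i) =
     (if i = a then [(b, e)] \<cdot> free_gen a \<cdot> [(b, \<not> e)] else free_gen i)"
  unfolding chi_sgn_def by (subst free_endo_gen) (auto simp: letter_closed)

lemma chi_aut_gen:
  "a < n \<Longrightarrow> b < n \<Longrightarrow> i < n \<Longrightarrow> chi_aut n a b (free_gen i) =
     (if i = a then free_gen b \<cdot> free_gen a \<cdot> inv\<^bsub>F\<^esub> free_gen b else free_gen i)"
  unfolding chi_aut_def by (subst free_endo_gen) auto

lemma rho_aut_gen:
  "a < n \<Longrightarrow> i < n \<Longrightarrow> rho_aut n a (free_gen i) = (if i = a then inv\<^bsub>F\<^esub> free_gen a else free_gen i)"
  unfolding rho_aut_def by (subst free_endo_gen) auto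

lemma chi_sgn_True: "b < n \<Longrightarrow> chi_sgn n a b True = chi_aut n a b"
  unfolding chi_sgn_def chi_aut_def by (simp add: inv_letter free_gen_letter)

lemma conj_letter_gen:
  assumes "j < n"
  shows "conj_letter i j (free_gen j)"
proof (rule conj_letterI[where w = "\<one>\<^bsub>F\<^esub>" and e = True])
  show "free_gen j = \<one>\<^bsub>F\<^esub> \<cdot> [(j, True)] \<cdot> inv\<^bsub>F\<^esub> \<one>\<^bsub>F\<^esub>"
    using letter_closed[OF assms, of True] by (simp add: free_gen_letter)
qed (simp_all add: subgroup.one_closed[OF subgroup_FS])

lemma perm_aut_mem:
  assumes \<pi>: "\<pi> \<in> young_subgroup lam"
  shows "perm_aut n \<pi> \<in> carrier G"
proof (rule mem_wBI[OF _ \<pi>])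
  let ?\<pi>' = "Hilbert_Choice.inv \<pi>"
  have \<pi>': "?\<pi>' \<in> young_subgroup lam" using \<pi> by (rule young_subgroup_inv)
  have p: "\<pi> permutes {..<n}" using \<pi> by (simp add: young_subgroup_iff n_def)
  have g: "perm_aut n ?\<pi>' (free_gen (\<pi> i)) = free_gen i" "perm_aut n \<pi> (free_gen (?\<pi>' i)) = free_gen i"
    if "i < n" for i
    using that perm_aut_gen[OF \<pi>'] perm_aut_gen[OF \<pi>] young_less[OF \<pi>] young_less[OF \<pi>'] permutes_inverses[OF p]
    by simp_all
  show "perm_aut n \<pi> \<in> auto F"
    unfolding perm_aut_def
    by (rule free_endo_auto[where g = "\<lambda>i. free_gen (?\<pi>' i)"])
      (use g young_less[OF \<pi>] young_less[OF \<pi>'] in \<open>auto simp: perm_aut_def\<close>)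
  show "conj_letter i (\<pi> i) (perm_aut n \<pi> (free_gen i))" if "i < n" for i
    using that \<pi> by (simp add: perm_aut_gen conj_letter_gen young_less)
qed

lemma chi_sgn_mem:
  assumes ab: "a < n" "nP \<le> b" "b < n" "a \<noteq> b"
  shows "chi_sgn n a b e \<in> carrier G"
proof (rule mem_wBI[OF _ id_young_subgroup])
  let ?f = "\<lambda>e. free_gen(a := [(b, e)] \<cdot> free_gen a \<cdot> [(b, \<not> e)])"
  have f: "?f e ` {..<n} \<subseteq> carrier F" for e
    using ab by (auto simp: letter_closed)
  have h: "chi_sgn n a b e \<in> hom F F" for e
    unfolding chi_sgn_def by (rule free_endo_hom[OF f])
  have inv: "chi_sgn n a b e (?f (\<not> e) i) = free_gen i" if i: "i < n" for e i
  proof (cases "i = a")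
    case True
    have l: "chi_sgn n a b e [(b, e')] = [(b, e')]" for e'
      using ab hom_simps(5)[OF h ab(3), of e e'] letter_eq[of b "{..<n}" e'] by (simp add: chi_sgn_gen)
    have *: "[(b, \<not> e)] = inv\<^bsub>F\<^esub> [(b, e)]" using ab by (simp add: inv_letter)
    have "chi_sgn n a b e (?f (\<not> e) i) = [(b, \<not> e)] \<cdot> ([(b, e)] \<cdot> free_gen a \<cdot> [(b, \<not> e)]) \<cdot> [(b, e)]"
      using True ab by (simp add: hom_simps(1-4)[OF h] letter_closed l chi_sgn_gen)
    also have "\<dots> = free_gen a"
      unfolding * using ab by (simp add: letter_closed F.group_word_simps)
    finally show ?thesis using True by simp
  next
    case False
    then show ?thesis using ab i by (simp add: chi_sgn_gen)
  qed
  show "chi_sgn n a b e \<in> auto F"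
    unfolding chi_sgn_def
    by (rule free_endo_auto[where g = "?f (\<not> e)"])
      (use f[of e] f[of "\<not> e"] inv[of _ e] inv[of _ "\<not> e"] in \<open>simp_all add: chi_sgn_def\<close>)
  show "conj_letter i (id i) (chi_sgn n a b e (free_gen i))" if i: "i < n" for i
  proof (cases "i = a")
    case True
    show ?thesis
    proof (rule conj_letterI[where w = "[(b, e)]" and e = True])
      show "chi_sgn n a b e (free_gen i) = [(b, e)] \<cdot> [(id i, True)] \<cdot> inv\<^bsub>F\<^esub> [(b, e)]"
        using True ab chi_sgn_gen[OF ab(1,3,1), of e] by (simp add: free_gen_letter inv_letter)
    qed (use ab in \<open>simp_all add: letter_FS\<close>)
  next
    case False
    then show ?thesis using ab i by (simp add: chi_sgn_gen conj_letter_gen)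
  qed
qed

lemma chi_aut_mem: "a < n \<Longrightarrow> nP \<le> b \<Longrightarrow> b < n \<Longrightarrow> a \<noteq> b \<Longrightarrow> chi_aut n a b \<in> carrier G"
  using chi_sgn_mem[of a b True] by (simp add: chi_sgn_True)

lemma rho_aut_mem:
  assumes a: "nP \<le> a" "a < n"
  shows "rho_aut n a \<in> carrier G"
proof (rule mem_wBI[OF _ id_young_subgroup])
  let ?f = "free_gen(a := inv\<^bsub>F\<^esub> free_gen a)"
  have f: "?f ` {..<n} \<subseteq> carrier F"
    using a by auto
  have h: "rho_aut n a \<in> hom F F"
    unfolding rho_aut_def by (rule free_endo_hom[OF f])
  have inv: "rho_aut n a (?f i) = free_gen i" if "i < n" for i
    using that a by (simp add: hom_simps(1-4)[OF h] rho_aut_gen)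
  show "rho_aut n a \<in> auto F"
    unfolding rho_aut_def
    by (rule free_endo_auto[where g = ?f]) (use f inv in \<open>simp_all add: rho_aut_def\<close>)
  show "conj_letter i (id i) (rho_aut n a (free_gen i))" if i: "i < n" for i
  proof (cases "i = a")
    case True
    show ?thesis
    proof (rule conj_letterI[where w = "\<one>\<^bsub>F\<^esub>" and e = False])
      show "rho_aut n a (free_gen i) = \<one>\<^bsub>F\<^esub> \<cdot> [(id i, False)] \<cdot> inv\<^bsub>F\<^esub> \<one>\<^bsub>F\<^esub>"
        using True a letter_closed[OF a(2)] rho_aut_gen[OF a(2) a(2)] inv_letter[OF a(2), of True]
        by (simp add: free_gen_letter)
    qed (use a True subgroup.one_closed[OF subgroup_FS] in auto)
  next
    case False
    then show ?thesis using a i by (simp add: rho_aut_gen conj_letter_gen)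
  qed
qed

lemma tau_aut_eq: "tau_aut n a = perm_aut n (transpose a (a + 1))"
  unfolding tau_aut_def perm_aut_def
  by (rule arg_cong[where f = "free_endo {..<n}"]) (auto simp: transpose_def fun_eq_iff)

lemma perm_aut_mult:
  assumes "\<pi> \<in> young_subgroup lam" "\<rho> \<in> young_subgroup lam"
  shows "perm_aut n \<pi> \<bullet> perm_aut n \<rho> = perm_aut n (\<pi> \<circ> \<rho>)"
  by (rule wB_eqI)
    (use assms in \<open>auto simp: perm_aut_mem mult_wB_apply perm_aut_gen young_less young_subgroup_comp\<close>)

lemma perm_aut_id: "perm_aut n id = \<one>\<^bsub>G\<^esub>"
  by (rule wB_eqI) (auto simp: perm_aut_mem id_young_subgroup perm_aut_gen one_wB_apply)

text \<open>Conjugation by a permutation relabels indices. The relation is written as an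
  intertwining so that both sides can be compared on generators without computing an inverse. It is
  the reason why all \<chi> between two given blocks have one class.\<close>

lemma perm_aut_chi_aut:
  assumes "\<pi> \<in> young_subgroup lam" "a < n" "nP \<le> b" "b < n" "a \<noteq> b"
  shows "perm_aut n \<pi> \<bullet> chi_aut n a b = chi_aut n (\<pi> a) (\<pi> b) \<bullet> perm_aut n \<pi>"
proof -
  have inj: "\<pi> i = \<pi> j \<longleftrightarrow> i = j" for i j
    using assms(1) permutes_inj[of \<pi>] by (auto simp: young_subgroup_iff inj_eq)
  have b: "\<not> \<pi> b < nP" using assms young_less_nP[of \<pi> b] by simp
  note m = perm_aut_mem[OF assms(1)] chi_aut_mem[OF assms(2-5)]
  have m': "chi_aut n (\<pi> a) (\<pi> b) \<in> carrier G"
    using assms b by (intro chi_aut_mem) (auto simp: young_less inj)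
  show ?thesis
    by (rule wB_eqI)
      (use assms m m' in \<open>auto simp: mult_wB_apply perm_aut_gen chi_aut_gen young_less inj wB_hom\<close>)
qed

lemma perm_aut_rho_aut:
  assumes "\<pi> \<in> young_subgroup lam" "nP \<le> a" "a < n"
  shows "perm_aut n \<pi> \<bullet> rho_aut n a = rho_aut n (\<pi> a) \<bullet> perm_aut n \<pi>"
proof -
  have inj: "\<pi> i = \<pi> j \<longleftrightarrow> i = j" for i j
    using assms(1) permutes_inj[of \<pi>] by (auto simp: young_subgroup_iff inj_eq)
  have b: "\<not> \<pi> a < nP" using assms young_less_nP[of \<pi> a] by simp
  note m = perm_aut_mem[OF assms(1)] rho_aut_mem[OF assms(2-3)]
  have m': "rho_aut n (\<pi> a) \<in> carrier G"
    using assms b by (intro rho_aut_mem) (auto simp: young_less)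
  show ?thesis
    by (rule wB_eqI)
      (use assms m m' in \<open>auto simp: mult_wB_apply perm_aut_gen rho_aut_gen young_less inj wB_hom\<close>)
qed

text \<open>The two automorphisms move different generators, and each fixes the letter by which the
  other conjugates. The case b = d is included and is used in \<open>comm4_C_P\<close>.\<close>

lemma chi_aut_commute:
  assumes "a < n" "nP \<le> b" "b < n" "a \<noteq> b" "c < n" "nP \<le> d" "d < n" "c \<noteq> d"
    and "a \<noteq> c" "a \<noteq> d" "c \<noteq> b"
  shows "chi_aut n a b \<bullet> chi_aut n c d = chi_aut n c d \<bullet> chi_aut n a b"
proof -
  have m: "chi_aut n a b \<in> carrier G" "chi_aut n c d \<in> carrier G"
    using assms by (auto intro: chi_aut_mem)
  show ?thesis
    by (rule wB_eqI) (use assms m in \<open>auto simp: mult_wB_apply chi_aut_gen wB_hom(1-4)\<close>)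
qed

text \<open>The product \<open>\<chi>\<^bsub>ad\<^esub> \<chi>\<^bsub>bd\<^esub>\<close> acts on \<open>\<langle>x\<^sub>a, x\<^sub>b\<rangle>\<close> as conjugation by \<open>x\<^sub>d\<close>.\<close>

lemma chi_aut_mccool:
  assumes "a < n" "nP \<le> b" "b < n" "nP \<le> d" "d < n" "a \<noteq> b" "a \<noteq> d" "b \<noteq> d"
  shows "chi_aut n a b \<bullet> (chi_aut n a d \<bullet> chi_aut n b d)
    = (chi_aut n a d \<bullet> chi_aut n b d) \<bullet> chi_aut n a b"
proof -
  have m: "chi_aut n a b \<in> carrier G" "chi_aut n a d \<in> carrier G" "chi_aut n b d \<in> carrier G"
    using assms by (auto intro: chi_aut_mem)
  show ?thesis
    by (rule wB_eqI)
      (use assms m in \<open>auto simp: mult_wB_apply chi_aut_gen wB_hom(1-4) F.group_word_simps\<close>)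
qed

lemma rho_aut_commute:
  assumes "nP \<le> a" "a < n" "nP \<le> b" "b < n"
  shows "rho_aut n a \<bullet> rho_aut n b = rho_aut n b \<bullet> rho_aut n a"
proof -
  have m: "rho_aut n a \<in> carrier G" "rho_aut n b \<in> carrier G"
    using assms by (auto intro: rho_aut_mem)
  show ?thesis
    by (rule wB_eqI) (use assms m in \<open>auto simp: mult_wB_apply rho_aut_gen wB_hom(1-4)\<close>)
qed

lemma rho_aut_chi_aut_commute:
  assumes "a < n" "nP \<le> b" "b < n" "a \<noteq> b" "nP \<le> c" "c < n" "c \<noteq> a" "c \<noteq> b"
  shows "rho_aut n c \<bullet> chi_aut n a b = chi_aut n a b \<bullet> rho_aut n c"
proof -
  have m: "rho_aut n c \<in> carrier G" "chi_aut n a b \<in> carrier G"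
    using assms by (auto intro: rho_aut_mem chi_aut_mem)
  show ?thesis
    by (rule wB_eqI) (use assms m in \<open>auto simp: mult_wB_apply rho_aut_gen chi_aut_gen wB_hom(1-4)\<close>)
qed

lemma rho_aut_square:
  assumes "nP \<le> a" "a < n"
  shows "rho_aut n a \<bullet> rho_aut n a = \<one>\<^bsub>G\<^esub>"
  by (rule wB_eqI)
    (use assms rho_aut_mem[OF assms] in \<open>auto simp: mult_wB_apply rho_aut_gen wB_hom(1-4) one_wB_apply\<close>)

text \<open>Inverting the conjugating letter x_b inverts the conjugation. Through this relation
  \<open>comm4_C_P\<close> gets a second element, besides the transposition, that inverts a basic
  commutator.\<close>

lemma rho_aut_conj_chi_aut:
  assumes "a < n" "nP \<le> b" "b < n" "a \<noteq> b"
  shows "rho_aut n b \<bullet> chi_aut n a b \<bullet> inv\<^bsub>G\<^esub> rho_aut n b = inv\<^bsub>G\<^esub> chi_aut n a b"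
proof -
  have m: "rho_aut n b \<in> carrier G" "chi_aut n a b \<in> carrier G"
    using assms by (auto intro: rho_aut_mem chi_aut_mem)
  have "inv\<^bsub>G\<^esub> rho_aut n b = rho_aut n b"
    by (rule G.inv_equality) (use assms m in \<open>auto simp: rho_aut_square\<close>)
  moreover have "(rho_aut n b \<bullet> chi_aut n a b \<bullet> rho_aut n b) \<bullet> chi_aut n a b = \<one>\<^bsub>G\<^esub>"
    by (rule wB_eqI)
      (use assms m in \<open>auto simp: mult_wB_apply rho_aut_gen chi_aut_gen wB_hom(1-4) one_wB_apply F.group_word_simps\<close>)
  ultimately show ?thesis
    using m by (simp add: G.inv_equality)
qed

lemma chi_sgn_mult_inv:
  assumes "a < n" "nP \<le> b" "b < n" "a \<noteq> b"
  shows "chi_sgn n a b e \<bullet> chi_sgn n a b (\<not> e) = \<one>\<^bsub>G\<^esub>"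
proof -
  have m: "chi_sgn n a b e \<in> carrier G" for e
    using assms by (rule chi_sgn_mem)
  have l: "chi_sgn n a b e [(b, e')] = [(b, e')]" for e e'
    using assms m wB_hom(5)[of "chi_sgn n a b e" b e'] letter_eq[of b "{..<n}" e'] by (simp add: chi_sgn_gen)
  have *: "[(b, \<not> e)] = inv\<^bsub>F\<^esub> [(b, e)]" using assms by (simp add: inv_letter)
  show ?thesis
  proof (rule wB_eqI)
    fix i assume i: "i < n"
    show "(chi_sgn n a b e \<bullet> chi_sgn n a b (\<not> e)) (free_gen i) = \<one>\<^bsub>G\<^esub> (free_gen i)"
    proof (cases "i = a")
      case True
      have "(chi_sgn n a b e \<bullet> chi_sgn n a b (\<not> e)) (free_gen i)
          = [(b, \<not> e)] \<cdot> ([(b, e)] \<cdot> free_gen a \<cdot> [(b, \<not> e)]) \<cdot> [(b, e)]"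
        using True assms m by (simp add: mult_wB_apply wB_hom(1-4) letter_closed l chi_sgn_gen)
      also have "\<dots> = free_gen a"
        unfolding * using assms by (simp add: letter_closed F.group_word_simps)
      finally show ?thesis using True i by (simp add: one_wB_apply)
    qed (use assms m i in \<open>simp add: mult_wB_apply chi_sgn_gen one_wB_apply\<close>)
  qed (use m in auto)
qed

text \<open>The right factor acts before the left one: the exchange sends x_a to x_(a+1), which is
  then conjugated by x_a. All questions about \<sigma> are reduced to \<chi> and \<tau> by this
  formula.\<close>

lemma sigma_aut_eq:
  assumes "nP \<le> a" "a + 1 < n" "transpose a (a + 1) \<in> young_subgroup lam"
  shows "sigma_aut n a = chi_aut n (a + 1) a \<bullet> perm_aut n (transpose a (a + 1))"
proof -
  let ?f = "free_gen(a := free_gen a \<cdot> free_gen (a + 1) \<cdot> inv\<^bsub>F\<^esub> (free_gen a), a + 1 := free_gen a)"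
  have m: "chi_aut n (a + 1) a \<in> carrier G" "perm_aut n (transpose a (a + 1)) \<in> carrier G"
    using assms by (auto intro: chi_aut_mem perm_aut_mem)
  have f: "?f ` {..<n} \<subseteq> carrier F" using assms by auto
  have h: "sigma_aut n a \<in> hom F F"
    unfolding sigma_aut_def by (rule free_endo_hom[OF f])
  show ?thesis
  \<comment> \<open>At this point \<open>sigma_aut\<close> is not known to belong to the group, so
    the two sides are compared as extensional homomorphisms that agree on generators.\<close>
  proof (rule extensionalityI[of _ "carrier F"])
    show "sigma_aut n a \<in> extensional (carrier F)"
      unfolding sigma_aut_def by (rule free_endo_extensional)
    show "chi_aut n (a + 1) a \<bullet> perm_aut n (transpose a (a + 1)) \<in> extensional (carrier F)"
      using wB_auto[OF G.m_closed[OF m]] by (simp add: auto_def Bij_def)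
    fix w assume w: "w \<in> carrier F"
    show "sigma_aut n a w = (chi_aut n (a + 1) a \<bullet> perm_aut n (transpose a (a + 1))) w"
    proof (rule F.hom_free_group_eqI[OF h auto_hom[OF wB_auto[OF G.m_closed[OF m]]] _ w])
      fix i assume "i \<in> {..<n}"
      then have i: "i < n" by simp
      have "sigma_aut n a (free_gen i) = ?f i"
        unfolding sigma_aut_def using i by (intro free_endo_gen f) simp
      then show "sigma_aut n a (free_gen i) = (chi_aut n (a + 1) a \<bullet> perm_aut n (transpose a (a + 1))) (free_gen i)"
        using i assms m young_less[OF assms(3) i]
        by (auto simp: mult_wB_apply perm_aut_gen chi_aut_gen transpose_def)
    qed
  qed
qed

end

section \<open>Nielsen reduction\<close>

text \<open>In the product of the inverse of p with z, all cancellation takes place in a common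
  prefix c. Since \<open>inv_word a @ b\<close> is a reduced word, c is the longest common
  prefix.\<close>

lemma common_prefix_reduce:
  assumes "reduced p" "reduced z"
  shows "\<exists>a b c. p = c @ a \<and> z = c @ b \<and> reduce (inv_word p @ z) = inv_word a @ b"
  using assms
proof (induction p arbitrary: z)
  case Nil
  then show ?case by (simp add: reduce_reduced)
next
  case (Cons x p)
  show ?case
  proof (cases "z \<noteq> [] \<and> hd z = x")
    case True
    then obtain z' where z: "z = x # z'" by (cases z) auto
    have r: "reduced p" "reduced z'" using Cons.prems by (auto simp: z reduced_Cons)
    obtain a b c where *: "p = c @ a" "z' = c @ b" "reduce (inv_word p @ z') = inv_word a @ b"
      using Cons.IH[OF r] by blast
    have "reduce (inv_word (x # p) @ z) = reduce (inv_word p @ reduce (inv_word [x] @ [x] @ z'))"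
      by (simp add: z)
    also have "\<dots> = inv_word a @ b"
      unfolding reduce_inv_word_append[of "[x]"] by (simp only: reduce_reduce_append(2) *(3))
    finally have "x # p = (x # c) @ a \<and> z = (x # c) @ b \<and> reduce (inv_word (x # p) @ z) = inv_word a @ b"
      using * z by simp
    then show ?thesis by blast
  next
    case False
    then have "z \<noteq> [] \<longrightarrow> \<not> cancels (fst x, \<not> snd x) (hd z)"
      by (auto simp: prod_eq_iff)
    then have "reduced (inv_word (x # p) @ z)"
      using Cons.prems reduced_inv_word[of "x # p"] by (simp add: reduced_append reduced_Cons[of _ z] del: reduced_inv_word)
    then have "x # p = [] @ (x # p) \<and> z = [] @ z \<and> reduce (inv_word (x # p) @ z) = inv_word (x # p) @ z"
      by (simp add: reduce_reduced)
    then show ?thesis by blast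
  qed
qed

text \<open>Without Nielsen cancellation, the first conjugating word and the first central letter
  survive in every product.\<close>

lemma nielsen_reduced_product:
  fixes W :: "nat \<Rightarrow> nat word" and s :: "nat \<Rightarrow> nat" and \<epsilon> :: "nat \<Rightarrow> bool"
  defines "U \<equiv> \<lambda>(i, e). W i @ [(s i, \<epsilon> i = e)] @ inv_word (W i)"
  assumes red: "\<And>i e. i < n \<Longrightarrow> reduced (U (i, e))"
    and inj: "inj_on s {..<n}"
    and np: "\<And>i j e v. i < n \<Longrightarrow> j < n \<Longrightarrow> i \<noteq> j \<Longrightarrow> W j \<noteq> W i @ [(s i, e)] @ v"
    and "reduced ((i, e) # u)" "fst ` set ((i, e) # u) \<subseteq> {..<n}"
  shows "\<exists>r. reduce (concat (map U ((i, e) # u))) = W i @ [(s i, \<epsilon> i = e)] @ r"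
  using assms(5,6)
proof (induction u arbitrary: i e)
  case Nil
  then have "reduced (U (i, e))" using red by simp
  then show ?case by (simp add: reduce_reduced U_def)
next
  case (Cons x u)
  obtain i' e' where x: "x = (i', e')" by force
  have i: "i < n" "i' < n" using Cons.prems by (auto simp: x)
  have rx: "reduced ((i', e') # u)" and ni: "i' = i \<Longrightarrow> e' = e"
    using Cons.prems by (auto simp: x)
  obtain r where r: "reduce (concat (map U ((i', e') # u))) = W i' @ [(s i', \<epsilon> i' = e')] @ r"
    using Cons.IH[OF rx] Cons.prems by (auto simp: x)
  let ?m = "(s i, \<epsilon> i = e)" and ?m' = "(s i', \<epsilon> i' = e')"
  define z where "z = W i' @ [?m'] @ r"
  have rz: "reduced z" unfolding z_def r[symmetric] by simp
  have rU: "reduced (W i @ [?m] @ inv_word (W i))" using red[OF i(1), of e] by (simp add: U_def)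
  then have rW: "reduced (W i)" by (simp add: reduced_append)
  obtain a b c where abc: "W i = c @ a" "z = c @ b" "reduce (inv_word (W i) @ z) = inv_word a @ b"
    using common_prefix_reduce[OF rW rz] by blast
  have "concat (map U ((i, e) # x # u)) = (W i @ [?m] @ inv_word (W i)) @ concat (map U ((i', e') # u))"
    by (simp add: x U_def)
  then have "reduce (concat (map U ((i, e) # x # u))) = reduce ((W i @ [?m] @ inv_word (W i)) @ reduce (concat (map U ((i', e') # u))))"
    by (simp only: reduce_reduce_append)
  also have "\<dots> = reduce ((W i @ [?m]) @ reduce (inv_word (W i) @ z))"
    unfolding r z_def[symmetric] by (simp only: reduce_reduce_append(2)) simp
  finally have *: "reduce (concat (map U ((i, e) # x # u))) = reduce (W i @ [?m] @ inv_word a @ b)"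
    unfolding abc(3) by (simp only: append_assoc)
  \<comment> \<open>Only the junction after the first central letter is in question. If part of the
    inverse of W i survives, this junction already occurs inside the reduced word U (i, e).\<close>
  have "\<not> cancels ?m (hd (inv_word a @ b))" if ne: "inv_word a @ b \<noteq> []"
  proof (cases "a = []")
    case False
    then have "hd (inv_word a @ b) = hd (inv_word (W i))" "inv_word (W i) \<noteq> []"
      using abc by (auto simp: inv_word_def)
    then show ?thesis using rU by (auto simp: reduced_append reduced_Cons)
  next
    case True
    then have z: "z = W i @ b" "b \<noteq> []" using abc ne by auto
    show ?thesis
    proof
      assume c: "cancels ?m (hd (inv_word a @ b))"
      obtain b' where b: "b = (s i, \<epsilon> i \<noteq> e) # b'"
        using c z True by (cases b) (auto simp: prod_eq_iff)
      have eq: "W i @ (s i, \<epsilon> i \<noteq> e) # b' = W i' @ ?m' # r"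
        using z b by (simp add: z_def)
      \<comment> \<open>Two factorisations of one word are compared. If one of W i and W i' is
        longer, it extends the other past its central letter, against \<open>np\<close>. If they
        have equal length, then i = i' and the first two letters are inverse to each other, against
        reducedness.\<close>
      consider "length (W i) < length (W i')" | "length (W i) = length (W i')" | "length (W i') < length (W i)"
        by linarith
      then show False
      proof cases
        case 1
        have "take (length (W i')) (W i @ (s i, \<epsilon> i \<noteq> e) # b') = W i'" unfolding eq by simp
        then have "W i' = W i @ [(s i, \<epsilon> i \<noteq> e)] @ take (length (W i') - length (W i) - 1) b'"
          using 1 by (simp add: take_Cons')
        moreover have "i \<noteq> i'" using 1 by auto
        ultimately show False using np[OF i] by blast
      next
        case 2
        then have "W i = W i'" "(s i, \<epsilon> i \<noteq> e) = ?m'" using eq by auto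
        moreover from this have "i = i'" using inj i by (auto dest: inj_onD)
        ultimately show False using ni by auto
      next
        case 3
        have "take (length (W i)) (W i' @ ?m' # r) = W i" unfolding eq[symmetric] by simp
        then have "W i = W i' @ [?m'] @ take (length (W i) - length (W i') - 1) r"
          using 3 by (simp add: take_Cons')
        moreover have "i' \<noteq> i" using 3 by auto
        ultimately show False using np[OF i(2,1)] by blast
      qed
    qed
  qed
  moreover have "reduced (inv_word a @ b)" unfolding abc(3)[symmetric] by simp
  moreover have "reduced (W i @ [?m])" using rU by (auto simp: reduced_append)
  ultimately have "reduced ((W i @ [?m]) @ inv_word a @ b)"
    by (simp only: reduced_append[of "W i @ [?m]"]) simp
  then show ?case unfolding * by (simp add: reduce_reduced)
qed

section \<open>Generation of the group by Nielsen moves\<close>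

context wB_group
begin

lemma FS_append:
  "u @ v \<in> carrier FS \<Longrightarrow> u \<in> carrier FS \<and> v \<in> carrier FS"
  by (auto simp: carrier_free_group reduced_append)

lemma mult_reduced: "reduced (u @ v) \<Longrightarrow> u \<cdot> v = u @ v"
  by (simp add: mult_free_group reduce_reduced)

lemma conj_letter_reduced:
  assumes "w \<in> carrier FS" "j < n"
  shows "\<exists>v\<in>carrier FS. reduced (v @ [(j, e)] @ inv_word v) \<and>
    w \<cdot> [(j, e)] \<cdot> inv\<^bsub>F\<^esub> w = v @ [(j, e)] @ inv_word v"
  using assms(1)
proof (induction w rule: rev_induct)
  case Nil
  then show ?case
    using assms(2) letter_closed[of j n e] one_free_group[of "{..<n}"]
    by (intro bexI[of _ "[]"]) (auto simp: mult_reduced inv_free_group carrier_free_group)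
next
  case (snoc x w)
  have w: "w \<in> carrier FS" using snoc.prems FS_append by blast
  have F: "w \<in> carrier F" "[x] \<in> carrier F" "w @ [x] \<in> carrier F" "[(j, e)] \<in> carrier F"
    using snoc.prems FS_append[of w "[x]"] FS_subset letter_closed assms(2) by auto
  have rwx: "reduced (w @ [x])" using F(3) by (simp add: carrier_free_group)
  show ?case
  proof (cases "fst x = j")
    case True
    have "[x] \<cdot> [(j, e)] = [(j, e)] \<cdot> [x]"
      using True by (cases x) (auto simp: mult_free_group reduce_def)
    then have "[x] \<cdot> [(j, e)] \<cdot> inv\<^bsub>F\<^esub> [x] = [(j, e)]"
      using F by (simp add: F.m_assoc)
    then have "w \<cdot> ([x] \<cdot> [(j, e)] \<cdot> inv\<^bsub>F\<^esub> [x]) \<cdot> inv\<^bsub>F\<^esub> w = w \<cdot> [(j, e)] \<cdot> inv\<^bsub>F\<^esub> w"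
      by simp
    then have "(w \<cdot> [x]) \<cdot> [(j, e)] \<cdot> inv\<^bsub>F\<^esub> (w \<cdot> [x]) = w \<cdot> [(j, e)] \<cdot> inv\<^bsub>F\<^esub> w"
      using F by (simp add: F.m_assoc F.inv_mult_group)
    then show ?thesis
      using snoc.IH[OF w] mult_reduced[OF rwx] by simp
  next
    case False
    let ?w = "w @ [x]"
    have "reduced (?w @ [(j, e)])"
      unfolding reduced_append[of ?w] using rwx False by auto
    moreover have "reduced (inv_word ?w)" using rwx reduced_inv_word by blast
    moreover have "hd (inv_word ?w) = (fst x, \<not> snd x)" by simp
    ultimately have r: "reduced (?w @ [(j, e)] @ inv_word ?w)"
      unfolding append_assoc[symmetric] reduced_append[of "?w @ [(j, e)]"] using False by auto
    then have "?w \<cdot> [(j, e)] \<cdot> inv\<^bsub>F\<^esub> ?w = ?w @ [(j, e)] @ inv_word ?w"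
      using \<open>reduced (?w @ [(j, e)])\<close> F by (subst mult_reduced) (simp_all add: inv_free_group mult_free_group reduce_reduced)
    then show ?thesis using r snoc.prems by blast
  qed
qed

definition wB_gens :: "(nat word \<Rightarrow> nat word) set" where
  "wB_gens =
     {perm_aut n (transpose p q) | p q. p \<noteq> q \<and> (\<exists>k. p \<in> block lam k \<and> q \<in> block lam k)} \<union>
     {rho_aut n a | a. nP \<le> a \<and> a < n} \<union>
     {chi_aut n a b | a b. a < n \<and> nP \<le> b \<and> b < n \<and> a \<noteq> b}"

lemma perm_transpose_mem_gens:
  "p \<noteq> q \<Longrightarrow> p \<in> block lam k \<Longrightarrow> q \<in> block lam k \<Longrightarrow> perm_aut n (transpose p q) \<in> wB_gens"
  unfolding wB_gens_def by blast

lemma wB_gens_closed: "wB_gens \<subseteq> carrier G"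
  using perm_aut_mem[OF young_subgroup_transpose] rho_aut_mem chi_aut_mem
  unfolding wB_gens_def by blast

lemma subgroup_generate_gens: "subgroup (generate G wB_gens) G"
  by (rule G.generate_is_subgroup[OF wB_gens_closed])

lemma chi_sgn_generate:
  assumes "a < n" "nP \<le> b" "b < n" "a \<noteq> b"
  shows "chi_sgn n a b e \<in> generate G wB_gens"
proof -
  have T: "chi_sgn n a b True \<in> generate G wB_gens"
    using assms unfolding chi_sgn_True[OF assms(3)] by (intro generate.incl) (auto simp: wB_gens_def)
  moreover have "chi_sgn n a b False = inv\<^bsub>G\<^esub> chi_sgn n a b True"
    using chi_sgn_mult_inv[OF assms, of False] chi_sgn_mem[OF assms] by (simp add: G.inv_equality)
  ultimately show ?thesis
    using subgroup.m_inv_closed[OF subgroup_generate_gens T] by (cases e) auto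
qed

text \<open>Composing with the transposition of a and \<pi> a fixes a and moves no point that was
  fixed, so the number of moved points drops.\<close>

lemma perm_aut_generate:
  assumes "\<pi> \<in> young_subgroup lam"
  shows "perm_aut n \<pi> \<in> generate G wB_gens"
  using assms
proof (induction "card {i. \<pi> i \<noteq> i}" arbitrary: \<pi> rule: less_induct)
  case less
  interpret H: subgroup "generate G wB_gens" G by (rule subgroup_generate_gens)
  have p: "\<pi> permutes {..<n}" using less.prems by (simp add: young_subgroup_iff n_def)
  show ?case
  proof (cases "\<pi> = id")
    case True
    then show ?thesis by (simp only: perm_aut_id H.one_closed)
  next
    case False
    then obtain a where a: "\<pi> a \<noteq> a" by (auto simp: fun_eq_iff)
    then have "a < n" using p by (auto simp: permutes_def)
    then obtain k where k: "a \<in> block lam k" using ex_block[of a lam] by (auto simp: n_def)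
    then have k': "\<pi> a \<in> block lam k" using young_subgroup_block[OF less.prems] by simp
    let ?t = "transpose a (\<pi> a)"
    have t: "?t \<in> young_subgroup lam" by (rule young_subgroup_transpose[OF k k'])
    let ?\<pi>' = "?t \<circ> \<pi>"
    have \<pi>': "?\<pi>' \<in> young_subgroup lam" by (rule young_subgroup_comp[OF t less.prems])
    have inj: "\<pi> i = \<pi> j \<longleftrightarrow> i = j" for i j using permutes_inj[OF p] by (simp add: inj_eq)
    have "{i. ?\<pi>' i \<noteq> i} \<subset> {i. \<pi> i \<noteq> i}"
    proof
      show "{i. ?\<pi>' i \<noteq> i} \<subseteq> {i. \<pi> i \<noteq> i}"
      proof (clarify)
        fix i assume i: "?\<pi>' i \<noteq> i" "\<pi> i = i"
        then have "i = a \<or> i = \<pi> a" by (auto simp: transpose_def split: if_splits)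
        then show False using i a inj[of i a] by auto
      qed
      show "{i. ?\<pi>' i \<noteq> i} \<noteq> {i. \<pi> i \<noteq> i}" using a by (auto simp: transpose_def set_eq_iff)
    qed
    moreover have "finite {i. \<pi> i \<noteq> i}"
      by (rule finite_subset[of _ "{..<n}"]) (use p in \<open>auto simp: permutes_def\<close>)
    ultimately have "card {i. ?\<pi>' i \<noteq> i} < card {i. \<pi> i \<noteq> i}" by (simp add: psubset_card_mono)
    then have IH: "perm_aut n ?\<pi>' \<in> generate G wB_gens" using less.hyps \<pi>' by blast
    have "perm_aut n ?t \<in> generate G wB_gens"
      by (rule generate.incl[OF perm_transpose_mem_gens]) (use k k' a in auto)
    then have "perm_aut n ?t \<bullet> perm_aut n ?\<pi>' \<in> generate G wB_gens" using IH by simp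
    moreover have "?t \<circ> ?\<pi>' = \<pi>" by (auto simp: fun_eq_iff)
    ultimately show ?thesis using t \<pi>' by (simp add: perm_aut_mult)
  qed
qed

text \<open>The end of Nielsen reduction: a permutation up to signs. A negative sign can only occur
  at a circle, where \<open>rho_aut\<close> removes it.\<close>

lemma letters_generate:
  assumes "g \<in> carrier G" "\<sigma> \<in> young_subgroup lam"
    and "\<And>i. i < n \<Longrightarrow> g (free_gen i) = [(\<sigma> i, e i)]" "\<And>i. i < nP \<Longrightarrow> e i"
  shows "g \<in> generate G wB_gens"
  using assms
proof (induction "card {i. i < n \<and> \<not> e i}" arbitrary: g e rule: less_induct)
  case less
  interpret H: subgroup "generate G wB_gens" G by (rule subgroup_generate_gens)
  show ?case
  proof (cases "{i. i < n \<and> \<not> e i} = {}")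
    case True
    have "g = perm_aut n \<sigma>"
      by (rule wB_eqI) (use True less.prems in \<open>auto simp: perm_aut_mem perm_aut_gen free_gen_letter[of "\<sigma> _"]\<close>)
    then show ?thesis using perm_aut_generate less.prems by simp
  next
    case False
    then obtain a where a: "a < n" "\<not> e a" by auto
    then have aS: "nP \<le> a" using less.prems(4)[of a] by (meson not_less)
    note rho = rho_aut_mem[OF aS a(1)]
    let ?g = "g \<bullet> rho_aut n a"
    have g': "?g \<in> carrier G" using less.prems rho by simp
    have IH: "?g \<in> generate G wB_gens"
    proof (rule less.hyps[OF _ g' less.prems(2), where e = "e(a := True)"])
      have "{i. i < n \<and> \<not> (e(a := True)) i} \<subset> {i. i < n \<and> \<not> e i}" using a by auto
      then show "card {i. i < n \<and> \<not> (e(a := True)) i} < card {i. i < n \<and> \<not> e i}"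
        by (simp add: psubset_card_mono)
      fix i assume i: "i < n"
      have "inv\<^bsub>F\<^esub> [(\<sigma> a, False)] = [(\<sigma> a, True)]"
        using inv_letter[of "\<sigma> a" n False] young_less[OF less.prems(2) a(1)] by simp
      then show "?g (free_gen i) = [(\<sigma> i, (e(a := True)) i)]"
        using i a less.prems rho by (auto simp: mult_wB_apply rho_aut_gen wB_hom(1-4))
    qed (use less.prems(4) in auto)
    have "rho_aut n a \<in> generate G wB_gens"
      using a aS by (intro generate.incl) (auto simp: wB_gens_def)
    then have "?g \<bullet> inv\<^bsub>G\<^esub> rho_aut n a \<in> generate G wB_gens" using IH by simp
    then show ?thesis using less.prems rho by (simp add: G.m_assoc)
  qed
qed

lemma length_mult: "length (u \<cdot> v) \<le> length u + length v"
  using length_reduce[of "u @ v"] by (simp add: mult_free_group)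

text \<open>Induction on the total length of the images of the generators. Either some conjugating
  word runs through another one and its central letter, and a \<chi> or its inverse shortens the
  image; or products have no such cancellation, and surjectivity leaves only single letters as
  images.\<close>

lemma generate_wB_gens: "generate G wB_gens = carrier G"
proof
  show "generate G wB_gens \<subseteq> carrier G"
    by (rule subgroup.subset[OF subgroup_generate_gens])
  show "carrier G \<subseteq> generate G wB_gens"
  proof
    fix g assume "g \<in> carrier G"
    then show "g \<in> generate G wB_gens"
    proof (induction "\<Sum>i<n. length (g (free_gen i))" arbitrary: g rule: less_induct)
      case less
      interpret H: subgroup "generate G wB_gens" G by (rule subgroup_generate_gens)
      note g = less.prems
      have hg: "g \<in> hom F F" using auto_hom wB_auto g by blast
      obtain \<sigma> where \<sigma>: "\<sigma> \<in> young_subgroup lam" "\<And>i. i < n \<Longrightarrow> conj_letter i (\<sigma> i) (g (free_gen i))"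
        using g by (auto simp: mem_wB_iff)
      have "\<exists>w e. i < n \<longrightarrow> w \<in> carrier FS \<and> (i < nP \<longrightarrow> e) \<and>
          reduced (w @ [(\<sigma> i, e)] @ inv_word w) \<and> g (free_gen i) = w @ [(\<sigma> i, e)] @ inv_word w" for i
      proof (cases "i < n")
        case True
        obtain w e where "w \<in> carrier FS" "i < nP \<Longrightarrow> e" "g (free_gen i) = w \<cdot> [(\<sigma> i, e)] \<cdot> inv\<^bsub>F\<^esub> w"
          using \<sigma>(2)[OF True] by (elim conj_letterE) auto
        then show ?thesis
          using conj_letter_reduced[of w "\<sigma> i" e] young_less[OF \<sigma>(1) True] by metis
      qed auto
      then obtain W \<epsilon> where W: "\<And>i. i < n \<Longrightarrow> W i \<in> carrier FS" "\<And>i. i < n \<Longrightarrow> i < nP \<Longrightarrow> \<epsilon> i"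
          "\<And>i. i < n \<Longrightarrow> reduced (W i @ [(\<sigma> i, \<epsilon> i)] @ inv_word (W i))"
          "\<And>i. i < n \<Longrightarrow> g (free_gen i) = W i @ [(\<sigma> i, \<epsilon> i)] @ inv_word (W i)"
        by metis
      define U where "U = (\<lambda>(i, e). W i @ [(\<sigma> i, \<epsilon> i = e)] @ inv_word (W i))"
      have WF: "W i \<in> carrier F" if "i < n" for i using W(1)[OF that] FS_subset by blast
      have gU: "g [(i, e)] = U (i, e)" if "i < n" for i e
      proof (cases e)
        case True
        then show ?thesis using that W(4) hom_simps(5)[OF hg that] by (simp add: U_def)
      next
        case False
        then have "g [(i, e)] = inv_word (g (free_gen i))"
          using that hom_simps(5)[OF hg that] by (simp add: inv_free_group hom_simps(1)[OF hg])
        then show ?thesis using W(4)[OF that] False by (simp add: U_def)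
      qed
      have inj: "inj_on \<sigma> {..<n}"
        using permutes_inj[of \<sigma>] \<sigma>(1) by (auto simp: young_subgroup_iff intro: inj_on_subset)
      show ?case
      proof (cases "\<exists>i j e v. i < n \<and> j < n \<and> i \<noteq> j \<and> W j = W i @ [(\<sigma> i, e)] @ v")
        case True
        then obtain i j e v where ij: "i < n" "j < n" "i \<noteq> j" "W j = W i @ [(\<sigma> i, e)] @ v" by blast
        have \<sigma>i: "\<sigma> i < n" using young_less[OF \<sigma>(1) ij(1)] .
        have "[(\<sigma> i, e)] @ v \<in> carrier FS" using FS_append W(1)[OF ij(2)] unfolding ij(4) by blast
        \<comment> \<open>W j consists of circle letters, so the central letter of the image of x_i
          is a circle, and therefore x_i is one. Hence conjugation of x_j by x_i belongs to the
          group.\<close>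
        then have "nP \<le> \<sigma> i" by (simp add: carrier_free_group)
        then have iS: "nP \<le> i" using young_less_nP[OF \<sigma>(1) ij(1)] by (meson not_less)
        have vF: "v \<in> carrier F"
          using \<open>[(\<sigma> i, e)] @ v \<in> carrier FS\<close> FS_append FS_subset by blast
        \<comment> \<open>The exponent of x_i for which the central letter of the image is inverse
          to the letter that follows W i in W j. Left multiplication by that image deletes this
          letter from W j.\<close>
        define d where "d = (\<epsilon> i \<noteq> e)"
        note chi = chi_sgn_mem[OF ij(2) iS ij(1) ij(3)[symmetric]]
        let ?g = "g \<bullet> chi_sgn n j i d"
        let ?A = "W i" and ?l = "[(\<sigma> i, e)]" and ?m = "[(\<sigma> j, \<epsilon> j)]"
        have c: "?A \<in> carrier F" "?l \<in> carrier F" "?m \<in> carrier F" "W j \<in> carrier F"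
          using WF[OF ij(1)] WF[OF ij(2)] \<sigma>i young_less[OF \<sigma>(1) ij(2)] by (simp_all add: letter_closed)
        have U_eq: "U (i, d') = ?A \<cdot> [(\<sigma> i, \<epsilon> i = d')] \<cdot> inv\<^bsub>F\<^esub> ?A" for d'
        proof -
          have "reduced (U (i, d'))"
            using gU[OF ij(1), of d'] hom_simps(1)[OF hg letter_closed[OF ij(1), of d']]
            by (simp add: carrier_free_group)
          then show ?thesis
            using c by (simp add: U_def mult_free_group inv_free_group reduce_reduced)
        qed
        have gi: "g [(i, d)] = ?A \<cdot> inv\<^bsub>F\<^esub> ?l \<cdot> inv\<^bsub>F\<^esub> ?A" "g [(i, \<not> d)] = ?A \<cdot> ?l \<cdot> inv\<^bsub>F\<^esub> ?A"
        proof -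
          have "(\<epsilon> i = d) = (\<not> e)" "(\<epsilon> i = (\<not> d)) = e" by (auto simp: d_def)
          then show "g [(i, d)] = ?A \<cdot> inv\<^bsub>F\<^esub> ?l \<cdot> inv\<^bsub>F\<^esub> ?A" "g [(i, \<not> d)] = ?A \<cdot> ?l \<cdot> inv\<^bsub>F\<^esub> ?A"
            using gU[OF ij(1), of d] gU[OF ij(1), of "\<not> d"] U_eq[of d] U_eq[of "\<not> d"] \<sigma>i by (simp_all add: inv_letter)
        qed
        have gj: "g (free_gen j) = W j \<cdot> ?m \<cdot> inv\<^bsub>F\<^esub> W j"
          using W(3,4)[OF ij(2)] c by (simp add: mult_free_group inv_free_group reduce_reduced)
        have Wj: "W j = ?A \<cdot> ?l \<cdot> v"
          using c ij(4) by (simp add: mult_free_group carrier_free_group reduce_reduced)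
        have "?g (free_gen j) = g [(i, d)] \<cdot> g (free_gen j) \<cdot> g [(i, \<not> d)]"
          using ij g chi by (simp add: mult_wB_apply chi_sgn_gen hom_simps(1-4)[OF hg] letter_closed)
        also have "\<dots> = (?A \<cdot> v) \<cdot> ?m \<cdot> inv\<^bsub>F\<^esub> (?A \<cdot> v)"
          unfolding gi gj Wj using c vF by (simp add: F.group_word_simps)
        finally have gj': "?g (free_gen j) = (?A \<cdot> v) \<cdot> ?m \<cdot> inv\<^bsub>F\<^esub> (?A \<cdot> v)" .
        \<comment> \<open>One letter of the conjugating word is gone and further cancellation only
          helps, so the image of x_j loses at least two letters.\<close>
        have Av: "length (?A \<cdot> v) \<le> length ?A + length v" by (rule length_mult)
        have "length (?g (free_gen j)) \<le> length (?A \<cdot> v) + 1 + length (?A \<cdot> v)"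
          unfolding gj' using c vF length_mult[of "(?A \<cdot> v) \<cdot> ?m" "inv\<^bsub>F\<^esub> (?A \<cdot> v)"]
            length_mult[of "?A \<cdot> v" ?m] by (simp add: inv_free_group)
        also have "\<dots> < length (g (free_gen j))"
          unfolding W(4)[OF ij(2)] ij(4) using Av by simp
        finally have less_j: "length (?g (free_gen j)) < length (g (free_gen j))" .
        have "(\<Sum>k<n. length (?g (free_gen k))) < (\<Sum>k<n. length (g (free_gen k)))"
        proof (rule sum_strict_mono_ex1)
          show "\<forall>k\<in>{..<n}. length (?g (free_gen k)) \<le> length (g (free_gen k))"
          proof
            fix k assume "k \<in> {..<n}"
            then show "length (?g (free_gen k)) \<le> length (g (free_gen k))"
              using less_j ij g chi by (cases "k = j") (simp_all add: mult_wB_apply chi_sgn_gen)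
          qed
        qed (use less_j ij in auto)
        then have IH: "?g \<in> generate G wB_gens"
          using less.hyps g chi by simp
        have "?g \<bullet> chi_sgn n j i (\<not> d) \<in> generate G wB_gens"
          using IH chi_sgn_generate[OF ij(2) iS ij(1) ij(3)[symmetric]] by simp
        then show ?thesis
          using g chi chi_sgn_mult_inv[OF ij(2) iS ij(1) ij(3)[symmetric], of d] by (simp add: G.m_assoc)
      next
        case False
        have gw: "g w = reduce (concat (map U w))" if "w \<in> carrier F" for w
          using that
        proof (induction w)
          case Nil
          then show ?case using hom_simps(4)[OF hg] by (simp add: one_free_group reduce_def)
        next
          case (Cons x w)
          obtain i e where x: "x = (i, e)" by force
          have i: "i < n" and w: "w \<in> carrier F" and l: "[x] \<in> carrier F"
            using Cons.prems by (auto simp: x carrier_free_group reduced_Cons)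
          have "g (x # w) = g ([x] \<cdot> w)"
            using Cons.prems by (simp add: mult_free_group carrier_free_group reduce_reduced)
          also have "\<dots> = U x \<cdot> g w"
            using l w gU[OF i, of e] by (simp add: hom_simps(2)[OF hg] x)
          finally show ?case using Cons.IH[OF w] by (simp add: mult_free_group)
        qed
        have W_Nil: "W i = []" if i: "i < n" for i
        proof -
          have \<sigma>i: "\<sigma> i < n" using young_less[OF \<sigma>(1) i] .
          \<comment> \<open>Surjectivity enters here: some reduced word is sent to a single letter,
            but its image begins with W k and a central letter. So W k is empty, and injectivity of
            \<sigma> gives k = i.\<close>
          have "bij_betw g (carrier F) (carrier F)" using wB_auto[OF g] by (simp add: auto_def Bij_def)
          then obtain u where u: "u \<in> carrier F" "g u = free_gen (\<sigma> i)"
            using \<sigma>i by (metis bij_betw_imp_surj_on gen_closed imageE)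
          then have ne: "u \<noteq> []" using gw[OF u(1)] by (auto simp: free_gen_def reduce_def)
          then obtain k e u' where u': "u = (k, e) # u'" by (cases u) auto
          have k: "k < n" using u(1) by (simp add: u' carrier_free_group)
          have "\<exists>r. reduce (concat (map U ((k, e) # u'))) = W k @ [(\<sigma> k, \<epsilon> k = e)] @ r"
            unfolding U_def
          proof (rule nielsen_reduced_product[where n = n])
            fix i e assume i: "i < n"
            have "reduced (U (i, e))"
              using gU[OF i, of e] hom_simps(1)[OF hg letter_closed[OF i, of e]] by (simp add: carrier_free_group)
            then show "reduced (case (i, e) of (i, e) \<Rightarrow> W i @ [(\<sigma> i, \<epsilon> i = e)] @ inv_word (W i))"
              by (simp add: U_def)
          next
            show "reduced ((k, e) # u')" "fst ` set ((k, e) # u') \<subseteq> {..<n}"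
              using u(1) by (auto simp: u' carrier_free_group)
          qed (use False inj in blast)+
          then obtain r where "free_gen (\<sigma> i) = W k @ [(\<sigma> k, \<epsilon> k = e)] @ r"
            using gw[OF u(1)] u u' by auto
          then have "W k = []" "\<sigma> k = \<sigma> i"
            by (auto simp: free_gen_def Cons_eq_append_conv)
          then show ?thesis using inj i k by (auto dest: inj_onD)
        qed
        show ?thesis
          by (rule letters_generate[OF g \<sigma>(1), of \<epsilon>])
            (use W W_Nil in \<open>auto simp: n_def intro: order.strict_trans2\<close>)
      qed
    qed
  qed
qed

end

section \<open>Commutators of generators\<close>

text \<open>One transposition brings a to a', a second one brings the image of b to b' without
  touching a'. The blocks k and l may coincide, so this covers both the \<tau> of one block and the
  \<chi> between any two blocks.\<close>

lemma young_subgroup_2_transitive: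
  assumes "a \<in> block lam k" "b \<in> block lam l" "a' \<in> block lam k" "b' \<in> block lam l" "a \<noteq> b" "a' \<noteq> b'"
  shows "\<exists>\<pi>\<in>young_subgroup lam. \<pi> a = a' \<and> \<pi> b = b'"
proof -
  let ?t = "transpose a a'"
  have t: "?t \<in> young_subgroup lam" by (rule young_subgroup_transpose) (fact assms)+
  have tb: "?t b \<in> block lam l" using young_subgroup_block[OF t] assms by simp
  let ?u = "transpose (?t b) b'"
  have u: "?u \<in> young_subgroup lam" by (rule young_subgroup_transpose) (fact tb assms)+
  have "?t b \<noteq> a'" using assms by (auto simp: transpose_def)
  then have "(?u \<circ> ?t) a = a'" "(?u \<circ> ?t) b = b'"
    using assms by (auto simp: transpose_def)
  then show ?thesis using young_subgroup_comp[OF u t] by blast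
qed

lemma comp_transpose:
  assumes "inj \<pi>"
  shows "\<pi> \<circ> transpose a b = transpose (\<pi> a) (\<pi> b) \<circ> \<pi>"
  using assms by (auto simp: fun_eq_iff transpose_def inj_eq)

context group
begin

lemma ab_class_intertwine:
  assumes "p \<in> carrier G" "a \<in> carrier G" "b \<in> carrier G" "p \<otimes> a = b \<otimes> p"
  shows "ab_class G a = ab_class G b"
proof -
  have "p \<otimes> a \<otimes> inv p = b" using assms by (simp add: m_assoc)
  then show ?thesis using ab_class_conj[OF assms(1,2)] by simp
qed

lemma commutator_rcos_ab_class_cong:
  assumes "a \<in> carrier G" "b \<in> carrier G" "a' \<in> carrier G" "b' \<in> carrier G"
    and "ab_class G a = ab_class G a'" "ab_class G b = ab_class G b'"
  shows "lower_central G 3 #> commutator G a b = lower_central G 3 #> commutator G a' b'"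
  using assms by (simp flip: lie_bracket_ab_class)

lemma cent_mod_mult_cancel:
  assumes "N \<lhd> G" "a \<in> carrier G" "b \<in> carrier G" "c \<in> carrier G"
    and "a \<otimes> b \<in> cent_mod G N c" "b \<in> cent_mod G N c"
  shows "a \<in> cent_mod G N c"
proof -
  interpret C: subgroup "cent_mod G N c" G by (rule subgroup_cent_mod) (fact assms)+
  have "(a \<otimes> b) \<otimes> inv b \<in> cent_mod G N c" using assms by blast
  then show ?thesis using assms by (simp add: m_assoc)
qed

end

lemma (in wB_group) transpose_commute_fix:
  assumes "\<pi> \<in> young_subgroup lam" "a < n" "nP \<le> b" "b < n" "a \<noteq> b" "\<pi> a = a" "\<pi> b = b"
  shows "perm_aut n \<pi> \<bullet> chi_aut n a b = chi_aut n a b \<bullet> perm_aut n \<pi>"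
  using perm_aut_chi_aut[OF assms(1-5)] assms by simp

section \<open>Choice of strands and of representatives when circle blocks are large\<close>

locale wB_large_circles = wB_group +
  assumes four: "\<forall>k\<in>set lamS. 4 \<le> k"
begin

abbreviation \<Gamma> where "\<Gamma> \<equiv> lower_central G"
abbreviation P where "P a b \<equiv> perm_aut n (transpose a b)"
abbreviation R where "R \<equiv> rho_aut n"
abbreviation X where "X \<equiv> chi_aut n"
abbreviation B where "B \<equiv> block lam"
abbreviation IS where "IS \<equiv> S_blocks lamP lamS"

definition comm3 where "comm3 a b \<longleftrightarrow> a \<in> cent_mod G (\<Gamma> 3) b"
definition comm4 where "comm4 a b \<longleftrightarrow> a \<in> cent_mod G (\<Gamma> 4) b"

lemma block_less: "a \<in> B k \<Longrightarrow> a < n"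
  using block_subset[of lam k] by (auto simp: n_def)

lemma block_nonempty_less: "a \<in> B k \<Longrightarrow> k < length lam"
  by (rule ccontr) (simp add: block_def)

lemma S_block_iff: "a \<in> B k \<Longrightarrow> k \<in> IS \<longleftrightarrow> nP \<le> a"
  using block_append1[of k lamP lamS] block_append2[of lamP k lamS] block_nonempty_less[of a k]
  by (cases "k < length lamP") (auto simp: S_blocks_def)

lemma S_block_strand: "k \<in> IS \<Longrightarrow> a \<in> B k \<Longrightarrow> nP \<le> a"
  using S_block_iff by blast

lemma ex_S_block:
  assumes "nP \<le> a" "a < n"
  obtains k where "k \<in> IS" "a \<in> B k"
  using ex_block[of a lam] S_block_iff assms unfolding n_def by blast

lemma ex_block_strand:
  assumes "a < n"
  obtains k where "a \<in> B k"
  using ex_block[of a lam] assms unfolding n_def by blast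

lemma avoid:
  assumes "finite T" "card T < card (B k)"
  obtains b where "b \<in> B k" "b \<notin> T"
proof -
  have "\<not> B k \<subseteq> T" using card_mono[OF assms(1), of "B k"] assms(2) by auto
  then show thesis using that by blast
qed

lemma card_S_block:
  assumes "k \<in> IS"
  shows "4 \<le> card (B k)"
proof -
  have k: "k < length lam" "length lamP \<le> k" using assms by (auto simp: S_blocks_def)
  then have "lam ! k \<in> set lamS" by (auto simp: nth_append)
  then show ?thesis using four k card_block[of k lam] by simp
qed

text \<open>The form in which the bound four enters the commutation arguments. A typical triple
  consists of the two strands of a transposition and the first index of a \<chi>.\<close>

lemma avoid3:
  assumes "k \<in> IS"
  obtains b where "b \<in> B k" "b \<noteq> x" "b \<noteq> y" "b \<noteq> z"
proof -
  have "card {x, y, z} \<le> 3" by (simp add: card_insert_if)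
  then have "card {x, y, z} < card (B k)" using card_S_block[OF assms] by linarith
  then show thesis using avoid[of "{x, y, z}" k] that by auto
qed

lemma P_mem: "a \<in> B k \<Longrightarrow> b \<in> B k \<Longrightarrow> P a b \<in> carrier G"
  by (rule perm_aut_mem[OF young_subgroup_transpose])

lemma R_mem: "k \<in> IS \<Longrightarrow> a \<in> B k \<Longrightarrow> R a \<in> carrier G"
  by (rule rho_aut_mem) (auto simp: S_block_strand block_less)

lemma X_mem: "a \<in> B k \<Longrightarrow> l \<in> IS \<Longrightarrow> b \<in> B l \<Longrightarrow> a \<noteq> b \<Longrightarrow> X a b \<in> carrier G"
  by (rule chi_aut_mem) (auto simp: S_block_strand block_less)

lemma P_class:
  assumes "a \<in> B k" "b \<in> B k" "a \<noteq> b" "a' \<in> B k" "b' \<in> B k" "a' \<noteq> b'"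
  shows "ab_class G (P a b) = ab_class G (P a' b')"
proof -
  obtain \<pi> where \<pi>: "\<pi> \<in> young_subgroup lam" "\<pi> a = a'" "\<pi> b = b'"
    using young_subgroup_2_transitive[of a lam k b k a' b'] assms by blast
  have "inj \<pi>" using \<pi>(1) permutes_inj by (auto simp: young_subgroup_iff)
  then have "\<pi> \<circ> transpose a b = transpose a' b' \<circ> \<pi>" using comp_transpose[of \<pi> a b] \<pi> by simp
  then show ?thesis
    using \<pi> assms
    by (intro G.ab_class_intertwine[of "perm_aut n \<pi>"])
      (simp_all add: perm_aut_mem perm_aut_mult young_subgroup_transpose P_mem)
qed

lemma R_class:
  assumes "k \<in> IS" "a \<in> B k" "a' \<in> B k"
  shows "ab_class G (R a) = ab_class G (R a')"
proof -
  have t: "transpose a a' \<in> young_subgroup lam" by (rule young_subgroup_transpose) (fact assms)+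
  have "P a a' \<bullet> R a = R a' \<bullet> P a a'"
    using perm_aut_rho_aut[OF t, of a] S_block_strand[OF assms(1,2)] block_less[OF assms(2)] by simp
  then show ?thesis
    using assms R_mem[of k] perm_aut_mem[OF t] by (intro G.ab_class_intertwine[of "P a a'"])
qed

lemma X_class:
  assumes "a \<in> B k" "a' \<in> B k" "l \<in> IS" "b \<in> B l" "b' \<in> B l" "a \<noteq> b" "a' \<noteq> b'"
  shows "ab_class G (X a b) = ab_class G (X a' b')"
proof -
  obtain \<pi> where \<pi>: "\<pi> \<in> young_subgroup lam" "\<pi> a = a'" "\<pi> b = b'"
    using young_subgroup_2_transitive[of a lam k b l a' b'] assms by blast
  have "perm_aut n \<pi> \<bullet> X a b = X a' b' \<bullet> perm_aut n \<pi>"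
    using perm_aut_chi_aut[OF \<pi>(1), of a b] \<pi> assms block_less S_block_strand by simp
  then show ?thesis
    using assms X_mem[of _ k l] \<pi>
    by (intro G.ab_class_intertwine[of "perm_aut n \<pi>"]) (simp_all add: perm_aut_mem)
qed

section \<open>Commutation of generators modulo the third and fourth terms\<close>

lemma comm3_sym: "a \<in> carrier G \<Longrightarrow> b \<in> carrier G \<Longrightarrow> comm3 a b \<Longrightarrow> comm3 b a"
  unfolding comm3_def by (rule G.cent_mod_sym[OF G.lower_central_subgroup])

lemma comm3_commute: "a \<in> carrier G \<Longrightarrow> b \<in> carrier G \<Longrightarrow> a \<bullet> b = b \<bullet> a \<Longrightarrow> comm3 a b"
  unfolding comm3_def by (rule G.commute_imp_cent_mod[OF G.lower_central_subgroup])

lemma comm3_class: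
  "a \<in> carrier G \<Longrightarrow> a' \<in> carrier G \<Longrightarrow> b \<in> carrier G \<Longrightarrow> ab_class G a = ab_class G a' \<Longrightarrow> comm3 a' b \<Longrightarrow> comm3 a b"
  unfolding comm3_def by (rule G.cent_mod_ab_class_cong[OF G.lower_central_normal]) auto

lemma comm4_sym: "a \<in> carrier G \<Longrightarrow> b \<in> carrier G \<Longrightarrow> comm4 a b \<Longrightarrow> comm4 b a"
  unfolding comm4_def by (rule G.cent_mod_sym[OF G.lower_central_subgroup])

lemma comm4_commute: "a \<in> carrier G \<Longrightarrow> b \<in> carrier G \<Longrightarrow> a \<bullet> b = b \<bullet> a \<Longrightarrow> comm4 a b"
  unfolding comm4_def by (rule G.commute_imp_cent_mod[OF G.lower_central_subgroup])

lemma comm4_\<Gamma>3: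
  assumes "k \<in> \<Gamma> 3" "b \<in> carrier G"
  shows "comm4 k b"
proof (rule comm4_sym)
  show k: "k \<in> carrier G" using assms G.lower_central_subgroup subgroup.subset by blast
  show "comm4 b k"
    using G.commutator_mem_lower_central_Suc[of 3 b k] assms by (simp add: comm4_def cent_mod_def)
qed (fact assms)

lemma comm3_P_P:
  assumes "a \<in> B k" "b \<in> B k" "a \<noteq> b" "c \<in> B k'" "d \<in> B k'" "c \<noteq> d"
  shows "comm3 (P a b) (P c d)"
proof (cases "k = k'")
  case True
  then show ?thesis
    using assms P_mem P_class[of a k b c d]
    by (intro comm3_class[of "P a b" "P c d" "P c d"] comm3_commute) auto
next
  case False
  then have ne: "c \<noteq> a" "c \<noteq> b" "d \<noteq> a" "d \<noteq> b" using assms block_inj by blast+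
  then have "transpose a b \<circ> transpose c d = transpose c d \<circ> transpose a b"
    by (auto simp: fun_eq_iff transpose_def)
  then show ?thesis
    using assms by (intro comm3_commute P_mem) (simp_all add: P_mem perm_aut_mult young_subgroup_transpose)
qed

lemma comm3_P_R:
  assumes "a \<in> B k" "b \<in> B k" "a \<noteq> b" "l \<in> IS" "c \<in> B l"
  shows "comm3 (P a b) (R c)"
proof -
  obtain c' where c': "c' \<in> B l" "c' \<noteq> a" "c' \<noteq> b" using avoid3[OF assms(4)] by metis
  have m: "P a b \<in> carrier G" "R c \<in> carrier G" "R c' \<in> carrier G"
    using assms c' P_mem R_mem by blast+
  have t: "transpose a b \<in> young_subgroup lam" using assms young_subgroup_transpose by blast
  have "P a b \<bullet> R c' = R c' \<bullet> P a b"
    using perm_aut_rho_aut[OF t, of c'] c' S_block_strand[OF assms(4)] block_less by simp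
  then have "comm3 (R c') (P a b)" using m by (intro comm3_commute) auto
  then have "comm3 (R c) (P a b)"
    using comm3_class[OF m(2,3,1) R_class[OF assms(4,5) c'(1)]] by blast
  then show ?thesis using comm3_sym m by blast
qed

text \<open>Within its class, the \<chi> is replaced by one that avoids a and b. Its first index has
  to stay in the block k', and a strand beside a and b is missing there precisely when k' = k and
  the block is {a, b}: this is the exceptional pair.\<close>

lemma comm3_P_X:
  assumes "a \<in> B k" "b \<in> B k" "a \<noteq> b" "c \<in> B k'" "l \<in> IS" "d \<in> B l" "c \<noteq> d"
    and large: "k' = k \<Longrightarrow> 3 \<le> card (B k)"
  shows "comm3 (P a b) (X c d)"
proof -
  obtain c' where c': "c' \<in> B k'" "c' \<noteq> a" "c' \<noteq> b"
  proof (cases "k' = k")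
    case True
    have "card {a, b} < card (B k)" using large[OF True] card_insert_le_m1[of 2 "{b}" a] by simp
    then show ?thesis using avoid[of "{a, b}" k] that True by auto
  next
    case False
    then show ?thesis using that[of c] assms block_inj by blast
  qed
  obtain d' where d': "d' \<in> B l" "d' \<noteq> a" "d' \<noteq> b" "d' \<noteq> c'" using avoid3[OF assms(5)] by metis
  have m: "P a b \<in> carrier G" "X c d \<in> carrier G" "X c' d' \<in> carrier G"
    using assms c' d' P_mem X_mem by (auto intro: X_mem)
  have t: "transpose a b \<in> young_subgroup lam" using assms young_subgroup_transpose by blast
  have "P a b \<bullet> X c' d' = X c' d' \<bullet> P a b"
    using c' d' S_block_strand[OF assms(5)] block_less by (intro transpose_commute_fix t) auto
  then have "comm3 (X c' d') (P a b)" using m by (intro comm3_commute) auto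
  moreover have "ab_class G (X c d) = ab_class G (X c' d')"
    by (rule X_class[where k = k' and l = l]) (use assms c' d' in auto)
  ultimately have "comm3 (X c d) (P a b)" using comm3_class[OF m(2,3,1)] by blast
  then show ?thesis using comm3_sym m by blast
qed

lemma comm3_R_R:
  assumes "k \<in> IS" "a \<in> B k" "l \<in> IS" "b \<in> B l"
  shows "comm3 (R a) (R b)"
  using assms R_mem rho_aut_commute S_block_strand block_less by (intro comm3_commute) auto

lemma comm3_R_X:
  assumes "k \<in> IS" "a \<in> B k" "c \<in> B k'" "l \<in> IS" "d \<in> B l" "c \<noteq> d"
  shows "comm3 (R a) (X c d)"
proof -
  obtain a' where a': "a' \<in> B k" "a' \<noteq> c" "a' \<noteq> d" using avoid3[OF assms(1)] by metis
  have m: "R a \<in> carrier G" "R a' \<in> carrier G" "X c d \<in> carrier G"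
    using assms a' by (auto intro: R_mem X_mem)
  have "comm3 (R a') (X c d)"
    using m assms a' S_block_strand block_less by (intro comm3_commute rho_aut_chi_aut_commute) auto
  then show ?thesis using comm3_class[OF m R_class[OF assms(1,2) a'(1)]] by blast
qed

text \<open>With c outside {a, b}, only the equality of d and a can spoil commutation, and d may be
  exchanged within its circle block.\<close>

lemma comm3_X_X_disjoint:
  assumes "a \<in> B k" "l \<in> IS" "b \<in> B l" "a \<noteq> b" "c \<in> B k'" "l' \<in> IS" "d \<in> B l'" "c \<noteq> d" "c \<noteq> a" "c \<noteq> b"
  shows "comm3 (X c d) (X a b)"
proof -
  obtain d' where d': "d' \<in> B l'" "d' \<noteq> a" "d' \<noteq> b" "d' \<noteq> c" using avoid3[OF assms(6)] by metis
  have m: "X c d \<in> carrier G" "X c d' \<in> carrier G" "X a b \<in> carrier G"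
    using assms d' by (auto intro: X_mem)
  have "comm3 (X c d') (X a b)"
    using m assms d' S_block_strand block_less by (intro comm3_commute chi_aut_commute) auto
  moreover have "ab_class G (X c d) = ab_class G (X c d')"
    by (rule X_class[where k = k' and l = l']) (use assms d' in auto)
  ultimately show ?thesis using comm3_class[OF m] by blast
qed

text \<open>Since b is a circle, its block contains a strand c off a, b and d. Exchanging b for c in
  the first factor leads to the disjoint case.\<close>

lemma comm3_X_X_chain:
  assumes "a \<in> B k" "l \<in> IS" "b \<in> B l" "a \<noteq> b" "l' \<in> IS" "d \<in> B l'" "b \<noteq> d"
  shows "comm3 (X b d) (X a b)"
proof -
  obtain c where c: "c \<in> B l" "c \<noteq> a" "c \<noteq> b" "c \<noteq> d" using avoid3[OF assms(2)] by metis
  have m: "X b d \<in> carrier G" "X c d \<in> carrier G" "X a b \<in> carrier G"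
    using assms c by (auto intro: X_mem)
  have "comm3 (X c d) (X a b)"
    by (rule comm3_X_X_disjoint[where k = k and l = l and k' = l and l' = l']) (use assms c in auto)
  moreover have "ab_class G (X b d) = ab_class G (X c d)"
    by (rule X_class[where k = l and l = l']) (use assms c in auto)
  ultimately show ?thesis using comm3_class[OF m] by blast
qed

text \<open>The cases are the positions of c relative to a and b. If c = a, then
  \<open>\<chi>_ab\<close> commutes with the product of \<open>\<chi>_ad'\<close> and
  \<open>\<chi>_bd'\<close>, and by the chain case with the second factor modulo
  \<open>\<Gamma> 3\<close>, hence with the first.\<close>

lemma comm3_X_X:
  assumes "a \<in> B k" "l \<in> IS" "b \<in> B l" "a \<noteq> b" "c \<in> B k'" "l' \<in> IS" "d \<in> B l'" "c \<noteq> d"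
  shows "comm3 (X c d) (X a b)"
proof -
  consider "c \<noteq> a" "c \<noteq> b" | "c = b" | "c = a" by blast
  then show ?thesis
  proof cases
    case 1
    then show ?thesis using assms comm3_X_X_disjoint by blast
  next
    case 2
    then show ?thesis using assms comm3_X_X_chain by blast
  next
    case 3
    obtain d' where d': "d' \<in> B l'" "d' \<noteq> a" "d' \<noteq> b" using avoid3[OF assms(6)] by metis
    have m: "X a d \<in> carrier G" "X a d' \<in> carrier G" "X b d' \<in> carrier G" "X a b \<in> carrier G"
      using assms d' 3 by (auto intro: X_mem)
    have "X a b \<bullet> (X a d' \<bullet> X b d') = (X a d' \<bullet> X b d') \<bullet> X a b"
      by (rule chi_aut_mccool) (use assms d' S_block_strand block_less in auto)
    then have "comm3 (X a d' \<bullet> X b d') (X a b)" using m by (intro comm3_commute) auto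
    moreover have "comm3 (X b d') (X a b)"
      using assms d' by (intro comm3_X_X_chain[where k = k and l = l and l' = l']) auto
    ultimately have "comm3 (X a d') (X a b)"
      unfolding comm3_def by (rule G.cent_mod_mult_cancel[OF G.lower_central_normal m(2,3,4)])
    moreover have "ab_class G (X a d) = ab_class G (X a d')"
      by (rule X_class[where k = k and l = l']) (use assms d' 3 in auto)
    ultimately show ?thesis using comm3_class[OF m(1,2,4)] 3 by blast
  qed
qed

text \<open>The element \<open>\<chi>\<^bsub>bd\<^esub>\<close> depends modulo \<open>\<Gamma> 3\<close> only on the block of \<open>b\<close>, because that block
  contains a transposition disjoint from the support of \<open>\<chi>\<^bsub>cd\<^esub>\<close>.\<close>

lemma comm4_X_X_chain:
  assumes "a \<in> B k" "l \<in> IS" "b \<in> B l" "a \<noteq> b" "l' \<in> IS" "d \<in> B l'" "b \<noteq> d" "a \<noteq> d"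
  shows "comm4 (X b d) (X a b)"
proof -
  obtain c where c: "c \<in> B l" "c \<noteq> a" "c \<noteq> b" "c \<noteq> d" using avoid3[OF assms(2)] by metis
  have m: "X b d \<in> carrier G" "X c d \<in> carrier G" "X a b \<in> carrier G" "P c b \<in> carrier G"
    using assms c by (auto intro: X_mem P_mem)
  have 1: "comm4 (X c d) (X a b)"
    using m assms c S_block_strand block_less by (intro comm4_commute chi_aut_commute) auto
  have t: "transpose c b \<in> young_subgroup lam" using c assms young_subgroup_transpose by blast
  have "P c b \<bullet> X c d = X b d \<bullet> P c b"
    using perm_aut_chi_aut[OF t, of c d] assms c S_block_strand block_less by (auto simp: transpose_def)
  \<comment> \<open>The quotient of the two \<chi> is a commutator already known to lie in
    \<open>\<Gamma> 3\<close>. Equality of their classes in the abelianization would only put it in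
    \<open>\<Gamma> 2\<close>, too weak modulo \<open>\<Gamma> 4\<close>.\<close>
  then have "commutator G (P c b) (X c d) = X b d \<bullet> inv\<^bsub>G\<^esub> X c d"
    using m by (simp add: commutator_def G.m_assoc)
  moreover have "comm3 (P c b) (X c d)"
    by (rule comm3_P_X[where k = l and k' = l and l = l']) (use assms c card_S_block[OF assms(2)] in auto)
  ultimately have "X b d \<bullet> inv\<^bsub>G\<^esub> X c d \<in> \<Gamma> 3" by (simp add: comm3_def cent_mod_def)
  then have "comm4 (X b d \<bullet> inv\<^bsub>G\<^esub> X c d) (X a b)" using m comm4_\<Gamma>3 by blast
  moreover have "comm4 (inv\<^bsub>G\<^esub> X c d) (X a b)"
    using 1 m subgroup.m_inv_closed[OF G.subgroup_cent_mod[OF G.lower_central_normal]] unfolding comm4_def by blast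
  ultimately show ?thesis
    unfolding comm4_def by (rule G.cent_mod_mult_cancel[OF G.lower_central_normal m(1) G.inv_closed[OF m(2)] m(3)])
qed

text \<open>The cancellation in the relation of McCool from \<open>comm3_X_X\<close>, one step
  deeper in the series. Here d is kept fixed, so a, b and d are distinct by hypothesis.\<close>

lemma comm4_X_X_same:
  assumes "a \<in> B k" "l \<in> IS" "b \<in> B l" "a \<noteq> b" "l' \<in> IS" "d \<in> B l'" "b \<noteq> d" "a \<noteq> d"
  shows "comm4 (X a d) (X a b)"
proof -
  have m: "X b d \<in> carrier G" "X a d \<in> carrier G" "X a b \<in> carrier G"
    using assms by (auto intro: X_mem)
  have "X a b \<bullet> (X a d \<bullet> X b d) = (X a d \<bullet> X b d) \<bullet> X a b"
    by (rule chi_aut_mccool) (use assms S_block_strand block_less in auto)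
  then have "comm4 (X a d \<bullet> X b d) (X a b)" using m by (intro comm4_commute) auto
  moreover have "comm4 (X b d) (X a b)" using assms comm4_X_X_chain by blast
  ultimately show ?thesis
    unfolding comm4_def by (rule G.cent_mod_mult_cancel[OF G.lower_central_normal m(2,1,3)])
qed

section \<open>The third step of the lower central series\<close>

definition first_strand :: "nat \<Rightarrow> nat" where
  "first_strand k = sum_list (take k lam)"

abbreviation "C a a' b \<equiv> commutator G (P a a') (X a b)"

text \<open>The transposition carries \<open>\<chi>_ab\<close> to \<open>\<chi>_a'b\<close>.
  Centrality of the commutator is thereby reduced to statements about these two factors.\<close>

lemma C_eq:
  assumes "a \<in> B i" "a' \<in> B i" "a \<noteq> a'" "i \<notin> IS" "j \<in> IS" "b \<in> B j"
  shows "C a a' b = X a' b \<bullet> inv\<^bsub>G\<^esub> X a b"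
proof -
  have ne: "a \<noteq> b" "a' \<noteq> b" using assms block_inj by blast+
  have m: "X a b \<in> carrier G" "X a' b \<in> carrier G" "P a a' \<in> carrier G"
    using assms ne by (auto intro: X_mem P_mem)
  have t: "transpose a a' \<in> young_subgroup lam" using assms young_subgroup_transpose by blast
  have "P a a' \<bullet> X a b = X a' b \<bullet> P a a'"
    using perm_aut_chi_aut[OF t, of a b] ne assms S_block_strand block_less by (auto simp: transpose_def)
  then show ?thesis using m by (simp add: commutator_def G.m_assoc)
qed

text \<open>Exchanging b for b' changes the entry \<chi> by an element of \<open>\<Gamma> 2\<close>
  and the commutator by one of \<open>\<Gamma> 3\<close>, which is central modulo
  \<open>\<Gamma> 4\<close>. So b can still be moved away from the support of y, although a single
  \<chi> no longer admits this.\<close>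

lemma comm4_C_indep:
  assumes "a \<in> B i" "a' \<in> B i" "i \<notin> IS" "j \<in> IS" "b \<in> B j" "b' \<in> B j" "y \<in> carrier G"
    and "comm4 (C a a' b') y"
  shows "comm4 (C a a' b) y"
proof -
  have ne: "a \<noteq> b" "a \<noteq> b'" using assms block_inj by blast+
  have m: "X a b \<in> carrier G" "X a b' \<in> carrier G" "P a a' \<in> carrier G"
    using assms ne by (auto intro: X_mem P_mem)
  have "ab_class G (X a b) = ab_class G (X a b')"
    by (rule X_class[where k = i and l = j]) (use assms ne in auto)
  then have "\<Gamma> 3 #>\<^bsub>G\<^esub> C a a' b = \<Gamma> 3 #>\<^bsub>G\<^esub> C a a' b'"
    using m by (intro G.commutator_rcos_ab_class_cong) auto
  then have "C a a' b \<in> \<Gamma> 3 #>\<^bsub>G\<^esub> C a a' b'"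
    using m G.rcos_self[OF _ G.lower_central_subgroup] by blast
  then obtain k where k: "k \<in> \<Gamma> 3" "C a a' b = k \<bullet> C a a' b'" by (auto simp: r_coset_def)
  then have "comm4 k y" using comm4_\<Gamma>3 assms by blast
  then show ?thesis
    using k assms(7,8) subgroup.m_closed[OF G.subgroup_cent_mod[OF G.lower_central_normal]]
    unfolding comm4_def by metis
qed

lemma comm4_C_via:
  assumes a: "a \<in> B i" "a' \<in> B i" "a \<noteq> a'" "i \<notin> IS" and j: "j \<in> IS" and b: "b \<in> B j" "c \<in> B j"
    and y: "y \<in> carrier G" and c: "comm4 (X a c) y" "comm4 (X a' c) y"
  shows "comm4 (C a a' b) y"
proof (rule comm4_C_indep[OF a(1,2,4) j b y])
  interpret K: subgroup "cent_mod G (\<Gamma> 4) y" G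
    by (rule G.subgroup_cent_mod[OF G.lower_central_normal y])
  show "comm4 (C a a' c) y"
    unfolding C_eq[OF a j b(2)] using c unfolding comm4_def by blast
qed

text \<open>The first indices a and a' are points while c is a circle, so \<rho> can only meet the
  second index of the \<chi>, and that index is moved off c.\<close>

lemma comm4_C_R:
  assumes a: "a \<in> B i" "a' \<in> B i" "a \<noteq> a'" "i \<notin> IS" and j: "j \<in> IS" "b \<in> B j" and c: "l \<in> IS" "c \<in> B l"
  shows "comm4 (C a a' b) (R c)"
proof -
  obtain d where d: "d \<in> B j" "d \<noteq> c" using avoid3[OF j(1)] by metis
  have ne: "a \<noteq> d" "a' \<noteq> d" "a \<noteq> c" "a' \<noteq> c"
    using assms d block_inj by blast+
  have m: "X a d \<in> carrier G" "X a' d \<in> carrier G" "R c \<in> carrier G"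
    using assms d ne by (auto intro: X_mem R_mem)
  have cm: "R c \<bullet> X a d = X a d \<bullet> R c" "R c \<bullet> X a' d = X a' d \<bullet> R c"
    by (rule rho_aut_chi_aut_commute; use assms d ne S_block_strand block_less in auto)+
  show ?thesis
    by (rule comm4_C_via[OF a j d(1)]) (use m cm in \<open>auto intro: comm4_commute\<close>)
qed

text \<open>Both \<open>\<tau>\<close> and \<open>\<rho>\<close> invert the commutator \<open>C\<close>, but \<open>\<rho>\<close> can be moved away from it.\<close>

lemma comm4_C_P:
  assumes a: "a \<in> B i" "a' \<in> B i" "a \<noteq> a'" "i \<notin> IS" and j: "j \<in> IS" "b \<in> B j"
  shows "comm4 (C a a' b) (P a a')"
proof -
  have ne: "a \<noteq> b" "a' \<noteq> b" using assms block_inj by blast+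
  define p where "p = P a a'"
  define r where "r = R b"
  define u where "u = X a b"
  define v where "v = X a' b"
  have m: "u \<in> carrier G" "v \<in> carrier G" "p \<in> carrier G" "r \<in> carrier G"
    using assms ne unfolding u_def v_def p_def r_def by (auto intro: X_mem P_mem R_mem)
  have t: "transpose a a' \<in> young_subgroup lam" using assms young_subgroup_transpose by blast
  have pu: "p \<bullet> u = v \<bullet> p" "p \<bullet> v = u \<bullet> p"
    using perm_aut_chi_aut[OF t, of a b] perm_aut_chi_aut[OF t, of a' b] ne assms S_block_strand block_less
    unfolding u_def v_def p_def by (auto simp: transpose_def)
  have ru: "r \<bullet> u \<bullet> inv\<^bsub>G\<^esub> r = inv\<^bsub>G\<^esub> u" "r \<bullet> v \<bullet> inv\<^bsub>G\<^esub> r = inv\<^bsub>G\<^esub> v"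
    using rho_aut_conj_chi_aut[of a b] rho_aut_conj_chi_aut[of a' b] ne assms S_block_strand block_less
    unfolding u_def v_def r_def by auto
  have uv: "u \<bullet> v = v \<bullet> u"
    unfolding u_def v_def using ne assms S_block_strand block_less by (intro chi_aut_commute) auto
  have C: "C a a' b = v \<bullet> inv\<^bsub>G\<^esub> u"
    unfolding u_def v_def by (rule C_eq[OF a j])
  have conj: "q \<bullet> (v \<bullet> inv\<^bsub>G\<^esub> u) \<bullet> inv\<^bsub>G\<^esub> q
      = (q \<bullet> v \<bullet> inv\<^bsub>G\<^esub> q) \<bullet> inv\<^bsub>G\<^esub> (q \<bullet> u \<bullet> inv\<^bsub>G\<^esub> q)" if "q \<in> carrier G" for q
    using that m by (simp add: G.group_word_simps)
  have "inv\<^bsub>G\<^esub> v \<bullet> u = u \<bullet> inv\<^bsub>G\<^esub> v"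
  proof -
    have "inv\<^bsub>G\<^esub> v \<bullet> u = inv\<^bsub>G\<^esub> v \<bullet> (u \<bullet> v) \<bullet> inv\<^bsub>G\<^esub> v"
      using m by (simp add: G.m_assoc)
    then show ?thesis unfolding uv using m by (simp add: G.group_word_simps)
  qed
  then have r: "r \<bullet> (v \<bullet> inv\<^bsub>G\<^esub> u) \<bullet> inv\<^bsub>G\<^esub> r = u \<bullet> inv\<^bsub>G\<^esub> v"
    unfolding conj[OF m(4)] ru using m by simp
  have p: "p \<bullet> (v \<bullet> inv\<^bsub>G\<^esub> u) \<bullet> inv\<^bsub>G\<^esub> p = u \<bullet> inv\<^bsub>G\<^esub> v"
    unfolding conj[OF m(3)] pu using m by (simp add: G.m_assoc)
  have "commutator G p (C a a' b) = commutator G r (C a a' b)"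
    unfolding C unfolding commutator_def p r by simp
  moreover have CG: "C a a' b \<in> carrier G" unfolding C using m by simp
  have "comm4 (C a a' b) r" unfolding r_def by (rule comm4_C_R[OF a j j])
  then have "comm4 r (C a a' b)" by (rule comm4_sym[OF CG m(4)])
  ultimately have "comm4 p (C a a' b)" using m by (simp add: comm4_def cent_mod_def)
  then have "comm4 (C a a' b) p" by (rule comm4_sym[OF m(3) CG])
  then show ?thesis unfolding p_def .
qed

lemma wB_gens_cases:
  assumes "y \<in> wB_gens"
  obtains (P) a b k where "y = P a b" "a \<noteq> b" "a \<in> B k" "b \<in> B k"
    | (R) c l where "y = R c" "l \<in> IS" "c \<in> B l"
    | (X) c d k l where "y = X c d" "c \<in> B k" "l \<in> IS" "d \<in> B l" "c \<noteq> d"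
proof -
  consider (P) a b k where "y = P a b" "a \<noteq> b" "a \<in> B k" "b \<in> B k"
    | (R) c where "y = R c" "nP \<le> c" "c < n"
    | (X) c d where "y = X c d" "c < n" "nP \<le> d" "d < n" "c \<noteq> d"
    using assms unfolding wB_gens_def by blast
  then show thesis
  proof cases
    case P
    then show thesis using that(1) by blast
  next
    case R
    then show thesis using that(2) ex_S_block by metis
  next
    case X
    obtain k where "c \<in> B k" using ex_block_strand X by blast
    moreover obtain l where "l \<in> IS" "d \<in> B l" using ex_S_block X by blast
    ultimately show thesis using that(3) X by blast
  qed
qed

text \<open>In general b is moved off the support of y. A transposition inside block i leaves no
  such freedom with a and a'; the hypothesis on \<open>B i\<close> makes it equal to the one of a
  and a', treated by \<open>comm4_C_P\<close>. A \<chi> that conjugates x_a or x_a' is treated by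
  \<open>comm4_X_X_same\<close>.\<close>

lemma comm4_C:
  assumes a: "a \<in> B i" "a' \<in> B i" "a \<noteq> a'" "i \<notin> IS" and Bi: "B i = {a, a'}" and j: "j \<in> IS" "b \<in> B j"
    and y: "y \<in> wB_gens"
  shows "comm4 (C a a' b) y"
proof -
  have aP: "a < nP" "a' < nP" using a S_block_iff by (meson not_less)+
  have aS: "a \<noteq> c" "a' \<noteq> c" if "l \<in> IS" "c \<in> B l" for c l
    using that a block_inj by blast+
  have yG: "y \<in> carrier G" using y wB_gens_closed by blast
  from y show ?thesis
  proof (cases rule: wB_gens_cases)
    case P: (P p q k)
    show ?thesis
    proof (cases "k = i")
      case True
      then have "transpose p q = transpose a a'"
        using P Bi by (auto simp: transpose_commute)
      then show ?thesis using comm4_C_P[OF a j] P by simp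
    next
      case False
      then have ne: "p \<noteq> a" "q \<noteq> a" "p \<noteq> a'" "q \<noteq> a'" using P a block_inj by blast+
      obtain d where d: "d \<in> B j" "d \<noteq> p" "d \<noteq> q" using avoid3[OF j(1)] by metis
      have t: "transpose p q \<in> young_subgroup lam" using P young_subgroup_transpose by blast
      have cm: "P p q \<bullet> X a d = X a d \<bullet> P p q" "P p q \<bullet> X a' d = X a' d \<bullet> P p q"
        using d ne j a aS[OF j(1) d(1)] S_block_strand block_less
        by (auto intro!: transpose_commute_fix t)
      show ?thesis
        by (rule comm4_C_via[OF a j d(1) yG])
          (use cm P a j d aS[OF j(1) d(1)] in \<open>auto intro!: comm4_commute intro: P_mem X_mem\<close>)
    qed
  next
    case R: (R c l)
    then show ?thesis using comm4_C_R[OF a j] by simp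
  next
    case X: (X c d k l)
    note k = X(2) and l = X(3,4)
    obtain e where e: "e \<in> B j" "e \<noteq> c" "e \<noteq> d" using avoid3[OF j(1)] by metis
    have m: "X a e \<in> carrier G" "X a' e \<in> carrier G" "X c d \<in> carrier G"
      using a j e aS[OF j(1) e(1)] X l k by (auto intro: X_mem)
    have away: "comm4 (X a'' e) (X c d)" if "a'' \<in> B i" "a'' \<noteq> c" for a''
    proof (rule comm4_commute)
      have "a'' \<noteq> e" "a'' \<noteq> d" using that a j e l block_inj by blast+
      then show "X a'' e \<bullet> X c d = X c d \<bullet> X a'' e"
        using that X e j S_block_strand block_less by (intro chi_aut_commute) auto
      show "X a'' e \<in> carrier G" using that j e \<open>a'' \<noteq> e\<close> by (auto intro: X_mem)
    qed (fact m)
    have near: "comm4 (X c e) (X c d)" if "c = a \<or> c = a'"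
      using that l k X e j aS[OF j(1) e(1)] aS[OF l] m
      by (intro comm4_X_X_same[where k = k and l = l and l' = j]) auto
    have "comm4 (X a e) (X c d)" "comm4 (X a' e) (X c d)"
      using away[OF a(1)] away[OF a(2)] near by (cases "c = a"; cases "c = a'"; auto)+
    then show ?thesis using comm4_C_via[OF a j e(1) m(3)] X by simp
  qed
qed

section \<open>Basic commutators and generation of the second term\<close>

lemma block_eq: "B k = {first_strand k..<first_strand (k + 1)}"
  by (simp add: block_def first_strand_def)

lemma first_strand_Suc: "k < length lam \<Longrightarrow> first_strand (k + 1) = first_strand k + lam ! k"
  by (simp add: first_strand_def take_Suc_conv_app_nth del: take_append)

lemma first_strand_mem: "k < length lam \<Longrightarrow> 0 < lam ! k \<Longrightarrow> first_strand k \<in> B k"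
  by (simp add: block_eq first_strand_Suc[unfolded Suc_eq_plus1[symmetric]])

lemma first_strand_mem_S: "k \<in> IS \<Longrightarrow> first_strand k \<in> B k"
  using card_S_block[of k] by (intro first_strand_mem) (auto simp: S_blocks_def card_block)

lemma block_2: "k < length lam \<Longrightarrow> lam ! k = 2 \<Longrightarrow> B k = {first_strand k, first_strand k + 1}"
  using first_strand_Suc[of k] by (auto simp: block_eq)

definition basic :: "nat \<times> nat \<Rightarrow> nat word \<Rightarrow> nat word" where
  "basic = (\<lambda>(i, j). C (first_strand i) (first_strand i + 1) (first_strand j))"

abbreviation I where "I \<equiv> basis_index lamP lamS"

lemma basis_indexD:
  assumes "(i, j) \<in> I"
  shows "i \<notin> IS" "j \<in> IS" "B i = {first_strand i, first_strand i + 1}" "i < length lam"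
    "first_strand i \<in> B i" "first_strand i + 1 \<in> B i" "first_strand j \<in> B j"
proof -
  have *: "i < length lamP" "lam ! i = 2" "j \<in> IS"
    using assms by (auto simp: basis_index_def P_blocks_def)
  then show "i \<notin> IS" "j \<in> IS" "i < length lam" by (auto simp: S_blocks_def)
  then show b: "B i = {first_strand i, first_strand i + 1}" using block_2 * by blast
  show "first_strand i \<in> B i" "first_strand i + 1 \<in> B i" unfolding b by auto
  show "first_strand j \<in> B j" using first_strand_mem_S * by blast
qed

lemma basic_factors_mem:
  assumes "(i, j) \<in> I"
  shows "P (first_strand i) (first_strand i + 1) \<in> carrier G" "X (first_strand i) (first_strand j) \<in> carrier G"
proof -
  note * = basis_indexD[OF assms]
  have "first_strand i \<noteq> first_strand j" using * block_inj by metis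
  then show "P (first_strand i) (first_strand i + 1) \<in> carrier G" "X (first_strand i) (first_strand j) \<in> carrier G"
    using * P_mem X_mem by blast+
qed

lemma basic_mem_\<Gamma>2: "ij \<in> I \<Longrightarrow> basic ij \<in> \<Gamma> 2"
  using G.commutator_mem_lower_central_Suc[of 1] basic_factors_mem
  by (cases ij) (auto simp: basic_def numeral_2_eq_2)

lemma \<Gamma>_closed: "x \<in> \<Gamma> k \<Longrightarrow> x \<in> carrier G"
  using G.lower_central_subgroup subgroup.subset by blast

text \<open>The candidate for \<open>\<Gamma> 2\<close>. Including \<open>\<Gamma> 3\<close> makes
  it normal, and its equality with \<open>\<Gamma> 2\<close> says that the basic commutators span
  the second component of the Lie ring.\<close>

definition H where "H = generate G (\<Gamma> 3 \<union> basic ` I)"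

lemma H_gens_closed: "\<Gamma> 3 \<union> basic ` I \<subseteq> carrier G"
  using \<Gamma>_closed basic_mem_\<Gamma>2 by blast

lemma \<Gamma>3_H: "\<Gamma> 3 \<subseteq> H"
  unfolding H_def by (blast intro: generate.incl)

lemma H_\<Gamma>2: "H \<subseteq> \<Gamma> 2"
  unfolding H_def
  using basic_mem_\<Gamma>2 G.lower_central_antimono[of 2]
  by (intro G.generate_subgroup_incl G.lower_central_subgroup) (auto simp: numeral_3_eq_3 numeral_2_eq_2)

lemma subgroup_H: "subgroup H G"
  unfolding H_def by (rule G.generate_is_subgroup[OF H_gens_closed])

text \<open>Conjugating h by x multiplies it by [x, h], which lies in \<open>\<Gamma> 3\<close>
  because H is contained in \<open>\<Gamma> 2\<close>.\<close>

lemma H_normal: "H \<lhd> G"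
  unfolding G.normal_inv_iff
proof (intro conjI ballI subgroup_H)
  interpret H: subgroup H G by (rule subgroup_H)
  fix x h assume x: "x \<in> carrier G" and h: "h \<in> H"
  have "commutator G x h \<in> \<Gamma> 3"
    using G.commutator_mem_lower_central_Suc[of 2 x h] x h H_\<Gamma>2 by (auto simp: numeral_3_eq_3 numeral_2_eq_2)
  then have "commutator G x h \<bullet> h \<in> H" using \<Gamma>3_H h by blast
  then show "x \<bullet> h \<bullet> inv\<^bsub>G\<^esub> x \<in> H"
    using x h by (simp add: G.conj_eq_commutator_mult)
qed

lemma comm3_H: "comm3 x y \<Longrightarrow> commutator G x y \<in> H"
  using \<Gamma>3_H by (auto simp: comm3_def cent_mod_def)

text \<open>Either \<open>comm3_P_X\<close> applies, or a, b and c lie in one block of two points.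
  Then both entries have the classes of the entries of \<open>basic (k, l)\<close>, and the two
  commutators agree modulo \<open>\<Gamma> 3\<close>.\<close>

lemma commutator_P_X_H:
  assumes "a \<in> B k" "b \<in> B k" "a \<noteq> b" "c \<in> B k'" "l \<in> IS" "d \<in> B l" "c \<noteq> d"
  shows "commutator G (P a b) (X c d) \<in> H"
proof (cases "k' = k \<and> card (B k) < 3")
  case False
  then show ?thesis
    using assms by (intro comm3_H comm3_P_X[where k = k and k' = k' and l = l]) auto
next
  case True
  have k: "k < length lam" using assms block_nonempty_less by blast
  have "card {a, b} \<le> card (B k)" using assms by (intro card_mono) (auto simp: block_eq)
  then have "lam ! k = 2" using True assms k by (auto simp: card_block)
  moreover have "k \<notin> IS" using card_S_block[of k] True by linarith
  ultimately have kl: "(k, l) \<in> I"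
    using assms k by (auto simp: basis_index_def P_blocks_def S_blocks_def)
  note * = basis_indexD[OF kl]
  have ne: "first_strand k \<noteq> first_strand l" using * block_inj by metis
  have m: "P a b \<in> carrier G" "X c d \<in> carrier G" using assms by (auto intro: P_mem X_mem)
  have "ab_class G (P a b) = ab_class G (P (first_strand k) (first_strand k + 1))"
    by (rule P_class[where k = k]) (use * assms in auto)
  moreover have "ab_class G (X c d) = ab_class G (X (first_strand k) (first_strand l))"
    by (rule X_class[where k = k and l = l]) (use * ne True assms in auto)
  ultimately have "\<Gamma> 3 #>\<^bsub>G\<^esub> commutator G (P a b) (X c d) = \<Gamma> 3 #>\<^bsub>G\<^esub> basic (k, l)"
    unfolding basic_def prod.case by (rule G.commutator_rcos_ab_class_cong[OF m basic_factors_mem[OF kl]])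
  then have "commutator G (P a b) (X c d) \<in> \<Gamma> 3 #>\<^bsub>G\<^esub> basic (k, l)"
    using m G.rcos_self[OF _ G.lower_central_subgroup] by blast
  then obtain g where g: "g \<in> \<Gamma> 3" "commutator G (P a b) (X c d) = g \<bullet> basic (k, l)"
    by (auto simp: r_coset_def)
  have "g \<in> H" using g \<Gamma>3_H by blast
  moreover have "basic (k, l) \<in> H" unfolding H_def using kl by (intro generate.incl) auto
  ultimately show ?thesis unfolding g(2) by (rule subgroup.m_closed[OF subgroup_H])
qed

lemma commutator_gens_H:
  assumes x: "x \<in> wB_gens" and y: "y \<in> wB_gens"
  shows "commutator G x y \<in> H"
proof -
  have c: "x \<in> carrier G" "y \<in> carrier G" using x y wB_gens_closed by blast+
  have sym: "commutator G x y \<in> H" if "commutator G y x \<in> H"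
    using subgroup.m_inv_closed[OF subgroup_H that] c by (simp add: G.inv_commutator)
  have sym3: "comm3 x y" if "comm3 y x"
    using comm3_sym c that by blast
  from x show ?thesis
  proof (cases rule: wB_gens_cases)
    case x: (P a b k)
    from y show ?thesis
    proof (cases rule: wB_gens_cases)
      case y: (P c d k')
      show ?thesis unfolding x(1) y(1) by (rule comm3_H[OF comm3_P_P[OF x(3,4,2) y(3,4,2)]])
    next
      case y: (R c l)
      show ?thesis unfolding x(1) y(1) by (rule comm3_H[OF comm3_P_R[OF x(3,4,2) y(2,3)]])
    next
      case y: (X c d k' l)
      show ?thesis unfolding x(1) y(1) by (rule commutator_P_X_H[OF x(3,4,2) y(2-5)])
    qed
  next
    case x: (R a k)
    from y show ?thesis
    proof (cases rule: wB_gens_cases)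
      case y: (P c d k')
      show ?thesis using comm3_P_R[OF y(3,4,2) x(2,3)] x(1) y(1) by (intro comm3_H sym3) simp
    next
      case y: (R c l)
      show ?thesis unfolding x(1) y(1) by (rule comm3_H[OF comm3_R_R[OF x(2,3) y(2,3)]])
    next
      case y: (X c d k' l)
      show ?thesis unfolding x(1) y(1) by (rule comm3_H[OF comm3_R_X[OF x(2,3) y(2-5)]])
    qed
  next
    case x: (X a b k l)
    from y show ?thesis
    proof (cases rule: wB_gens_cases)
      case y: (P c d k')
      show ?thesis using commutator_P_X_H[OF y(3,4,2) x(2-5)] x(1) y(1) by (intro sym) simp
    next
      case y: (R c l')
      show ?thesis using comm3_R_X[OF y(2,3) x(2-5)] x(1) y(1) by (intro comm3_H sym3) simp
    next
      case y: (X c d k' l')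
      show ?thesis unfolding x(1) y(1) by (rule comm3_H[OF comm3_X_X[OF y(2-4) y(5) x(2-5)]])
    qed
  qed
qed

lemma \<Gamma>2_eq_H: "\<Gamma> 2 = H"
proof
  have "\<Gamma> (Suc 1) \<subseteq> H"
  proof (rule G.lower_central_Suc_least[OF _ subgroup_H])
    fix a b assume "a \<in> carrier G" "b \<in> \<Gamma> 1"
    then show "commutator G a b \<in> H"
      using G.commutator_mem_if_generators[OF H_normal wB_gens_closed generate_wB_gens wB_gens_closed commutator_gens_H]
      by (simp add: generate_wB_gens)
  qed simp
  then show "\<Gamma> 2 \<subseteq> H" by (simp add: numeral_2_eq_2)
qed (rule H_\<Gamma>2)

text \<open>\<open>\<Gamma> 3\<close> is [G, \<open>\<Gamma> 2\<close>], and
  \<open>\<Gamma> 2\<close> is generated by \<open>\<Gamma> 3\<close> and the basic commutators. The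
  former contributes to \<open>\<Gamma> 4\<close> by definition, the latter by
  \<open>comm4_C\<close>.\<close>

lemma \<Gamma>3_eq_\<Gamma>4: "\<Gamma> 3 = \<Gamma> 4"
proof
  have "\<Gamma> (Suc 2) \<subseteq> \<Gamma> 4"
  proof (rule G.lower_central_Suc_least[OF _ G.lower_central_subgroup])
    fix a b assume a: "a \<in> carrier G" and b: "b \<in> \<Gamma> 2"
    have "commutator G y z \<in> \<Gamma> 4" if y: "y \<in> wB_gens" and z: "z \<in> \<Gamma> 3 \<union> basic ` I" for y z
    proof -
      have yG: "y \<in> carrier G" and zG: "z \<in> carrier G" using y z wB_gens_closed H_gens_closed by blast+
      have "comm4 z y"
      proof (cases "z \<in> \<Gamma> 3")
        case False
        then obtain i j where ij: "(i, j) \<in> I" "z = basic (i, j)" using z by auto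
        note * = basis_indexD[OF ij(1)]
        show ?thesis
          unfolding ij(2) basic_def prod.case
          by (rule comm4_C[OF *(5,6) _ *(1,3,2,7) y]) simp
      qed (use comm4_\<Gamma>3 yG in blast)
      then have "comm4 y z" using comm4_sym yG zG by blast
      then show ?thesis by (simp add: comm4_def cent_mod_def)
    qed
    then show "commutator G a b \<in> \<Gamma> 4"
      using G.commutator_mem_if_generators[OF G.lower_central_normal wB_gens_closed generate_wB_gens H_gens_closed _ a, of 4 b]
        b unfolding \<Gamma>2_eq_H H_def by blast
  qed simp
  then show "\<Gamma> 3 \<subseteq> \<Gamma> 4" by (simp add: numeral_3_eq_3 numeral_2_eq_2)
  show "\<Gamma> 4 \<subseteq> \<Gamma> 3" using G.lower_central_antimono[of 3] by (simp add: eval_nat_numeral)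
qed

end

section \<open>Detecting the basic commutators\<close>

text \<open>The dihedral group of order 8, as the wreath product of two groups of order 2: the first bit
  is the swap, the two others are the coordinates.\<close>

definition wreath :: "(bool \<times> bool \<times> bool) monoid" where
  "wreath = \<lparr>carrier = UNIV,
     monoid.mult = (\<lambda>(s, e, e') (t, f, f'). (s \<noteq> t, f \<noteq> (if t then e' else e), f' \<noteq> (if t then e else e'))),
     one = (False, False, False)\<rparr>"

lemma wreath_simps [simp]:
  "carrier wreath = UNIV"
  "(s, e, e') \<otimes>\<^bsub>wreath\<^esub> (t, f, f') = (s \<noteq> t, f \<noteq> (if t then e' else e), f' \<noteq> (if t then e else e'))"
  "\<one>\<^bsub>wreath\<^esub> = (False, False, False)"
  by (simp_all add: wreath_def)

lemma group_wreath: "group wreath"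
proof (rule groupI)
  fix x assume "x \<in> carrier wreath"
  obtain s e e' where x: "x = (s, e, e')" by (cases x)
  show "\<exists>y\<in>carrier wreath. y \<otimes>\<^bsub>wreath\<^esub> x = \<one>\<^bsub>wreath\<^esub>"
    by (rule bexI[of _ "(s, if s then e' else e, if s then e else e')"]) (auto simp: x)
qed auto

text \<open>Commutators lie in the centre, whose non-trivial element has both coordinates set and no
  swap.\<close>

lemma lower_central_wreath: "lower_central wreath 3 = {\<one>\<^bsub>wreath\<^esub>}"
proof -
  interpret W: group wreath by (rule group_wreath)
  let ?K = "{(False, False, False), (False, True, True)}"
  \<comment> \<open>A commutator is recognised through xy = k(yx), which can be checked on bits
    without computing inverses.\<close>
  have comm: "commutator wreath x y = k" if "x \<otimes>\<^bsub>wreath\<^esub> y = k \<otimes>\<^bsub>wreath\<^esub> (y \<otimes>\<^bsub>wreath\<^esub> x)" for x y k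
    unfolding commutator_def that by (simp add: W.m_assoc del: wreath_simps(2,3))
  have K: "subgroup ?K wreath"
  proof
    fix x assume "x \<in> ?K"
    then have "x \<otimes>\<^bsub>wreath\<^esub> x = \<one>\<^bsub>wreath\<^esub>" by auto
    then have "inv\<^bsub>wreath\<^esub> x = x" by (rule W.inv_equality) auto
    then show "inv\<^bsub>wreath\<^esub> x \<in> ?K" using \<open>x \<in> ?K\<close> by simp
  qed auto
  have "lower_central wreath (Suc 1) \<subseteq> ?K"
  proof (rule W.lower_central_Suc_least[OF _ K])
    fix x y :: "bool \<times> bool \<times> bool"
    obtain s e e' t f f' where xy: "x = (s, e, e')" "y = (t, f, f')" by (metis surj_pair)
    have "\<exists>k\<in>?K. x \<otimes>\<^bsub>wreath\<^esub> y = k \<otimes>\<^bsub>wreath\<^esub> (y \<otimes>\<^bsub>wreath\<^esub> x)"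
      unfolding xy by (cases s; cases t) auto
    then show "commutator wreath x y \<in> ?K" using comm by blast
  qed simp
  then have 2: "lower_central wreath 2 \<subseteq> ?K" by (simp add: numeral_2_eq_2)
  have "lower_central wreath (Suc 2) \<subseteq> {\<one>\<^bsub>wreath\<^esub>}"
  proof (rule W.lower_central_Suc_least[OF _ W.triv_subgroup])
    fix x y :: "bool \<times> bool \<times> bool" assume "y \<in> lower_central wreath 2"
    then have y: "y \<in> ?K" using 2 by blast
    obtain s e e' where x: "x = (s, e, e')" by (cases x)
    have "x \<otimes>\<^bsub>wreath\<^esub> y = \<one>\<^bsub>wreath\<^esub> \<otimes>\<^bsub>wreath\<^esub> (y \<otimes>\<^bsub>wreath\<^esub> x)"
      using y by (auto simp: x)
    then show "commutator wreath x y \<in> {\<one>\<^bsub>wreath\<^esub>}" using comm by blast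
  qed simp
  then show ?thesis
    using subgroup.one_closed[OF W.lower_central_subgroup[of 3]] by (auto simp: numeral_3_eq_3 numeral_2_eq_2)
qed

text \<open>Signs are ignored. The count modulo 2 is well defined on the free group because the two
  letters of a cancelling pair lie both in J or both outside.\<close>

definition parity :: "'a set \<Rightarrow> 'a word \<Rightarrow> bool" where
  "parity J w = odd (length (filter (\<lambda>l. fst l \<in> J) w))"

lemma parity_simps [simp]:
  "parity J [] = False"
  "parity J (l # w) = ((fst l \<in> J) \<noteq> parity J w)"
  "parity J (u @ v) = (parity J u \<noteq> parity J v)"
  by (auto simp: parity_def)

lemma parity_inv_word [simp]: "parity J (inv_word w) = parity J w"
  by (induction w) auto

lemma parity_reduce [simp]: "parity J (reduce w) = parity J w"
proof (induction w)
  case (Cons l w)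
  have "parity J (red_cons l v) = ((fst l \<in> J) \<noteq> parity J v)" for v :: "'a word"
    by (cases v) auto
  then show ?case using Cons by (simp add: reduce_def)
qed (simp add: reduce_def)

context wB_large_circles
begin

lemma parity_mult: "parity J (u \<cdot> v) = (parity J u \<noteq> parity J v)"
  by (simp add: mult_free_group)

lemma parity_inv: "u \<in> carrier F \<Longrightarrow> parity J (inv\<^bsub>F\<^esub> u) = parity J u"
  by (simp add: inv_free_group)

text \<open>A generator goes to a conjugate of a letter in the same block, and the conjugating word
  is counted twice. By this invariance the twist by g in \<open>strand_mult\<close> is invisible to
  \<open>detect\<close>.\<close>

lemma parity_wB:
  assumes g: "g \<in> carrier G" and u: "u \<in> carrier F"
  shows "parity (B j) (g u) = parity (B j) u"
proof -
  let ?M = "{u \<in> carrier F. parity (B j) (g u) = parity (B j) u}"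
  note hg = wB_hom(1-4)[OF g]
  have "subgroup ?M F"
    by unfold_locales (auto simp: hg parity_mult parity_inv)
  moreover have "free_gen i \<in> ?M" if i: "i < n" for i
  proof -
    obtain \<sigma> where \<sigma>: "\<sigma> \<in> young_subgroup lam" "conj_letter i (\<sigma> i) (g (free_gen i))"
      using g i by (auto simp: mem_wB_iff)
    obtain w e where w: "w \<in> carrier FS" "g (free_gen i) = w \<cdot> [(\<sigma> i, e)] \<cdot> inv\<^bsub>F\<^esub> w"
      using \<sigma>(2) by (elim conj_letterE)
    have "parity (B j) (g (free_gen i)) = (\<sigma> i \<in> B j)"
      unfolding w(2) using FS_subset[OF w(1)] by (auto simp: parity_mult parity_inv)
    then show ?thesis using i young_subgroup_block[OF \<sigma>(1)] by (simp add: free_gen_letter[of i])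
      (simp add: free_gen_letter[symmetric])
  qed
  ultimately have "generate F (free_gen ` {..<n}) \<subseteq> ?M"
    by (intro F.generate_subgroup_incl) auto
  then show ?thesis using u by (subst (asm) generate_free_gens) auto
qed

text \<open>For a point a the image of x_a is w x_b w^-1 with b a point and w in circle letters. It
  contains a single point letter, so cutting there recovers w and b without a choice.\<close>

definition strand_word :: "(nat word \<Rightarrow> nat word) \<Rightarrow> nat \<Rightarrow> nat word" where
  "strand_word g a = takeWhile (\<lambda>l. nP \<le> fst l) (g (free_gen a))"

definition strand_end :: "(nat word \<Rightarrow> nat word) \<Rightarrow> nat \<Rightarrow> nat" where
  "strand_end g a = fst (hd (dropWhile (\<lambda>l. nP \<le> fst l) (g (free_gen a))))"

lemma conj_P_letter:
  assumes w: "w \<in> carrier FS" and b: "b < nP"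
  shows "w \<cdot> [(b, True)] \<cdot> inv\<^bsub>F\<^esub> w = w @ [(b, True)] @ inv_word w"
proof -
  have rw: "reduced w" and fw: "fst ` set w \<subseteq> {nP..<n}" using w by (auto simp: carrier_free_group)
  have "fst (last w) \<noteq> b" if "w \<noteq> []"
    using fw b last_in_set[OF that] by fastforce
  then have r1: "reduced (w @ [(b, True)])" using rw by (auto simp: reduced_append)
  have "fst (hd (inv_word w)) \<noteq> b" if "inv_word w \<noteq> []"
  proof -
    have "fst (hd (inv_word w)) \<in> fst ` set (inv_word w)"
      using hd_in_set[OF that] by (rule imageI)
    then show ?thesis using fw b by auto
  qed
  then have "reduced ((w @ [(b, True)]) @ inv_word w)"
    unfolding reduced_append[of "w @ [(b, True)]"] using r1 rw by auto
  then show ?thesis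
    using r1 by (simp add: inv_free_group[OF FS_subset[OF w]] mult_free_group reduce_reduced)
qed

lemma strand_eqI:
  assumes w: "w \<in> carrier FS" and b: "b < nP"
    and g: "g (free_gen a) = w \<cdot> [(b, True)] \<cdot> inv\<^bsub>F\<^esub> w"
  shows "strand_word g a = w" "strand_end g a = b"
proof -
  have fw: "nP \<le> fst l" if "l \<in> set w" for l
    using w that by (auto simp: carrier_free_group)
  show "strand_word g a = w"
    unfolding strand_word_def g conj_P_letter[OF w b] using fw b by (subst takeWhile_append2) auto
  show "strand_end g a = b"
    unfolding strand_end_def g conj_P_letter[OF w b] using fw b by (subst dropWhile_append2) auto
qed

lemma strand:
  assumes g: "g \<in> carrier G" and a: "a < nP"
  shows "strand_word g a \<in> carrier FS" "strand_end g a < nP"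
    "g (free_gen a) = strand_word g a \<cdot> [(strand_end g a, True)] \<cdot> inv\<^bsub>F\<^esub> strand_word g a"
    "a \<in> B k \<Longrightarrow> strand_end g a \<in> B k"
proof -
  have an: "a < n" using a by (simp add: n_def)
  obtain \<sigma> where \<sigma>: "\<sigma> \<in> young_subgroup lam" "conj_letter a (\<sigma> a) (g (free_gen a))"
    using g an by (auto simp: mem_wB_iff)
  obtain w e where w: "w \<in> carrier FS" "a < nP \<Longrightarrow> e" "g (free_gen a) = w \<cdot> [(\<sigma> a, e)] \<cdot> inv\<^bsub>F\<^esub> w"
    using \<sigma>(2) by (elim conj_letterE) auto
  have b: "\<sigma> a < nP" using young_less_nP[OF \<sigma>(1) an] a by simp
  have gw: "g (free_gen a) = w \<cdot> [(\<sigma> a, True)] \<cdot> inv\<^bsub>F\<^esub> w" using w a by simp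
  note eq = strand_eqI[of w "\<sigma> a" g a, OF w(1) b gw]
  show "strand_word g a \<in> carrier FS" "strand_end g a < nP"
    "g (free_gen a) = strand_word g a \<cdot> [(strand_end g a, True)] \<cdot> inv\<^bsub>F\<^esub> strand_word g a"
    unfolding eq using w(1) b gw by auto
  show "strand_end g a \<in> B k" if "a \<in> B k"
    unfolding eq using that young_subgroup_block[OF \<sigma>(1)] by simp
qed

text \<open>Applying g to the normal form of the image under h gives a cocycle rule, in which the
  right factor acts before the left one. After reduction to parities it is the multiplication of
  \<open>wreath\<close>.\<close>

lemma strand_mult:
  assumes g: "g \<in> carrier G" and h: "h \<in> carrier G" and a: "a < nP"
  shows "strand_word (g \<bullet> h) a = g (strand_word h a) \<cdot> strand_word g (strand_end h a)"
    and "strand_end (g \<bullet> h) a = strand_end g (strand_end h a)"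
proof -
  interpret S: subgroup "carrier FS" F by (rule subgroup_FS)
  let ?b = "strand_end h a" and ?w = "strand_word h a"
  let ?c = "strand_end g ?b" and ?v = "strand_word g ?b"
  note sh = strand[OF h a] and sg = strand[OF g strand(2)[OF h a]]
  note hg = wB_hom(1-4)[OF g]
  have an: "a < n" and bn: "?b < n" "?c < n" using a sh(2) sg(2) by (auto simp: n_def)
  have "(g \<bullet> h) (free_gen a) = g ?w \<cdot> g (free_gen ?b) \<cdot> inv\<^bsub>F\<^esub> g ?w"
    using g h an bn FS_subset[OF sh(1)]
    by (simp add: mult_wB_apply sh(3)) (simp add: hg free_gen_letter[symmetric])
  also have "\<dots> = (g ?w \<cdot> ?v) \<cdot> [(?c, True)] \<cdot> inv\<^bsub>F\<^esub> (g ?w \<cdot> ?v)"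
    unfolding sg(3) using FS_subset[OF sh(1)] FS_subset[OF sg(1)] bn
    by (simp add: hg letter_closed F.inv_mult_group F.m_assoc)
  finally have eq: "(g \<bullet> h) (free_gen a) = (g ?w \<cdot> ?v) \<cdot> [(?c, True)] \<cdot> inv\<^bsub>F\<^esub> (g ?w \<cdot> ?v)" .
  have "g ?w \<cdot> ?v \<in> carrier FS" using wB_FS_closed[OF g sh(1)] sg(1) by (rule S.m_closed)
  from strand_eqI[of "g ?w \<cdot> ?v" ?c "g \<bullet> h" a, OF this sg(2) eq]
  show "strand_word (g \<bullet> h) a = g ?w \<cdot> ?v" "strand_end (g \<bullet> h) a = ?c" .
qed

text \<open>Ends compose, and those of the product of the inverse of g with g are the
  identity.\<close>

lemma strand_end_inj:
  assumes g: "g \<in> carrier G" and a: "a < nP" "b < nP" and eq: "strand_end g a = strand_end g b"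
  shows "a = b"
proof -
  have "strand_end (inv\<^bsub>G\<^esub> g \<bullet> g) c = c" if "c < nP" for c
  proof -
    have "(inv\<^bsub>G\<^esub> g \<bullet> g) (free_gen c) = \<one>\<^bsub>F\<^esub> \<cdot> [(c, True)] \<cdot> inv\<^bsub>F\<^esub> \<one>\<^bsub>F\<^esub>"
    proof -
      have cn: "c < n" using that by (simp add: n_def)
      have "(inv\<^bsub>G\<^esub> g \<bullet> g) (free_gen c) = [(c, True)]"
        using g cn by (simp add: one_wB_apply) (simp add: free_gen_letter)
      then show ?thesis using letter_closed[OF cn, of True] by simp
    qed
    then show ?thesis
      by (rule strand_eqI(2)[OF subgroup.one_closed[OF subgroup_FS] that])
  qed
  then show ?thesis using strand_mult(2)[of "inv\<^bsub>G\<^esub> g" g] g a eq by (metis G.inv_closed)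
qed

definition detect :: "nat \<Rightarrow> nat \<Rightarrow> (nat word \<Rightarrow> nat word) \<Rightarrow> bool \<times> bool \<times> bool" where
  "detect i j g = (let a = first_strand i; a' = a + 1 in
     (strand_end g a = a', parity (B j) (strand_word g a), parity (B j) (strand_word g a')))"

lemma detect_hom:
  assumes ij: "(i, j) \<in> I"
  shows "detect i j \<in> hom G wreath"
proof (rule homI)
  note * = basis_indexD[OF ij]
  let ?a = "first_strand i"
  let ?a' = "?a + 1"
  have aP: "?a < nP" "?a' < nP" using *(1,5,6) S_block_iff by (meson not_less)+
  \<comment> \<open>A block of two strands is either fixed pointwise or swapped, so the single bit
    in \<open>detect\<close> determines both ends.\<close>
  have ends: "strand_end g ?a = ?a \<and> strand_end g ?a' = ?a' \<or> strand_end g ?a = ?a' \<and> strand_end g ?a' = ?a"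
    if g: "g \<in> carrier G" for g
    using strand(4)[OF g aP(1) *(5)] strand(4)[OF g aP(2) *(6)] strand_end_inj[OF g aP] *(3) by auto
  fix g h assume g: "g \<in> carrier G" and h: "h \<in> carrier G"
  have p: "parity (B j) (strand_word (g \<bullet> h) b)
      = (parity (B j) (strand_word h b) \<noteq> parity (B j) (strand_word g (strand_end h b)))" if "b < nP" for b
    using strand_mult(1)[OF g h that] strand(1)[OF h that] FS_subset by (simp add: parity_mult parity_wB[OF g])
  show "detect i j (g \<bullet> h) = detect i j g \<otimes>\<^bsub>wreath\<^esub> detect i j h"
    using ends[OF g] ends[OF h] p[OF aP(1)] p[OF aP(2)] strand_mult(2)[OF g h aP(1)]
    by (auto simp: detect_def Let_def)
qed auto

lemma detect_X:
  assumes ij: "(i, j) \<in> I" and c: "c \<in> B k" "l \<in> IS" "d \<in> B l" "c \<noteq> d"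
  shows "detect i j (X c d) =
    (False, c = first_strand i \<and> d \<in> B j, c = first_strand i + 1 \<and> d \<in> B j)"
proof -
  note * = basis_indexD[OF ij]
  let ?a = "first_strand i"
  let ?a' = "?a + 1"
  have aP: "?a < nP" "?a' < nP" using *(1,5,6) S_block_iff by (meson not_less)+
  have dS: "nP \<le> d" "d < n" using c S_block_strand block_less by auto
  have cn: "c < n" using c block_less by blast
  have X: "strand_word (X c d) b = (if b = c then [(d, True)] else [])" "strand_end (X c d) b = b" if b: "b < nP" for b
  proof -
    have bn: "b < n" using b by (simp add: n_def)
    let ?w = "if b = c then [(d, True)] else \<one>\<^bsub>F\<^esub>"
    have "X c d (free_gen b) = ?w \<cdot> [(b, True)] \<cdot> inv\<^bsub>F\<^esub> ?w"
      using chi_aut_gen[OF cn dS(2) bn] letter_closed[OF bn, of True] by (auto simp: free_gen_letter)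
    moreover have "?w \<in> carrier FS" using dS by (auto simp: letter_FS subgroup.one_closed[OF subgroup_FS])
    ultimately show "strand_word (X c d) b = (if b = c then [(d, True)] else [])" "strand_end (X c d) b = b"
      using strand_eqI[of ?w b "X c d" b] b by (auto simp: one_free_group)
  qed
  show ?thesis
    using X[OF aP(1)] X[OF aP(2)] by (auto simp: detect_def Let_def)
qed

text \<open>The basic commutator is the quotient of two \<chi>. With matching indices they are sent
  to the two coordinate vectors, whose quotient is the non-trivial central element; otherwise both
  have trivial image.\<close>

lemma detect_basic:
  assumes ij: "(i, j) \<in> I" and kl: "(k, l) \<in> I"
  shows "detect i j (basic (k, l)) = (False, (k, l) = (i, j), (k, l) = (i, j))"
proof -
  interpret W: group wreath by (rule group_wreath)
  interpret h: group_hom G wreath "detect i j"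
    using detect_hom[OF ij] by unfold_locales
  note * = basis_indexD[OF ij] and ** = basis_indexD[OF kl]
  let ?c = "first_strand k" and ?d = "first_strand l"
  have ne: "?c \<noteq> ?d" "?c + 1 \<noteq> ?d" using ** block_inj by metis+
  have m: "X ?c ?d \<in> carrier G" "X (?c + 1) ?d \<in> carrier G" using ** ne X_mem by blast+
  have inv: "inv\<^bsub>wreath\<^esub> (False, e, e') = (False, e, e')" for e e'
    by (rule W.inv_equality) auto
  have d: "?d \<in> B j \<longleftrightarrow> l = j" using ** block_inj by blast
  have c: "?c = first_strand i \<longleftrightarrow> k = i" "?c + 1 = first_strand i + 1 \<longleftrightarrow> k = i"
    using * ** block_inj by (metis add_right_cancel)+
  have c': "?c \<noteq> first_strand i + 1" "?c + 1 \<noteq> first_strand i"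
    using * ** block_inj by (metis n_not_Suc_n Suc_eq_plus1)+
  have "basic (k, l) = X (?c + 1) ?d \<bullet> inv\<^bsub>G\<^esub> X ?c ?d"
    unfolding basic_def prod.case using ** by (intro C_eq) auto
  then show ?thesis
    using m c c' d detect_X[OF ij **(5,2,7) ne(1)] detect_X[OF ij **(6,2,7) ne(2)]
    by (simp add: inv)
qed

text \<open>The kernel of \<open>detect i j\<close> serves as the coordinate hyperplane belonging to
  (i, j). It contains \<open>\<Gamma> 3\<close> because the third term of the dihedral group is
  trivial.\<close>

lemma detecting_subgroup:
  assumes ij: "ij \<in> I"
  obtains K where "subgroup K G" "\<Gamma> 3 \<subseteq> K" "basic ij \<notin> K" "basic ` (I - {ij}) \<subseteq> K"
proof -
  obtain i j where ij': "ij = (i, j)" by force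
  note ij = ij[unfolded ij']
  interpret h: group_hom G wreath "detect i j"
    using detect_hom[OF ij] G.is_group group_wreath by (simp add: group_hom_def group_hom_axioms_def)
  let ?K = "kernel G wreath (detect i j)"
  have "\<Gamma> 3 \<subseteq> ?K"
    using G.lower_central_hom[OF group_wreath detect_hom[OF ij], of _ 3] \<Gamma>_closed
    by (auto simp: kernel_def lower_central_wreath)
  moreover have "basic ij \<notin> ?K"
    using detect_basic[OF ij ij] by (simp add: kernel_def ij')
  moreover have "basic kl \<in> ?K" if "kl \<in> I - {ij}" for kl
    using that detect_basic[OF ij, of "fst kl" "snd kl"] basic_mem_\<Gamma>2[of kl] \<Gamma>_closed
    by (auto simp: kernel_def ij')
  ultimately show thesis using that[OF h.subgroup_kernel] by blast
qed

end

section \<open>Vector spaces over the field with two elements\<close>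

lemma zmod_module_simps [simp]:
  "carrier (zmod_module A) = carrier A"
  "\<zero>\<^bsub>zmod_module A\<^esub> = \<one>\<^bsub>A\<^esub>"
  "x \<oplus>\<^bsub>zmod_module A\<^esub> y = x \<otimes>\<^bsub>A\<^esub> y"
  "k \<odot>\<^bsub>zmod_module A\<^esub> x = x [^]\<^bsub>A\<^esub> k"
  by (simp_all add: zmod_module_def)

lemma finsum_zmod_module: "finsum (zmod_module A) f I = finprod A f I"
  by (simp add: finsum_def finprod_def zmod_module_def)

lemma abelian_group_zmod_module:
  assumes "comm_group A"
  shows "abelian_group (zmod_module A)"
proof -
  interpret comm_group A by fact
  show ?thesis
    by (rule abelian_groupI) (auto simp: m_ac intro: l_inv)
qed

lemma residue_ring_2:
  "cring (residue_ring 2)" "carrier (residue_ring 2) = {0, 1}"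
  "x \<oplus>\<^bsub>residue_ring 2\<^esub> y = (x + y) mod 2" "x \<otimes>\<^bsub>residue_ring 2\<^esub> y = (x * y) mod 2"
  "\<zero>\<^bsub>residue_ring 2\<^esub> = 0" "\<one>\<^bsub>residue_ring 2\<^esub> = 1"
proof -
  interpret residues 2 "residue_ring 2" by unfold_locales simp_all
  show "cring (residue_ring 2)" by (rule cring)
qed (auto simp: residue_ring_def)

locale comm_group_exponent_2 = comm_group A for A (structure) +
  assumes square: "x \<in> carrier A \<Longrightarrow> x \<otimes> x = \<one>"
begin

lemma int_pow_add_mod_2:
  "x \<in> carrier A \<Longrightarrow> a \<in> {0, 1} \<Longrightarrow> b \<in> {0, 1} \<Longrightarrow> x [^] ((a + b) mod (2::int)) = x [^] a \<otimes> x [^] b"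
  by (auto simp: int_pow_1 square)

lemma module_zmod_2: "module (residue_ring 2) (zmod_module A)"
proof (rule moduleI)
  show "abelian_group (zmod_module A)"
    by (rule abelian_group_zmod_module[OF comm_group_axioms])
  fix a b :: int and x y
  assume x: "x \<in> carrier (zmod_module A)"
  then have xA: "x \<in> carrier A" by simp
  show "a \<odot>\<^bsub>zmod_module A\<^esub> x \<in> carrier (zmod_module A)" using xA by simp
  show "\<one>\<^bsub>residue_ring 2\<^esub> \<odot>\<^bsub>zmod_module A\<^esub> x = x"
    using xA by (simp add: residue_ring_2 int_pow_1)
  assume "a \<in> carrier (residue_ring 2)"
  then have a: "a \<in> {0, 1}" by (simp add: residue_ring_2)
  show "a \<odot>\<^bsub>zmod_module A\<^esub> (x \<oplus>\<^bsub>zmod_module A\<^esub> y) = a \<odot>\<^bsub>zmod_module A\<^esub> x \<oplus>\<^bsub>zmod_module A\<^esub> a \<odot>\<^bsub>zmod_module A\<^esub> y"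
    if "y \<in> carrier (zmod_module A)"
    using xA a that by (auto simp: int_pow_1)
  assume "b \<in> carrier (residue_ring 2)"
  then have b: "b \<in> {0, 1}" by (simp add: residue_ring_2)
  show "(a \<oplus>\<^bsub>residue_ring 2\<^esub> b) \<odot>\<^bsub>zmod_module A\<^esub> x = a \<odot>\<^bsub>zmod_module A\<^esub> x \<oplus>\<^bsub>zmod_module A\<^esub> b \<odot>\<^bsub>zmod_module A\<^esub> x"
    using int_pow_add_mod_2[OF xA a b] by (simp add: residue_ring_2)
  show "(a \<otimes>\<^bsub>residue_ring 2\<^esub> b) \<odot>\<^bsub>zmod_module A\<^esub> x = a \<odot>\<^bsub>zmod_module A\<^esub> (b \<odot>\<^bsub>zmod_module A\<^esub> x)"
    using xA a b by (auto simp: residue_ring_2 int_pow_1)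
qed (rule residue_ring_2)

lemma finprod_in_subgroup:
  assumes "subgroup K A" "f ` J \<subseteq> K"
  shows "finprod A f J \<in> K"
  using assms(2)
proof (induction J rule: infinite_finite_induct)
  case (insert j J)
  have "K \<subseteq> carrier A" using assms(1) by (rule subgroup.subset)
  then have "finprod A f (insert j J) = f j \<otimes> finprod A f J"
    using insert by (intro finprod_insert) auto
  then show ?case using insert subgroup.m_closed[OF assms(1)] by simp
qed (simp_all add: subgroup.one_closed[OF assms(1)])

text \<open>Independence is expressed by subgroups separating each b i from the others, in place of
  dual functionals, since subgroups of G are easily carried to the quotient. The identity in the
  spanning set is what \<open>\<Gamma> 3\<close> contributes in \<open>generate_L2\<close>.\<close>

lemma finite_basisI:
  assumes I: "finite I" and b: "b ` I \<subseteq> carrier A"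
    and indep: "\<And>i. i \<in> I \<Longrightarrow> \<exists>K. subgroup K A \<and> b i \<notin> K \<and> b ` (I - {i}) \<subseteq> K"
    and span: "carrier A \<subseteq> generate A (insert \<one> (b ` I))"
  shows "finite_basis (residue_ring 2) (zmod_module A) b I"
  unfolding finite_basis_def finsum_zmod_module zmod_module_simps residue_ring_2
proof (intro conjI ballI impI)
  fix c i assume c: "c \<in> I \<rightarrow> {0, 1 :: int}" and prod: "(\<Otimes>i\<in>I. b i [^] c i) = \<one>" and i: "i \<in> I"
  obtain K where K: "subgroup K A" "b i \<notin> K" "b ` (I - {i}) \<subseteq> K" using indep[OF i] by blast
  interpret K: subgroup K A by fact
  have bc: "b j [^] c j \<in> carrier A" if "j \<in> I" for j using that b by auto
  have rest: "(\<Otimes>j\<in>I - {i}. b j [^] c j) \<in> K"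
  proof (rule finprod_in_subgroup[OF K(1)])
    have "b j [^] c j \<in> K" if "j \<in> I - {i}" for j
    proof -
      have "b j \<in> K" "c j \<in> {0, 1}" using that K(3) c by auto
      then show ?thesis by (auto simp: int_pow_1)
    qed
    then show "(\<lambda>j. b j [^] c j) ` (I - {i}) \<subseteq> K" by blast
  qed
  have "(\<Otimes>j\<in>insert i (I - {i}). b j [^] c j) = b i [^] c i \<otimes> (\<Otimes>j\<in>I - {i}. b j [^] c j)"
    by (rule finprod_insert) (use I i bc in auto)
  then have "b i [^] c i \<otimes> (\<Otimes>j\<in>I - {i}. b j [^] c j) = \<one>"
    using prod i by (simp add: insert_absorb)
  \<comment> \<open>The i-th term is the inverse of the remaining product and so lies in K; with
    coefficient 1 this would put b i in K.\<close>
  then have "inv (\<Otimes>j\<in>I - {i}. b j [^] c j) = b i [^] c i"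
    using bc[OF i] K.mem_carrier[OF rest] by (intro inv_equality)
  then have "b i [^] c i \<in> K" using K.m_inv_closed[OF rest] by simp
  then have "c i \<noteq> 1" using K(2) b i by (auto simp: int_pow_1)
  then show "c i = 0" using c i by auto
next
  fix v assume v: "v \<in> carrier A"
  let ?V = "{\<Otimes>i\<in>I. b i [^] c i | c. c \<in> I \<rightarrow> {0, 1 :: int}}"
  have bc: "(\<lambda>i. b i [^] c i) \<in> I \<rightarrow> carrier A" for c :: "_ \<Rightarrow> int" using b by auto
  have V1: "\<one> \<in> ?V"
    by (rule CollectI, rule exI[of _ "\<lambda>_. 0"]) simp
  have "subgroup ?V A"
  proof
    show "?V \<subseteq> carrier A" using bc by auto
    show "\<one> \<in> ?V" by (rule V1)
    fix x assume x: "x \<in> ?V"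
    then obtain c where c: "x = (\<Otimes>i\<in>I. b i [^] c i)" "c \<in> I \<rightarrow> {0, 1 :: int}" by blast
    have "x \<in> carrier A" using c bc by auto
    then have "inv x = x" using square by (intro inv_equality) auto
    then show "inv x \<in> ?V" using x by simp
    fix y assume "y \<in> ?V"
    then obtain d where d: "y = (\<Otimes>i\<in>I. b i [^] d i)" "d \<in> I \<rightarrow> {0, 1 :: int}" by blast
    have "x \<otimes> y = (\<Otimes>i\<in>I. b i [^] c i \<otimes> b i [^] d i)"
      unfolding c(1) d(1) by (rule finprod_multf[OF bc bc, symmetric])
    also have "\<dots> = (\<Otimes>i\<in>I. b i [^] ((c i + d i) mod 2))"
    proof (rule finprod_cong')
      fix i assume i: "i \<in> I"
      have "b i \<in> carrier A" "c i \<in> {0, 1}" "d i \<in> {0, 1}" using b c(2) d(2) i by auto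
      then show "b i [^] c i \<otimes> b i [^] d i = b i [^] ((c i + d i) mod 2)"
        by (rule int_pow_add_mod_2[symmetric])
    qed (use bc in auto)
    finally have "x \<otimes> y = (\<Otimes>i\<in>I. b i [^] ((c i + d i) mod 2))" .
    moreover have "(\<lambda>i. (c i + d i) mod 2) \<in> I \<rightarrow> {0, 1}" by auto
    ultimately show "x \<otimes> y \<in> ?V"
      by (intro CollectI exI[of _ "\<lambda>i. (c i + d i) mod 2"] conjI)
  qed
  moreover have "b i \<in> ?V" if i: "i \<in> I" for i
  proof -
    have "(\<Otimes>j\<in>I. b j [^] (if j = i then 1 else 0 :: int)) = (\<Otimes>j\<in>I. if j = i then b j else \<one>)"
      by (rule finprod_cong') (use b in \<open>auto simp: int_pow_1\<close>)
    also have "\<dots> = b i" by (rule finprod_singleton_swap) (use I i b in auto)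
    finally show ?thesis
      by (intro CollectI exI[of _ "\<lambda>j. if j = i then 1 else 0"]) auto
  qed
  ultimately have "generate A (insert \<one> (b ` I)) \<subseteq> ?V"
    using V1 by (intro generate_subgroup_incl) auto
  then show "\<exists>c\<in>I \<rightarrow> {0, 1 :: int}. v = (\<Otimes>i\<in>I. b i [^] c i)" using v span by blast
qed (use I b module_zmod_2 in auto)

end

section \<open>The second component of the Lie ring\<close>

context group
begin

text \<open>Conjugation by an involution p inverts [p, x]. Hence the square of a basic commutator
  lies one step deeper in the series, which is where the coefficients modulo 2 come from.\<close>

lemma commutator_involution_squared:
  assumes p: "p \<in> carrier G" "p \<otimes> p = \<one>" and x: "x \<in> carrier G"
  shows "commutator G p (commutator G p x) = inv (commutator G p x \<otimes> commutator G p x)"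
proof -
  have i: "inv p = p" by (rule inv_equality) (use p in auto)
  have pp: "p \<otimes> (p \<otimes> y) = y" if "y \<in> carrier G" for y using that p by (simp flip: m_assoc)
  show ?thesis using p x by (simp add: commutator_def i pp group_word_simps)
qed

end

context wB_large_circles
begin

abbreviation L2 where "L2 \<equiv> lie_component G 2"

lemma \<Gamma>3_\<Gamma>2: "\<Gamma> 3 \<subseteq> \<Gamma> 2"
  using \<Gamma>3_H \<Gamma>2_eq_H by simp

lemma L2_eq: "L2 = (G\<lparr>carrier := \<Gamma> 2\<rparr>) Mod \<Gamma> 3"
  by (simp add: lie_component_def)

lemma normal_\<Gamma>3_\<Gamma>2: "\<Gamma> 3 \<lhd> G\<lparr>carrier := \<Gamma> 2\<rparr>"
  by (rule G.normal_restrict_supergroup[OF G.lower_central_subgroup G.lower_central_normal \<Gamma>3_\<Gamma>2])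

lemma L2_simps:
  "carrier L2 = (\<lambda>x. \<Gamma> 3 #>\<^bsub>G\<^esub> x) ` \<Gamma> 2"
  "\<one>\<^bsub>L2\<^esub> = \<Gamma> 3"
  by (simp_all add: L2_eq carrier_FactGroup)

lemma L2_mult:
  assumes "x \<in> \<Gamma> 2" "y \<in> \<Gamma> 2"
  shows "(\<Gamma> 3 #>\<^bsub>G\<^esub> x) \<otimes>\<^bsub>L2\<^esub> (\<Gamma> 3 #>\<^bsub>G\<^esub> y) = \<Gamma> 3 #>\<^bsub>G\<^esub> (x \<bullet> y)"
  using normal.rcos_sum[OF normal_\<Gamma>3_\<Gamma>2, of x y] assms by (simp add: L2_eq)

lemma coset_\<Gamma>3_eq_iff:
  assumes "x \<in> carrier G" "y \<in> carrier G"
  shows "\<Gamma> 3 #>\<^bsub>G\<^esub> x = \<Gamma> 3 #>\<^bsub>G\<^esub> y \<longleftrightarrow> (\<exists>k\<in>\<Gamma> 3. x = k \<bullet> y)"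
proof
  assume "\<Gamma> 3 #>\<^bsub>G\<^esub> x = \<Gamma> 3 #>\<^bsub>G\<^esub> y"
  then have "x \<in> \<Gamma> 3 #>\<^bsub>G\<^esub> y" using G.rcos_self[OF assms(1) G.lower_central_subgroup] by blast
  then show "\<exists>k\<in>\<Gamma> 3. x = k \<bullet> y" by (auto simp: r_coset_def)
next
  assume "\<exists>k\<in>\<Gamma> 3. x = k \<bullet> y"
  then show "\<Gamma> 3 #>\<^bsub>G\<^esub> x = \<Gamma> 3 #>\<^bsub>G\<^esub> y"
    using G.rcos_mult_left[OF G.lower_central_subgroup _ assms(2)] by auto
qed

lemma coset_\<Gamma>3_self: "x \<in> \<Gamma> 3 \<Longrightarrow> \<Gamma> 3 #>\<^bsub>G\<^esub> x = \<Gamma> 3"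
  by (rule G.coset_join2[OF \<Gamma>_closed G.lower_central_subgroup])

lemma commutator_\<Gamma>3: "x \<in> carrier G \<Longrightarrow> y \<in> \<Gamma> 2 \<Longrightarrow> commutator G x y \<in> \<Gamma> 3"
  using G.commutator_mem_lower_central_Suc[of 2 x y] by (simp add: numeral_3_eq_3 numeral_2_eq_2)

lemma comm_group_L2: "comm_group L2"
proof -
  interpret L: group L2
    unfolding L2_eq by (rule normal.factorgroup_is_group[OF normal_\<Gamma>3_\<Gamma>2])
  show ?thesis
  proof (rule L.group_comm_groupI)
    fix a b assume "a \<in> carrier L2" "b \<in> carrier L2"
    then obtain x y where xy: "x \<in> \<Gamma> 2" "y \<in> \<Gamma> 2" "a = \<Gamma> 3 #>\<^bsub>G\<^esub> x" "b = \<Gamma> 3 #>\<^bsub>G\<^esub> y"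
      by (auto simp: L2_simps)
    then have c: "x \<in> carrier G" "y \<in> carrier G" using \<Gamma>_closed by auto
    have "x \<bullet> y = commutator G x y \<bullet> (y \<bullet> x)"
      using c by (simp add: commutator_def G.group_word_simps)
    then have "\<Gamma> 3 #>\<^bsub>G\<^esub> (x \<bullet> y) = \<Gamma> 3 #>\<^bsub>G\<^esub> (y \<bullet> x)"
      using c commutator_\<Gamma>3[OF c(1) xy(2)] by (subst coset_\<Gamma>3_eq_iff) auto
    then show "a \<otimes>\<^bsub>L2\<^esub> b = b \<otimes>\<^bsub>L2\<^esub> a" using xy by (simp add: L2_mult)
  qed
qed

lemma coset_hom: "group_hom (G\<lparr>carrier := \<Gamma> 2\<rparr>) L2 (\<lambda>x. \<Gamma> 3 #>\<^bsub>G\<^esub> x)"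
proof -
  have "group (G\<lparr>carrier := \<Gamma> 2\<rparr>)"
    by (rule subgroup.subgroup_is_group[OF G.lower_central_subgroup G.is_group])
  moreover have "group L2" using comm_group_L2 by (simp add: comm_group_def)
  moreover have "(\<lambda>x. \<Gamma> 3 #>\<^bsub>G\<^esub> x) \<in> hom (G\<lparr>carrier := \<Gamma> 2\<rparr>) L2"
    using L2_mult by (auto simp: hom_def L2_simps)
  ultimately show ?thesis by (simp add: group_hom_def group_hom_axioms_def)
qed

text \<open>The generators of \<open>\<Gamma> 2\<close> are pushed to the quotient, where all of
  \<open>\<Gamma> 3\<close> collapses to the identity.\<close>

lemma generate_L2:
  "generate L2 (insert \<one>\<^bsub>L2\<^esub> ((\<lambda>ij. \<Gamma> 3 #>\<^bsub>G\<^esub> basic ij) ` I)) = carrier L2"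
proof -
  interpret q: group_hom "G\<lparr>carrier := \<Gamma> 2\<rparr>" L2 "\<lambda>x. \<Gamma> 3 #>\<^bsub>G\<^esub> x" by (rule coset_hom)
  let ?Y = "\<Gamma> 3 \<union> basic ` I"
  have Y: "?Y \<subseteq> \<Gamma> 2" using \<Gamma>3_\<Gamma>2 basic_mem_\<Gamma>2 by auto
  have "(\<lambda>x. \<Gamma> 3 #>\<^bsub>G\<^esub> x) ` \<Gamma> 3 = {\<one>\<^bsub>L2\<^esub>}"
    using coset_\<Gamma>3_self subgroup.one_closed[OF G.lower_central_subgroup[of 3]] by (force simp: L2_simps)
  then have "insert \<one>\<^bsub>L2\<^esub> ((\<lambda>ij. \<Gamma> 3 #>\<^bsub>G\<^esub> basic ij) ` I) = (\<lambda>x. \<Gamma> 3 #>\<^bsub>G\<^esub> x) ` ?Y"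
    by (auto simp: image_Un image_image)
  also have "generate L2 \<dots> = (\<lambda>x. \<Gamma> 3 #>\<^bsub>G\<^esub> x) ` generate (G\<lparr>carrier := \<Gamma> 2\<rparr>) ?Y"
    by (rule q.generate_img) (use Y in simp)
  also have "generate (G\<lparr>carrier := \<Gamma> 2\<rparr>) ?Y = \<Gamma> 2"
    using G.generate_consistent[OF Y G.lower_central_subgroup] \<Gamma>2_eq_H by (simp add: H_def)
  finally show ?thesis by (simp add: L2_simps)
qed

lemma basic_squared: "ij \<in> I \<Longrightarrow> basic ij \<bullet> basic ij \<in> \<Gamma> 3"
proof -
  assume ij: "ij \<in> I"
  obtain i j where ij': "ij = (i, j)" by force
  let ?p = "P (first_strand i) (first_strand i + 1)" and ?x = "X (first_strand i) (first_strand j)"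
  note m = basic_factors_mem[OF ij[unfolded ij']]
  have t: "transpose (first_strand i) (first_strand i + 1) \<in> young_subgroup lam"
    using basis_indexD(5,6)[OF ij[unfolded ij']] by (rule young_subgroup_transpose)
  have "?p \<bullet> ?p = \<one>\<^bsub>G\<^esub>"
    using perm_aut_mult[OF t t] by (simp add: perm_aut_id)
  then have "commutator G ?p (basic ij) = inv\<^bsub>G\<^esub> (basic ij \<bullet> basic ij)"
    using G.commutator_involution_squared[OF m(1) _ m(2)] by (simp add: basic_def ij')
  moreover have b: "basic ij \<in> \<Gamma> 2" using basic_mem_\<Gamma>2 ij by blast
  ultimately have "inv\<^bsub>G\<^esub> (basic ij \<bullet> basic ij) \<in> \<Gamma> 3" using commutator_\<Gamma>3[OF m(1) b] by simp
  then have "inv\<^bsub>G\<^esub> (inv\<^bsub>G\<^esub> (basic ij \<bullet> basic ij)) \<in> \<Gamma> 3"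
    by (rule subgroup.m_inv_closed[OF G.lower_central_subgroup])
  then show ?thesis using \<Gamma>_closed[OF b] by simp
qed

text \<open>In an abelian group the elements of square 1 form a subgroup, so it is enough to square
  the basic commutators.\<close>

lemma exponent_2_L2: "comm_group_exponent_2 L2"
proof -
  interpret L: comm_group L2 by (rule comm_group_L2)
  let ?T = "{v \<in> carrier L2. v \<otimes>\<^bsub>L2\<^esub> v = \<one>\<^bsub>L2\<^esub>}"
  have "subgroup ?T L2"
  proof
    fix x y assume "x \<in> ?T" "y \<in> ?T"
    moreover from this have "(x \<otimes>\<^bsub>L2\<^esub> y) \<otimes>\<^bsub>L2\<^esub> (x \<otimes>\<^bsub>L2\<^esub> y) = (x \<otimes>\<^bsub>L2\<^esub> x) \<otimes>\<^bsub>L2\<^esub> (y \<otimes>\<^bsub>L2\<^esub> y)"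
      by (simp add: L.m_ac)
    ultimately show "x \<otimes>\<^bsub>L2\<^esub> y \<in> ?T" by simp
  next
    fix x assume x: "x \<in> ?T"
    then have "inv\<^bsub>L2\<^esub> x = x" by (intro L.inv_equality) auto
    then show "inv\<^bsub>L2\<^esub> x \<in> ?T" using x by simp
  qed auto
  moreover have "insert \<one>\<^bsub>L2\<^esub> ((\<lambda>ij. \<Gamma> 3 #>\<^bsub>G\<^esub> basic ij) ` I) \<subseteq> ?T"
  proof (intro insert_subsetI image_subsetI)
    fix ij assume ij: "ij \<in> I"
    show "\<Gamma> 3 #>\<^bsub>G\<^esub> basic ij \<in> ?T"
      using basic_mem_\<Gamma>2[OF ij] coset_\<Gamma>3_self[OF basic_squared[OF ij]] by (simp add: L2_mult) (simp add: L2_simps)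
  qed simp
  ultimately have "carrier L2 \<subseteq> ?T"
    unfolding generate_L2[symmetric] by (intro L.generate_subgroup_incl)
  then show ?thesis by unfold_locales blast
qed

text \<open>Each detecting subgroup K contains \<open>\<Gamma> 3\<close>, so membership in K is
  constant on cosets. The image of its intersection with \<open>\<Gamma> 2\<close> therefore still
  separates one basic class from the others.\<close>

lemma basis_L2:
  assumes "\<And>ij. ij \<in> I \<Longrightarrow> b ij = \<Gamma> 3 #>\<^bsub>G\<^esub> basic ij"
  shows "finite_basis (residue_ring 2) (zmod_module L2) b I"
proof -
  interpret L: comm_group_exponent_2 L2 by (rule exponent_2_L2)
  have im: "b ` J = (\<lambda>ij. \<Gamma> 3 #>\<^bsub>G\<^esub> basic ij) ` J" if "J \<subseteq> I" for J
    using that assms by (intro image_cong) auto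
  show ?thesis
  proof (rule L.finite_basisI)
    have "I \<subseteq> {..<length lam} \<times> {..<length lam}"
      by (auto simp: basis_index_def P_blocks_def S_blocks_def)
    then show "finite I" by (rule finite_subset) simp
    show "b ` I \<subseteq> carrier L2" using basic_mem_\<Gamma>2 by (auto simp: im L2_simps)
    show "carrier L2 \<subseteq> generate L2 (insert \<one>\<^bsub>L2\<^esub> (b ` I))" using generate_L2 by (simp add: im)
    fix ij assume ij: "ij \<in> I"
    obtain K where K: "subgroup K G" "\<Gamma> 3 \<subseteq> K" "basic ij \<notin> K" "basic ` (I - {ij}) \<subseteq> K"
      using detecting_subgroup[OF ij] by blast
    interpret K: subgroup K G by fact
    interpret q: group_hom "G\<lparr>carrier := \<Gamma> 2\<rparr>" L2 "\<lambda>x. \<Gamma> 3 #>\<^bsub>G\<^esub> x" by (rule coset_hom)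
    let ?K = "(\<lambda>x. \<Gamma> 3 #>\<^bsub>G\<^esub> x) ` (K \<inter> \<Gamma> 2)"
    have "subgroup (K \<inter> \<Gamma> 2) (G\<lparr>carrier := \<Gamma> 2\<rparr>)"
      by (rule G.subgroup_incl[OF G.subgroups_Inter_pair[OF K(1) G.lower_central_subgroup] G.lower_central_subgroup]) auto
    then have "subgroup ?K L2" by (rule q.subgroup_img_is_subgroup)
    moreover have "b ij \<notin> ?K"
    proof
      assume "b ij \<in> ?K"
      then obtain x where x: "x \<in> K" "x \<in> \<Gamma> 2" "\<Gamma> 3 #>\<^bsub>G\<^esub> basic ij = \<Gamma> 3 #>\<^bsub>G\<^esub> x"
        using assms[OF ij] by auto
      then obtain k where "k \<in> \<Gamma> 3" "basic ij = k \<bullet> x"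
        using coset_\<Gamma>3_eq_iff[of "basic ij" x] basic_mem_\<Gamma>2[OF ij] \<Gamma>_closed by auto
      then show False using K x by auto
    qed
    moreover have "b ` (I - {ij}) \<subseteq> ?K"
      using K(4) basic_mem_\<Gamma>2 by (auto simp: im)
    ultimately show "\<exists>K. subgroup K L2 \<and> b ij \<notin> K \<and> b ` (I - {ij}) \<subseteq> K" by blast
  qed
qed

section \<open>Brackets of the generators\<close>

text \<open>The product form of \<open>sigma_aut\<close>: commutation with a generator s splits into
  commutation with a \<chi> and with a \<tau>.\<close>

definition sig :: "nat \<Rightarrow> nat word \<Rightarrow> nat word" where
  "sig a = X (a + 1) a \<bullet> P a (a + 1)"

fun gen_rep :: "ab_gen \<Rightarrow> nat word \<Rightarrow> nat word" where
  "gen_rep (Gen_s i) = sig (first_strand i)"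
| "gen_rep (Gen_t i) = P (first_strand i) (first_strand i + 1)"
| "gen_rep (Gen_r i) = R (first_strand i)"
| "gen_rep (Gen_x i j) = X (first_strand i) (first_strand j)"

lemma comm3_mult_left:
  "a \<in> carrier G \<Longrightarrow> comm3 x a \<Longrightarrow> comm3 y a \<Longrightarrow> comm3 (x \<bullet> y) a"
  unfolding comm3_def by (rule subgroup.m_closed[OF G.subgroup_cent_mod[OF G.lower_central_normal]])

lemma comm3_mult_right:
  assumes "a \<in> carrier G" "x \<in> carrier G" "y \<in> carrier G" "comm3 a x" "comm3 a y"
  shows "comm3 a (x \<bullet> y)"
proof (rule comm3_sym)
  show "comm3 (x \<bullet> y) a"
    by (rule comm3_mult_left[OF assms(1) comm3_sym[OF assms(1,2,4)] comm3_sym[OF assms(1,3,5)]])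
qed (use assms in auto)

lemma first_strand_Suc_mem:
  "k < length lam \<Longrightarrow> 2 \<le> lam ! k \<Longrightarrow> first_strand k + 1 \<in> B k"
  using first_strand_Suc[of k] by (simp add: block_eq)

lemma sig_class:
  assumes "k \<in> IS" "a \<in> B k" "a + 1 \<in> B k" "b \<in> B k" "b + 1 \<in> B k"
  shows "sig a \<in> carrier G" "ab_class G (sig a) = ab_class G (sig b)"
proof -
  obtain \<pi> where \<pi>: "\<pi> \<in> young_subgroup lam" "\<pi> a = b" "\<pi> (a + 1) = b + 1"
    using young_subgroup_2_transitive[of a lam k "a + 1" k b "b + 1"] assms by auto
  let ?p = "perm_aut n \<pi>"
  have m: "X (c + 1) c \<in> carrier G" "P c (c + 1) \<in> carrier G" if "c \<in> B k" "c + 1 \<in> B k" for c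
    using that assms(1) by (auto intro: X_mem P_mem)
  note ma = m[OF assms(2,3)] and mb = m[OF assms(4,5)] and mp = perm_aut_mem[OF \<pi>(1)]
  show "sig a \<in> carrier G" using ma by (simp add: sig_def)
  have "inj \<pi>" using \<pi>(1) permutes_inj by (auto simp: young_subgroup_iff)
  then have "\<pi> \<circ> transpose a (a + 1) = transpose b (b + 1) \<circ> \<pi>" using comp_transpose[of \<pi> a "a + 1"] \<pi> by simp
  then have 1: "?p \<bullet> P a (a + 1) = P b (b + 1) \<bullet> ?p"
    using \<pi>(1) young_subgroup_transpose assms by (simp add: perm_aut_mult)
  have 2: "?p \<bullet> X (a + 1) a = X (b + 1) b \<bullet> ?p"
    using perm_aut_chi_aut[OF \<pi>(1), of "a + 1" a] \<pi> assms block_less S_block_strand by simp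
  have "?p \<bullet> sig a = (?p \<bullet> X (a + 1) a) \<bullet> P a (a + 1)"
    using ma mp by (simp add: sig_def G.m_assoc)
  also have "\<dots> = X (b + 1) b \<bullet> (?p \<bullet> P a (a + 1))"
    unfolding 2 using ma mb mp by (simp add: G.m_assoc)
  also have "\<dots> = sig b \<bullet> ?p"
    unfolding 1 using mb mp by (simp add: sig_def G.m_assoc)
  finally show "ab_class G (sig a) = ab_class G (sig b)"
    using ma mb mp by (intro G.ab_class_intertwine[of ?p]) (simp_all add: sig_def)
qed

lemma S_block_large:
  assumes "k \<in> IS"
  shows "k < length lam \<and> 2 \<le> lam ! k"
proof -
  have k: "k < length lam" using assms by (simp add: S_blocks_def)
  then have "4 \<le> lam ! k" using card_S_block[OF assms] card_block[OF k] by (simp only:)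
  then show ?thesis using k by simp
qed

end

text \<open>An empty block would leave \<open>Gen_x i j\<close> without representatives, and
  \<open>the_elem\<close> without meaning. Positivity puts the first strand of every block inside
  it.\<close>

locale wB_pos = wB_large_circles +
  assumes pos: "\<forall>k\<in>set lamP. 0 < k"
begin

lemma lam_pos: "k < length lam \<Longrightarrow> 0 < lam ! k"
  using pos four nth_mem[of k lam] by fastforce

lemma first_strand_mem_pos: "k < length lam \<Longrightarrow> first_strand k \<in> B k"
  by (simp add: first_strand_mem lam_pos)

lemma ab_gens_cases:
  assumes "g \<in> ab_gens lamP lamS"
  obtains (s) i where "g = Gen_s i" "i \<in> IS"
    | (t) i where "g = Gen_t i" "i < length lam" "2 \<le> lam ! i"
    | (r) i where "g = Gen_r i" "i \<in> IS"
    | (x) i j where "g = Gen_x i j" "i < length lam" "j \<in> IS" "i \<noteq> j"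
proof -
  have "P_blocks lamP lamS \<union> IS = {..<length lam}" by (auto simp: P_blocks_def S_blocks_def)
  then show thesis using assms that unfolding ab_gens_def Let_def by auto
qed

lemma x_strands:
  assumes "i < length lam" "j \<in> IS" "i \<noteq> j"
  shows "first_strand i \<in> B i" "first_strand j \<in> B j" "first_strand i \<noteq> first_strand j"
  using assms first_strand_mem_pos[of i] first_strand_mem_S[of j] block_inj by (blast, blast, metis)

lemma t_strands:
  assumes "i < length lam" "2 \<le> lam ! i"
  shows "first_strand i \<in> B i" "first_strand i + 1 \<in> B i" "first_strand i \<noteq> first_strand i + 1"
  using first_strand_mem_pos first_strand_Suc_mem assms by auto

lemma s_strands:
  assumes "i \<in> IS"
  shows "first_strand i \<in> B i" "first_strand i + 1 \<in> B i"
proof -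
  have i: "i < length lam" and "2 \<le> lam ! i" using S_block_large[OF assms] by blast+
  then show "first_strand i \<in> B i" "first_strand i + 1 \<in> B i"
    using t_strands(1,2)[OF i] by blast+
qed

lemma the_elem_image_const:
  assumes "x \<in> S" "\<And>y. y \<in> S \<Longrightarrow> f y = f x"
  shows "the_elem (f ` S) = f x"
proof -
  have "f ` S = (\<lambda>_. f x) ` S" by (rule image_cong[OF refl assms(2)])
  then show ?thesis using assms(1) by (simp add: image_constant)
qed

text \<open>Justifies \<open>the_elem\<close> in \<open>ab_gen_class\<close>: permutations
  preserving the blocks carry the representatives of a generator to each other, so their class is
  indeed common.\<close>

lemma gen_class:
  assumes "g \<in> ab_gens lamP lamS"
  shows "gen_rep g \<in> carrier G" "ab_gen_class lamP lamS g = ab_class G (gen_rep g)"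
proof -
  have "gen_rep g \<in> carrier G \<and> ab_gen_class lamP lamS g = ab_class G (gen_rep g)"
    using assms
  proof (cases rule: ab_gens_cases)
    case (s i)
    note ss = s_strands[OF s(2)]
    have sigma: "sigma_aut n a = sig a" if "a \<in> B i" "a + 1 \<in> B i" for a
      unfolding sig_def
      by (rule sigma_aut_eq[OF S_block_strand[OF s(2) that(1)] block_less[OF that(2)] young_subgroup_transpose[OF that]])
    have reps: "ab_gen_reps lamP lamS g = {sigma_aut n a | a. a \<in> B i \<and> a + 1 \<in> B i}"
      by (simp add: s(1) n_def)
    have "ab_gen_class lamP lamS g = ab_class G (sig (first_strand i))"
      unfolding ab_gen_class_def
    proof (rule the_elem_image_const)
      show "sig (first_strand i) \<in> ab_gen_reps lamP lamS g"
        unfolding reps sigma[OF ss, symmetric] using ss by blast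
      fix y assume "y \<in> ab_gen_reps lamP lamS g"
      then obtain a where a: "a \<in> B i" "a + 1 \<in> B i" "y = sigma_aut n a" unfolding reps by blast
      show "ab_class G y = ab_class G (sig (first_strand i))"
        unfolding a(3) sigma[OF a(1,2)] by (rule sig_class(2)[OF s(2) a(1,2) ss])
    qed
    then show ?thesis using sig_class(1)[OF s(2) ss ss] by (simp add: s(1))
  next
    case (t i)
    note ts = t_strands[OF t(2,3)]
    have reps: "ab_gen_reps lamP lamS g = {P a (a + 1) | a. a \<in> B i \<and> a + 1 \<in> B i}"
      unfolding t(1) ab_gen_reps.simps n_def[symmetric] tau_aut_eq by (rule refl)
    have "ab_gen_class lamP lamS g = ab_class G (P (first_strand i) (first_strand i + 1))"
      unfolding ab_gen_class_def
    proof (rule the_elem_image_const)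
      show "P (first_strand i) (first_strand i + 1) \<in> ab_gen_reps lamP lamS g"
        unfolding reps using ts by blast
      fix y assume "y \<in> ab_gen_reps lamP lamS g"
      then obtain a where a: "a \<in> B i" "a + 1 \<in> B i" "y = P a (a + 1)" unfolding reps by blast
      show "ab_class G y = ab_class G (P (first_strand i) (first_strand i + 1))"
        unfolding a(3) by (rule P_class[OF a(1,2) _ ts]) simp
    qed
    then show ?thesis using P_mem[OF ts(1,2)] by (simp add: t(1))
  next
    case (r i)
    note rs = s_strands(1)[OF r(2)]
    have reps: "ab_gen_reps lamP lamS g = R ` B i"
      by (auto simp: r(1) n_def)
    have "ab_gen_class lamP lamS g = ab_class G (R (first_strand i))"
      unfolding ab_gen_class_def
    proof (rule the_elem_image_const)
      show "R (first_strand i) \<in> ab_gen_reps lamP lamS g"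
        unfolding reps using rs by blast
      fix y assume "y \<in> ab_gen_reps lamP lamS g"
      then obtain a where a: "a \<in> B i" "y = R a" unfolding reps by blast
      show "ab_class G y = ab_class G (R (first_strand i))"
        unfolding a(2) by (rule R_class[OF r(2) a(1) rs])
    qed
    then show ?thesis using R_mem[OF r(2) rs] by (simp add: r(1))
  next
    case (x i j)
    note xs = x_strands[OF x(2-4)]
    have reps: "ab_gen_reps lamP lamS g = {X a b | a b. a \<in> B i \<and> b \<in> B j}"
      by (simp add: x(1) n_def)
    have "ab_gen_class lamP lamS g = ab_class G (X (first_strand i) (first_strand j))"
      unfolding ab_gen_class_def
    proof (rule the_elem_image_const)
      show "X (first_strand i) (first_strand j) \<in> ab_gen_reps lamP lamS g"
        unfolding reps using xs by blast
      fix y assume "y \<in> ab_gen_reps lamP lamS g"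
      then obtain a b where a: "a \<in> B i" "b \<in> B j" "y = X a b" unfolding reps by blast
      have "a \<noteq> b" using a x(4) block_inj by metis
      then show "ab_class G y = ab_class G (X (first_strand i) (first_strand j))"
        unfolding a(3) by (rule X_class[OF a(1) xs(1) x(3) a(2) xs(2) _ xs(3)])
    qed
    then show ?thesis using X_mem[OF xs(1) x(3) xs(2,3)] by (simp add: x(1))
  qed
  then show "gen_rep g \<in> carrier G" "ab_gen_class lamP lamS g = ab_class G (gen_rep g)" by auto
qed

lemma gen_bracket_eq:
  assumes "g \<in> ab_gens lamP lamS" "h \<in> ab_gens lamP lamS"
  shows "gen_bracket lamP lamS g h = \<Gamma> 3 #>\<^bsub>G\<^esub> commutator G (gen_rep g) (gen_rep h)"
  unfolding gen_bracket_def gen_class(2)[OF assms(1)] gen_class(2)[OF assms(2)]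
  by (rule G.lie_bracket_ab_class[OF gen_class(1)[OF assms(1)] gen_class(1)[OF assms(2)]])

lemma gen_bracket_basic:
  assumes "(i, j) \<in> I"
  shows "gen_bracket lamP lamS (Gen_t i) (Gen_x i j) = \<Gamma> 3 #>\<^bsub>G\<^esub> basic (i, j)"
proof -
  have "Gen_t i \<in> ab_gens lamP lamS" "Gen_x i j \<in> ab_gens lamP lamS"
    using assms by (auto simp: basis_index_def ab_gens_def Let_def P_blocks_def S_blocks_def)
  then show ?thesis by (simp add: gen_bracket_eq basic_def)
qed

lemma comm3_P_gen:
  assumes ab: "a \<in> B k" "b \<in> B k" "a \<noteq> b" and g: "g \<in> ab_gens lamP lamS"
    and ok: "\<And>j. g = Gen_x k j \<Longrightarrow> 3 \<le> card (B k)"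
  shows "comm3 (P a b) (gen_rep g)"
  using g
proof (cases rule: ab_gens_cases)
  case (s i)
  note ss = s_strands[OF s(2)]
  have "comm3 (P a b) (X (first_strand i + 1) (first_strand i))"
    by (rule comm3_P_X[OF ab ss(2) s(2) ss(1)]) (use card_S_block[OF s(2)] in auto)
  moreover have "comm3 (P a b) (P (first_strand i) (first_strand i + 1))"
    by (rule comm3_P_P[OF ab ss]) simp
  ultimately show ?thesis
    using P_mem[OF ab(1,2)] P_mem[OF ss] X_mem[OF ss(2) s(2) ss(1)]
    by (simp add: s(1) sig_def comm3_mult_right)
next
  case (t i)
  show ?thesis unfolding t(1) gen_rep.simps by (rule comm3_P_P[OF ab t_strands[OF t(2,3)]])
next
  case (r i)
  show ?thesis unfolding r(1) gen_rep.simps by (rule comm3_P_R[OF ab r(2) s_strands(1)[OF r(2)]])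
next
  case (x i j)
  note xs = x_strands[OF x(2-4)]
  show ?thesis unfolding x(1) gen_rep.simps
    by (rule comm3_P_X[OF ab xs(1) x(3) xs(2,3)]) (use ok x(1) in auto)
qed

lemma comm3_R_gen:
  assumes a: "k \<in> IS" "a \<in> B k" and g: "g \<in> ab_gens lamP lamS"
  shows "comm3 (R a) (gen_rep g)"
  using g
proof (cases rule: ab_gens_cases)
  case (s i)
  note ss = s_strands[OF s(2)]
  have m: "R a \<in> carrier G" "P (first_strand i) (first_strand i + 1) \<in> carrier G"
    "X (first_strand i + 1) (first_strand i) \<in> carrier G"
    using R_mem[OF a] P_mem[OF ss] X_mem[OF ss(2) s(2) ss(1)] by auto
  have "comm3 (R a) (X (first_strand i + 1) (first_strand i))"
    by (rule comm3_R_X[OF a ss(2) s(2) ss(1)]) simp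
  moreover have "comm3 (R a) (P (first_strand i) (first_strand i + 1))"
    by (rule comm3_sym[OF m(2,1) comm3_P_R[OF ss _ a]]) simp
  ultimately show ?thesis
    using m by (simp add: s(1) sig_def comm3_mult_right)
next
  case (t i)
  note ts = t_strands[OF t(2,3)]
  show ?thesis unfolding t(1) gen_rep.simps
    by (rule comm3_sym[OF P_mem[OF ts(1,2)] R_mem[OF a] comm3_P_R[OF ts a]])
next
  case (r i)
  show ?thesis unfolding r(1) gen_rep.simps by (rule comm3_R_R[OF a r(2) s_strands(1)[OF r(2)]])
next
  case (x i j)
  note xs = x_strands[OF x(2-4)]
  show ?thesis unfolding x(1) gen_rep.simps by (rule comm3_R_X[OF a xs(1) x(3) xs(2,3)])
qed

lemma comm3_X_gen:
  assumes ab: "a \<in> B k" "l \<in> IS" "b \<in> B l" "a \<noteq> b" and g: "g \<in> ab_gens lamP lamS"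
    and ok: "g = Gen_t k \<Longrightarrow> 3 \<le> card (B k)"
  shows "comm3 (X a b) (gen_rep g)"
  using g
proof (cases rule: ab_gens_cases)
  case (s i)
  note ss = s_strands[OF s(2)]
  have m: "X a b \<in> carrier G" "P (first_strand i) (first_strand i + 1) \<in> carrier G"
    "X (first_strand i + 1) (first_strand i) \<in> carrier G"
    using X_mem[OF ab] P_mem[OF ss] X_mem[OF ss(2) s(2) ss(1)] by auto
  have "comm3 (X a b) (X (first_strand i + 1) (first_strand i))"
    by (rule comm3_X_X[OF ss(2) s(2) ss(1) _ ab]) simp
  moreover have "comm3 (P (first_strand i) (first_strand i + 1)) (X a b)"
    by (rule comm3_P_X[OF ss _ ab]) (use card_S_block[OF s(2)] in auto)
  then have "comm3 (X a b) (P (first_strand i) (first_strand i + 1))"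
    by (rule comm3_sym[OF m(2,1)])
  ultimately show ?thesis
    using m by (simp add: s(1) sig_def comm3_mult_right)
next
  case (t i)
  note ts = t_strands[OF t(2,3)]
  have "comm3 (P (first_strand i) (first_strand i + 1)) (X a b)"
    by (rule comm3_P_X[OF ts ab]) (use ok t(1) in auto)
  then show ?thesis unfolding t(1) gen_rep.simps
    by (rule comm3_sym[OF P_mem[OF ts(1,2)] X_mem[OF ab]])
next
  case (r i)
  note rs = s_strands(1)[OF r(2)]
  show ?thesis unfolding r(1) gen_rep.simps
    by (rule comm3_sym[OF R_mem[OF r(2) rs] X_mem[OF ab] comm3_R_X[OF r(2) rs ab]])
next
  case (x i j)
  note xs = x_strands[OF x(2-4)]
  show ?thesis unfolding x(1) gen_rep.simps by (rule comm3_X_X[OF xs(1) x(3) xs(2,3) ab])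
qed

text \<open>A pair t, x is harmless if the block of t differs from the first block of x, or if their
  common block has a third strand. The excluded pairs are the only ones where both fail.\<close>

lemma comm3_gens:
  assumes g: "g \<in> ab_gens lamP lamS" and h: "h \<in> ab_gens lamP lamS"
    and ok: "\<And>i j. (i, j) \<in> I \<Longrightarrow> (g, h) \<noteq> (Gen_t i, Gen_x i j) \<and> (g, h) \<noteq> (Gen_x i j, Gen_t i)"
  shows "comm3 (gen_rep g) (gen_rep h)"
proof -
  have large: "3 \<le> card (B i)" if "i < length lam" "2 \<le> lam ! i" "j \<in> IS" "(i, j) \<notin> I" for i j
  proof (cases "i \<in> IS")
    case True
    then show ?thesis using card_S_block by fastforce
  next
    case False
    then have "lam ! i \<noteq> 2"
      using that by (auto simp: basis_index_def P_blocks_def S_blocks_def)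
    then show ?thesis using that card_block[of i lam] by simp
  qed
  from g show ?thesis
  proof (cases rule: ab_gens_cases)
    case (s i)
    note ss = s_strands[OF s(2)]
    have "comm3 (X (first_strand i + 1) (first_strand i)) (gen_rep h)"
      by (rule comm3_X_gen[OF ss(2) s(2) ss(1) _ h]) (use card_S_block[OF s(2)] in auto)
    moreover have "comm3 (P (first_strand i) (first_strand i + 1)) (gen_rep h)"
      by (rule comm3_P_gen[OF ss _ h]) (use card_S_block[OF s(2)] in auto)
    ultimately show ?thesis
      using gen_class(1)[OF h] by (simp add: s(1) sig_def comm3_mult_left)
  next
    case (t i)
    have "3 \<le> card (B i)" if "h = Gen_x i j" for j
    proof (rule large[OF t(2,3)])
      show "j \<in> IS" using h that by (auto simp: ab_gens_def Let_def)
      show "(i, j) \<notin> I" using ok that t(1) by blast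
    qed
    then show ?thesis unfolding t(1) gen_rep.simps by (intro comm3_P_gen[OF t_strands[OF t(2,3)] h])
  next
    case (r i)
    show ?thesis unfolding r(1) gen_rep.simps by (rule comm3_R_gen[OF r(2) s_strands(1)[OF r(2)] h])
  next
    case (x i j)
    note xs = x_strands[OF x(2-4)]
    have "3 \<le> card (B i)" if "h = Gen_t i"
    proof (rule large[OF x(2) _ x(3)])
      show "2 \<le> lam ! i" using h that by (auto simp: ab_gens_def Let_def)
      show "(i, j) \<notin> I" using ok that x(1) by blast
    qed
    then show ?thesis unfolding x(1) gen_rep.simps by (intro comm3_X_gen[OF xs(1) x(3) xs(2,3) h])
  qed
qed

lemma gen_bracket_trivial:
  assumes g: "g \<in> ab_gens lamP lamS" and h: "h \<in> ab_gens lamP lamS"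
    and ok: "\<And>i j. (i, j) \<in> I \<Longrightarrow> (g, h) \<noteq> (Gen_t i, Gen_x i j) \<and> (g, h) \<noteq> (Gen_x i j, Gen_t i)"
  shows "gen_bracket lamP lamS g h = \<one>\<^bsub>L2\<^esub>"
proof -
  have "commutator G (gen_rep g) (gen_rep h) \<in> \<Gamma> 3"
    using comm3_gens[OF assms] by (simp add: comm3_def cent_mod_def)
  then show ?thesis using gen_bracket_eq[OF g h] by (simp add: coset_\<Gamma>3_self L2_simps)
qed

lemma lcs_stops_at_3:
  assumes "I \<noteq> {}"
  shows "lcs_stops_at G 3"
proof -
  obtain ij where ij: "ij \<in> I" using assms by blast
  obtain K where "\<Gamma> 3 \<subseteq> K" "basic ij \<notin> K" by (rule detecting_subgroup[OF ij])
  then have 23: "\<Gamma> 2 \<noteq> \<Gamma> 3" using basic_mem_\<Gamma>2[OF ij] by (metis subsetD)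
  \<comment> \<open>If two consecutive terms agreed, the recursion would make the next two agree as
    well, so this follows from the difference between \<open>\<Gamma> 2\<close> and
    \<open>\<Gamma> 3\<close>.\<close>
  have "\<Gamma> 1 \<noteq> \<Gamma> 2"
  proof
    assume "\<Gamma> 1 = \<Gamma> 2"
    moreover have "\<Gamma> 3 = commutator_subgroup G (carrier G) (\<Gamma> 2)" "\<Gamma> 2 = commutator_subgroup G (carrier G) (\<Gamma> 1)"
      using G.lower_central_Suc[of 2] G.lower_central_Suc[of 1] by (simp_all add: numeral_3_eq_3 numeral_2_eq_2)
    ultimately show False using 23 by simp
  qed
  then have "\<Gamma> i \<noteq> \<Gamma> (i + 1)" if "1 \<le> i" "i < 3" for i
  proof -
    have "i = 1 \<or> i = 2" using that by linarith
    then show ?thesis using \<open>\<Gamma> 1 \<noteq> \<Gamma> 2\<close> 23 by (elim disjE) (simp_all add: numeral_3_eq_3 numeral_2_eq_2)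
  qed
  moreover have "\<Gamma> 3 = \<Gamma> (3 + 1)" using \<Gamma>3_eq_\<Gamma>4 by simp
  ultimately show ?thesis unfolding lcs_stops_at_def by simp
qed

end

theorem proposition5p21:
  fixes lamP lamS :: "nat list"
  assumes "\<forall>k\<in>set lamP. 0 < k"
    and "2 \<in> set lamP"
    and "lamS \<noteq> []"
    and "\<forall>k\<in>set lamS. 4 \<le> k"
  shows "lcs_stops_at (wB lamP lamS) 3 \<and>
    finite_basis (residue_ring 2) (zmod_module (lie_component (wB lamP lamS) 2))
      (\<lambda>(i, j). gen_bracket lamP lamS (Gen_t i) (Gen_x i j)) (basis_index lamP lamS) \<and>
    (\<forall>g \<in> ab_gens lamP lamS. \<forall>h \<in> ab_gens lamP lamS.
       (\<forall>(i, j) \<in> basis_index lamP lamS.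
          (g, h) \<noteq> (Gen_t i, Gen_x i j) \<and> (g, h) \<noteq> (Gen_x i j, Gen_t i)) \<longrightarrow>
       gen_bracket lamP lamS g h = \<one>\<^bsub>lie_component (wB lamP lamS) 2\<^esub>)"
proof -
  interpret wB_pos lamP lamS by unfold_locales (fact assms)+
  obtain i where i: "i < length lamP" "lamP ! i = 2" using assms(2) by (auto simp: in_set_conv_nth)
  \<comment> \<open>Counting from 0, \<open>length lamP\<close> is the index of the first circle
    block, which exists because \<open>lamS\<close> is not empty.\<close>
  have "(i, length lamP) \<in> I"
    using i assms(3) by (simp add: basis_index_def P_blocks_def S_blocks_def nth_append)
  then have "I \<noteq> {}" by blast
  moreover have "finite_basis (residue_ring 2) (zmod_module L2)
      (\<lambda>(i, j). gen_bracket lamP lamS (Gen_t i) (Gen_x i j)) I"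
  proof (rule basis_L2)
    fix ij assume "ij \<in> I"
    then show "(case ij of (i, j) \<Rightarrow> gen_bracket lamP lamS (Gen_t i) (Gen_x i j)) = \<Gamma> 3 #>\<^bsub>G\<^esub> basic ij"
      using gen_bracket_basic by (cases ij) simp
  qed
  ultimately show ?thesis
    using lcs_stops_at_3 gen_bracket_trivial by blast
qed

end
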